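(* Let $\{X_n, n\ge 1\}$ be a sequence of independent random variables, identically distributed as $X$, in the sublinear expectation space $(\Omega,\mathcal{H},\mathbb{E})$. Let $p>0$, $r>1$, $q>\frac12$, $\beta=-q/r<0$, and suppose that $\mathbb{E}X=-\mathbb{E}(-X)=0$ in the case $\frac12<q\le 1$. Suppose that $\{a_{ni}, 1\le i\le n, n\ge 1\}$ is a triangular array of real numbers with $a_{ni}\approx (i/n)^{\beta}(1/n^{q})$. Then the condition that, for every $\epsilon>0$, $$\sum_{n=1}^{\infty}n^{r-2}\,C_{\mathbb{V}}\left(\left(\max_{1\le k\le n}\left|\sum_{i=1}^{k}a_{ni}X_{i}\right|^p-\epsilon\right)^{+}\right)<\infty$$ is equivalent to $$\begin{cases} C_{\mathbb{V}}\left(|X|^{p}\right)<\infty, & \text{if } p>r/q,\\ C_{\mathbb{V}}\left(|X|^{r/q}\ln^2|X|\right)<\infty, & \text{if } p=r/q,\\ C_{\mathbb{V}}\left(|X|^{r/q}\ln|X|\right)<\infty, & \text{if } p<r/q.\end{cases}$$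
   Context: Setting. $(\Omega,\mathcal{F})$ is a measurable space and $\mathcal{H}$ is a set of real random variables on $(\Omega,\mathcal{F})$ such that $I_A\in\mathcal{H}$ for all $A\in\mathcal{F}$ and such that $X_1,\dots,X_n\in\mathcal{H}$ implies $\varphi(X_1,\dots,X_n)\in\mathcal{H}$ for every $\varphi\in C_{l,Lip}(\mathbb{R}^n)$, the space of functions satisfying $|\varphi(\mathbf{x})-\varphi(\mathbf{y})|\le C(1+|\mathbf{x}|^m+|\mathbf{y}|^m)|\mathbf{x}-\mathbf{y}|$ for all $\mathbf{x},\mathbf{y}\in\mathbb{R}^n$, with some $C>0$, $m\in\mathbb{N}$ depending on $\varphi$. A sublinear expectation is a functional $\mathbb{E}:\mathcal{H}\to[-\infty,\infty]$ such that for all $X,Y\in\mathcal{H}$: (a) $X\ge Y$ implies $\mathbb{E}[X]\ge\mathbb{E}[Y]$; (b) $\mathbb{E}[c]=c$ for $c\in\mathbb{R}$; (c) $\mathbb{E}[\lambda X]=\lambda\mathbb{E}[X]$ for $\lambda\ge0$; (d) $\mathbb{E}[X+Y]\le\mathbb{E}[X]+\mathbb{E}[Y]$ whenever the right side is not of the form $\infty-\infty$ or $-\infty+\infty$. Then $(\Omega,\mathcal{H},\mathbb{E})$ is a sublinear expectation space. Standing assumption: $\mathbb{E}$ is countably sub-additive, i.e. $\mathbb{E}(X)\le\sum_{n=1}^\infty\mathbb{E}(X_n)$ whenever $X\le\sum_{n=1}^\infty X_n$ with $X,X_n\in\mathcal{H}$, $X\ge0$, $X_n\ge0$. The capacity is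 $\mathbb{V}(A):=\mathbb{E}[I_A]$ for $A\in\mathcal{F}$, and the Choquet expectation of a random variable $X$ is $C_{\mathbb{V}}(X):=\int_0^\infty\mathbb{V}(X>x)\,dx+\int_{-\infty}^0(\mathbb{V}(X>x)-1)\,dx$. Independence. A random vector $\mathbf{Y}=(Y_1,\dots,Y_n)$, $Y_i\in\mathcal{H}$, is independent of $\mathbf{X}=(X_1,\dots,X_m)$, $X_i\in\mathcal{H}$, if for each Borel-measurable $\psi$ on $\mathbb{R}^m\times\mathbb{R}^n$ with $\psi(\mathbf{X},\mathbf{Y})\in\mathcal{H}$ and $\psi(\mathbf{x},\mathbf{Y})\in\mathcal{H}$ for each $\mathbf{x}\in\mathbb{R}^m$, one has $\mathbb{E}[\psi(\mathbf{X},\mathbf{Y})]=\mathbb{E}\big[\mathbb{E}[\psi(\mathbf{x},\mathbf{Y})]|_{\mathbf{x}=\mathbf{X}}\big]$ whenever $\bar\psi(\mathbf{x}):=\mathbb{E}[|\psi(\mathbf{x},\mathbf{Y})|]<\infty$ for each $\mathbf{x}$ and $\mathbb{E}[|\bar\psi(\mathbf{X})|]<\infty$. A sequence $(X_n)$ is a sequence of independent random variables if $X_{n+1}$ is independent of $(X_1,\dots,X_n)$ for each $n\ge1$. Identical distribution. $X$ and $Y$ are identically distributed if $\mathbb{E}[\psi(X)]=\mathbb{E}[\psi(Y)]$ for every Borel-measurable $\psi$ with $\psi(X),\psi(Y)\in\mathcal{H}$, whenever these sublinear expectations are finite. Notation. $x^+=\max\{x,0\}$. For the array, $a_{ni}\approx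 b_{ni}$ (with $b_{ni}>0$) means there is a constant $C\ge1$, independent of $i$ and $n$, with $C^{-1}b_{ni}\le a_{ni}\le C b_{ni}$ for all indices $i$ of the $n$-th row and all sufficiently large $n$. The expressions $|X|^{s}\ln|X|$ and $|X|^s\ln^2|X|$ ($s>0$) are read as $0$ where $X=0$; $\ln^2|X|=(\ln|X|)^2$. *)

theory Defs
  imports "HOL-Analysis.Analysis"
begin

text \<open>A vector in \<open>n\<close>-dimensional real space is a function on \<open>{1..n}\<close>, undefined elsewhere, that
  is, an element of the carrier of the following product of Borel spaces.\<close>

abbreviation borel_vec :: "nat \<Rightarrow> (nat \<Rightarrow> real) measure" where
  "borel_vec n \<equiv> Pi\<^sub>M {1..n} (\<lambda>_. borel)"

definition random_vec :: "nat \<Rightarrow> (nat \<Rightarrow> 'a \<Rightarrow> real) \<Rightarrow> 'a \<Rightarrow> nat \<Rightarrow> real" where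
  "random_vec n X \<omega> = (\<lambda>i\<in>{1..n}. X i \<omega>)"

definition C_l_Lip :: "nat \<Rightarrow> ((nat \<Rightarrow> real) \<Rightarrow> real) set" where
  "C_l_Lip n = {\<phi>. \<exists>C>0. \<exists>m::nat. \<forall>x\<in>space (borel_vec n). \<forall>y\<in>space (borel_vec n).
     \<bar>\<phi> x - \<phi> y\<bar> \<le> C * (1 + L2_set x {1..n} ^ m + L2_set y {1..n} ^ m)
                     * L2_set (\<lambda>i. x i - y i) {1..n}}"

text \<open>Random variables are total functions of which only the values on \<open>space M\<close> matter; the
  assumption \<open>H_cong\<close> makes \<open>H\<close> insensitive to the values outside \<open>space M\<close>. It is vacuous when
  \<open>space M = UNIV\<close>.\<close>

locale random_variable_space =
  fixes M :: "'a measure" and H :: "('a \<Rightarrow> real) set"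
  assumes H_measurable: "H \<subseteq> borel_measurable M"
    and H_cong: "\<And>X Y. X \<in> H \<Longrightarrow> (\<And>\<omega>. \<omega> \<in> space M \<Longrightarrow> X \<omega> = Y \<omega>) \<Longrightarrow> Y \<in> H"
    and H_indicator: "\<And>A. A \<in> sets M \<Longrightarrow> indicat_real A \<in> H"
    and H_Lip: "\<And>n X \<phi>. n \<ge> 1 \<Longrightarrow> (\<And>i. i \<in> {1..n} \<Longrightarrow> X i \<in> H) \<Longrightarrow> \<phi> \<in> C_l_Lip n
                  \<Longrightarrow> (\<lambda>\<omega>. \<phi> (random_vec n X \<omega>)) \<in> H"

text \<open>The functional \<open>E\<close> is only meaningful on \<open>H\<close>; its values elsewhere are unconstrained.\<close>

locale sublinear_expectation_space = random_variable_space M H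
  for M :: "'a measure" and H :: "('a \<Rightarrow> real) set" +
  fixes E :: "('a \<Rightarrow> real) \<Rightarrow> ereal"
  assumes E_mono: "\<And>X Y. X \<in> H \<Longrightarrow> Y \<in> H \<Longrightarrow> (\<And>\<omega>. \<omega> \<in> space M \<Longrightarrow> X \<omega> \<ge> Y \<omega>) \<Longrightarrow> E X \<ge> E Y"
    and E_const: "\<And>c. E (\<lambda>_. c) = ereal c"
    and E_pos_homogeneous: "\<And>X c. X \<in> H \<Longrightarrow> c \<ge> 0 \<Longrightarrow> E (\<lambda>\<omega>. c * X \<omega>) = ereal c * E X"
    and E_subadditive: "\<And>X Y. X \<in> H \<Longrightarrow> Y \<in> H
          \<Longrightarrow> \<not> (E X = \<infinity> \<and> E Y = -\<infinity>) \<Longrightarrow> \<not> (E X = -\<infinity> \<and> E Y = \<infinity>)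
          \<Longrightarrow> E (\<lambda>\<omega>. X \<omega> + Y \<omega>) \<le> E X + E Y"

text \<open>The pointwise series may diverge, so it is taken in the extended reals.\<close>

definition countably_subadditive_expectation ::
  "'a measure \<Rightarrow> ('a \<Rightarrow> real) set \<Rightarrow> (('a \<Rightarrow> real) \<Rightarrow> ereal) \<Rightarrow> bool" where
  "countably_subadditive_expectation M H E \<longleftrightarrow>
     (\<forall>X Y. X \<in> H \<longrightarrow> (\<forall>n::nat. Y n \<in> H) \<longrightarrow>
        (\<forall>\<omega>\<in>space M. 0 \<le> X \<omega>) \<longrightarrow> (\<forall>n. \<forall>\<omega>\<in>space M. 0 \<le> Y n \<omega>) \<longrightarrow>
        (\<forall>\<omega>\<in>space M. ereal (X \<omega>) \<le> (\<Sum>n. ereal (Y n \<omega>))) \<longrightarrow>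
        E X \<le> (\<Sum>n. E (Y n)))"

definition capacity :: "(('a \<Rightarrow> real) \<Rightarrow> ereal) \<Rightarrow> 'a set \<Rightarrow> ereal" where
  "capacity E A = E (indicat_real A)"

text \<open>Capacities lie in \<open>[0,1]\<close>, so both integrands are nonnegative and the conversions lose
  nothing. The second integral of the usual definition is minus the one subtracted here. If both
  integrals are infinite, the expectation is undefined in the literature (and \<open>\<infinity>\<close> here); this does not
  occur for random variables bounded below.\<close>

definition Choquet :: "'a measure \<Rightarrow> (('a \<Rightarrow> real) \<Rightarrow> ereal) \<Rightarrow> ('a \<Rightarrow> real) \<Rightarrow> ereal" where
  "Choquet M E X =
     enn2ereal (\<integral>\<^sup>+x\<in>{0<..}. e2ennreal (capacity E {\<omega>\<in>space M. X \<omega> > x}) \<partial>lborel)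
   - enn2ereal (\<integral>\<^sup>+x\<in>{..<0}. e2ennreal (1 - capacity E {\<omega>\<in>space M. X \<omega> > x}) \<partial>lborel)"

text \<open>\<open>indep_vec H E n Y m X\<close>: the vector \<open>(Y 1, \<dots>, Y n)\<close> is independent of \<open>(X 1, \<dots>, X m)\<close>.
  As \<open>E\<close> is a functional on \<open>H\<close>, writing \<open>E\<close> of the two random variables obtained by inserting
  \<open>X\<close> presupposes that they belong to \<open>H\<close>; this is made explicit. The conversions to real numbers
  are applied to finite values only.\<close>

definition indep_vec :: "('a \<Rightarrow> real) set \<Rightarrow> (('a \<Rightarrow> real) \<Rightarrow> ereal)
    \<Rightarrow> nat \<Rightarrow> (nat \<Rightarrow> 'a \<Rightarrow> real) \<Rightarrow> nat \<Rightarrow> (nat \<Rightarrow> 'a \<Rightarrow> real) \<Rightarrow> bool" where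
  "indep_vec H E n Y m X \<longleftrightarrow>
     (\<forall>\<psi> \<in> borel_measurable (borel_vec m \<Otimes>\<^sub>M borel_vec n).
        let \<psi>Y = (\<lambda>x \<omega>. \<psi> (x, random_vec n Y \<omega>));
            \<psi>_bar = (\<lambda>x. E (\<lambda>\<omega>. \<bar>\<psi>Y x \<omega>\<bar>));
            \<psi>_bar_X = (\<lambda>\<omega>. real_of_ereal (\<psi>_bar (random_vec m X \<omega>)));
            E\<psi>_X = (\<lambda>\<omega>. real_of_ereal (E (\<psi>Y (random_vec m X \<omega>))))
        in (\<lambda>\<omega>. \<psi> (random_vec m X \<omega>, random_vec n Y \<omega>)) \<in> H \<longrightarrow>
           (\<forall>x\<in>space (borel_vec m). \<psi>Y x \<in> H) \<longrightarrow>
           (\<forall>x\<in>space (borel_vec m). \<psi>_bar x < \<infinity>) \<longrightarrow>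
           \<psi>_bar_X \<in> H \<longrightarrow> E (\<lambda>\<omega>. \<bar>\<psi>_bar_X \<omega>\<bar>) < \<infinity> \<longrightarrow>
           E\<psi>_X \<in> H \<longrightarrow>
           E (\<lambda>\<omega>. \<psi> (random_vec m X \<omega>, random_vec n Y \<omega>)) = E E\<psi>_X)"

text \<open>Sequences are indexed from 1; the term with index 0 is ignored.\<close>

definition indep_seq ::
  "('a \<Rightarrow> real) set \<Rightarrow> (('a \<Rightarrow> real) \<Rightarrow> ereal) \<Rightarrow> (nat \<Rightarrow> 'a \<Rightarrow> real) \<Rightarrow> bool" where
  "indep_seq H E X \<longleftrightarrow> (\<forall>n\<ge>1. indep_vec H E 1 (\<lambda>_. X (Suc n)) n X)"

definition ident_distrib ::
  "('a \<Rightarrow> real) set \<Rightarrow> (('a \<Rightarrow> real) \<Rightarrow> ereal) \<Rightarrow> ('a \<Rightarrow> real) \<Rightarrow> ('a \<Rightarrow> real) \<Rightarrow> bool" where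
  "ident_distrib H E X Y \<longleftrightarrow>
     (\<forall>\<psi> \<in> borel_measurable borel.
        (\<lambda>\<omega>. \<psi> (X \<omega>)) \<in> H \<longrightarrow> (\<lambda>\<omega>. \<psi> (Y \<omega>)) \<in> H \<longrightarrow>
        \<bar>E (\<lambda>\<omega>. \<psi> (X \<omega>))\<bar> < \<infinity> \<longrightarrow> \<bar>E (\<lambda>\<omega>. \<psi> (Y \<omega>))\<bar> < \<infinity> \<longrightarrow>
        E (\<lambda>\<omega>. \<psi> (X \<omega>)) = E (\<lambda>\<omega>. \<psi> (Y \<omega>)))"

definition array_equiv :: "(nat \<Rightarrow> nat \<Rightarrow> real) \<Rightarrow> (nat \<Rightarrow> nat \<Rightarrow> real) \<Rightarrow> bool" where
  "array_equiv a b \<longleftrightarrow>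
     (\<exists>C\<ge>1. \<forall>\<^sub>F n in sequentially. \<forall>i\<in>{1..n}. b n i / C \<le> a n i \<and> a n i \<le> C * b n i)"

end

theory Submission
  imports Defs "HOL-Real_Asymp.Real_Asymp"
begin

text \<open>
  Put \<open>s = r/q\<close> and \<open>\<theta> = p/s\<close>, and let \<open>h u = V(\<bar>X\<bar>\<^sup>p > u)\<close>. The weights
  \<open>b\<^sub>n\<^sub>i = (i/n)\<^sup>\<beta> / n\<^sup>q\<close> satisfy \<open>(1/b\<^sub>n\<^sub>i)\<^sup>s = i n\<^sup>r\<^sup>-\<^sup>1\<close>, so the event \<open>\<bar>a\<^sub>n\<^sub>i X\<^sub>i\<bar>\<^sup>p > x\<close> is, up to constant
  factors in \<open>x\<close>, the event \<open>\<bar>X\<^sub>i\<bar>\<^sup>p > x t\<close> with threshold \<open>t = (i n\<^sup>r\<^sup>-\<^sup>1)\<^sup>\<theta>\<close>. Suppose for the moment that the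
  capacity of \<open>max\<^sub>k \<bar>S\<^sub>k\<bar>\<^sup>p > x\<close> may be replaced by the sum over \<open>i\<close> of these capacities \<open>h (x t)\<close>.
  Rescaling \<open>x\<close> in each integral then turns the series into \<open>\<integral> h u K(u/\<epsilon>) du\<close>, where the kernel
  \<open>K v\<close> sums \<open>n\<^sup>r\<^sup>-\<^sup>2 / t\<close> over the pairs \<open>i \<le> n\<close> with \<open>t < v\<close>. Counting lattice points gives that
  \<open>K v\<close> is of exact order \<open>1\<close>, \<open>(ln v)\<^sup>2\<close> or \<open>v\<close> to the \<open>1/\<theta> - 1\<close> times \<open>ln v\<close> according to
  \<open>\<theta> > 1\<close>, \<open>\<theta> = 1\<close> or \<open>\<theta> < 1\<close> (\<open>kernel_upper\<close>, \<open>kernel_lower\<close>). A substitution identifies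
  finiteness of the integral of \<open>h\<close> against this weight with the three moment conditions
  (\<open>moment_condition_iff\<close>). This is where the trichotomy comes from.

  The replacement is legitimate in both directions. From below, independence gives the exact
  formula \<open>1 - V(\<Union>A\<^sub>i) = \<Prod>(1 - V A\<^sub>i)\<close> for events \<open>A\<^sub>i\<close> depending on \<open>X\<^sub>i\<close> alone
  (\<open>cap_union_indep\<close>), hence a lower bound by the sum capped at one; convergence of the series
  bounds the row sums, by comparison of rows whose lengths differ by a factor at most two, and so
  removes the cap (\<open>tail_weight_integral_finite_of_capped_sums\<close>).

  From above, truncate each summand at level \<open>y/(2N)\<close> with \<open>y\<^sup>p = x\<close>. Independence, applied one
  variable at a time to the exponential of the partial sum stopped at its first passage above the
  level, yields an exponential inequality for the maximum (\<open>cap_max_exp\<close>). Optimising the exponent gives a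
  bound of Fuk-Nagaev type (\<open>cap_max_sum\<close>): besides the sum of tails there is an error of order
  \<open>(B/y\<^sup>\<tau>)\<^sup>N\<close>, with \<open>N\<close> at will and \<open>B\<close> of order \<open>n\<close> to the power \<open>1 - q \<tau>\<close>. Any \<open>\<tau>\<close> strictly
  between \<open>1/q\<close> and \<open>min(2, s)\<close> makes this summable for large \<open>N\<close>, and such a \<open>\<tau>\<close> exists since
  \<open>q > 1/2\<close> and \<open>r > 1\<close>. If \<open>q > 1\<close>, it can be taken below one, and then the power \<open>\<tau>\<close>
  dominates the linear term of the exponential; if \<open>q \<le> 1\<close>, then \<open>\<tau> > 1\<close>, and the linear term
  vanishes in expectation because the upper and lower means do.
\<close>

section \<open>Closure properties, sublinear expectations and capacities\<close>

context random_variable_space begin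

lemma H_compose:
  assumes "X \<in> H" "C > 0" "\<And>x y. \<bar>\<phi> x - \<phi> y\<bar> \<le> C * (1 + \<bar>x\<bar> ^ m + \<bar>y\<bar> ^ m) * \<bar>x - y\<bar>"
  shows "(\<lambda>\<omega>. \<phi> (X \<omega>)) \<in> H"
proof -
  have "(\<lambda>x. \<phi> (x 1)) \<in> C_l_Lip 1"
    unfolding C_l_Lip_def using assms(2,3) by (auto intro!: exI[of _ C] exI[of _ m])
  from H_Lip[OF _ _ this, of "\<lambda>_. X"] show ?thesis
    using assms(1) by (simp add: random_vec_def)
qed

lemma H_lipschitz:
  assumes "X \<in> H" "\<And>x y. \<bar>\<phi> x - \<phi> y\<bar> \<le> L * \<bar>x - y\<bar>"
  shows "(\<lambda>\<omega>. \<phi> (X \<omega>)) \<in> H"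
proof (rule H_compose[OF assms(1), where C = "\<bar>L\<bar> + 1" and m = 0])
  fix x y :: real
  have "\<bar>\<phi> x - \<phi> y\<bar> \<le> L * \<bar>x - y\<bar>" by (rule assms(2))
  also have "\<dots> \<le> ((\<bar>L\<bar> + 1) * 3) * \<bar>x - y\<bar>"
    by (intro mult_right_mono) auto
  finally show "\<bar>\<phi> x - \<phi> y\<bar> \<le> (\<bar>L\<bar> + 1) * (1 + \<bar>x\<bar> ^ 0 + \<bar>y\<bar> ^ 0) * \<bar>x - y\<bar>" by simp
qed simp

lemma H_const: "(\<lambda>_. c) \<in> H"
proof -
  have "indicat_real (space M) \<in> H" by (rule H_indicator) simp
  from H_lipschitz[OF this, of "\<lambda>_. c" 0] show ?thesis by simp
qed

lemma H_cmult: "X \<in> H \<Longrightarrow> (\<lambda>\<omega>. c * X \<omega>) \<in> H"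
  by (rule H_lipschitz[where L = "\<bar>c\<bar>"]) (auto simp: abs_mult simp flip: right_diff_distrib)

lemma H_compose2:
  assumes "X \<in> H" "Y \<in> H" "C > 0"
    and "\<And>x x' y y'. \<bar>\<phi> x y - \<phi> x' y'\<bar>
      \<le> C * (1 + sqrt (x\<^sup>2 + y\<^sup>2) ^ m + sqrt (x'\<^sup>2 + y'\<^sup>2) ^ m) * sqrt ((x - x')\<^sup>2 + (y - y')\<^sup>2)"
  shows "(\<lambda>\<omega>. \<phi> (X \<omega>) (Y \<omega>)) \<in> H"
proof -
  have s: "{1..2::nat} = {1,2}" by auto
  have L: "L2_set x {1..2::nat} = sqrt ((x 1)\<^sup>2 + (x 2)\<^sup>2)" for x
    unfolding L2_set_def s by simp
  have "(\<lambda>x. \<phi> (x 1) (x 2)) \<in> C_l_Lip 2"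
    unfolding C_l_Lip_def L using assms(3,4) by (auto intro!: exI[of _ C] exI[of _ m])
  from H_Lip[OF _ _ this, of "\<lambda>i. if i = 1 then X else Y"] show ?thesis
    using assms(1,2) by (simp add: random_vec_def)
qed

lemma H_add:
  assumes "X \<in> H" "Y \<in> H" shows "(\<lambda>\<omega>. X \<omega> + Y \<omega>) \<in> H"
proof (rule H_compose2[OF assms, where C = 2 and m = 0])
  fix x x' y y' :: real
  define d where "d = sqrt ((x - x')\<^sup>2 + (y - y')\<^sup>2)"
  have "\<bar>x - x'\<bar> \<le> d" "\<bar>y - y'\<bar> \<le> d" "0 \<le> d"
    unfolding d_def by (auto intro: real_le_rsqrt)
  then show "\<bar>x + y - (x' + y')\<bar> \<le> 2 * (1 + sqrt (x\<^sup>2 + y\<^sup>2) ^ 0 + sqrt (x'\<^sup>2 + y'\<^sup>2) ^ 0)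
      * sqrt ((x - x')\<^sup>2 + (y - y')\<^sup>2)"
    unfolding d_def[symmetric] by (simp; linarith)
qed simp

lemma H_mult:
  assumes "X \<in> H" "Y \<in> H" shows "(\<lambda>\<omega>. X \<omega> * Y \<omega>) \<in> H"
proof (rule H_compose2[OF assms, where C = 1 and m = 1])
  fix x x' y y' :: real
  define d where "d = sqrt ((x - x')\<^sup>2 + (y - y')\<^sup>2)"
  have d: "\<bar>x - x'\<bar> \<le> d" "\<bar>y - y'\<bar> \<le> d" "0 \<le> d"
    unfolding d_def by (auto intro: real_le_rsqrt)
  have b: "\<bar>x\<bar> \<le> sqrt (x\<^sup>2 + y\<^sup>2)" "\<bar>y'\<bar> \<le> sqrt (x'\<^sup>2 + y'\<^sup>2)"
    by (auto intro: real_le_rsqrt)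
  have "x * y - x' * y' = x * (y - y') + y' * (x - x')" by (simp add: algebra_simps)
  then have "\<bar>x * y - x' * y'\<bar> \<le> \<bar>x\<bar> * \<bar>y - y'\<bar> + \<bar>y'\<bar> * \<bar>x - x'\<bar>"
    by (metis abs_mult abs_triangle_ineq)
  also have "\<dots> \<le> sqrt (x\<^sup>2 + y\<^sup>2) * d + sqrt (x'\<^sup>2 + y'\<^sup>2) * d"
    using b d by (intro add_mono mult_mono) auto
  finally show "\<bar>x * y - x' * y'\<bar> \<le> 1 * (1 + sqrt (x\<^sup>2 + y\<^sup>2) ^ 1 + sqrt (x'\<^sup>2 + y'\<^sup>2) ^ 1)
      * sqrt ((x - x')\<^sup>2 + (y - y')\<^sup>2)"
    unfolding d_def[symmetric] using d by (simp add: algebra_simps)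
qed simp

lemma H_minus: "X \<in> H \<Longrightarrow> (\<lambda>\<omega>. - X \<omega>) \<in> H"
  using H_cmult[of X "-1"] by simp

lemma H_diff: "X \<in> H \<Longrightarrow> Y \<in> H \<Longrightarrow> (\<lambda>\<omega>. X \<omega> - Y \<omega>) \<in> H"
  using H_add[OF _ H_minus] by simp

lemma H_indicator_pred:
  assumes "Measurable.pred M P"
  shows "(\<lambda>\<omega>. if P \<omega> then 1 else 0) \<in> H"
proof -
  have "{\<omega>\<in>space M. P \<omega>} \<in> sets M" using assms by simp
  from H_indicator[OF this] show ?thesis
    by (rule H_cong) (auto simp: indicator_def)
qed

end

text \<open>The capacity as a real number; no information is lost on measurable sets, where it lies in
  \<open>[0,1]\<close>.\<close>

definition cap where "cap E A = real_of_ereal (capacity E A)"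

context sublinear_expectation_space begin

lemma E_cong:
  assumes "X \<in> H" "\<And>\<omega>. \<omega> \<in> space M \<Longrightarrow> X \<omega> = Y \<omega>" shows "E X = E Y"
proof -
  have "Y \<in> H" using assms by (rule H_cong)
  with assms show ?thesis by (intro antisym E_mono) auto
qed

lemma E_le_const: "X \<in> H \<Longrightarrow> (\<And>\<omega>. \<omega> \<in> space M \<Longrightarrow> X \<omega> \<le> c) \<Longrightarrow> E X \<le> ereal c"
  using E_mono[OF H_const[of c], of X] by (simp add: E_const)

lemma E_ge_const: "X \<in> H \<Longrightarrow> (\<And>\<omega>. \<omega> \<in> space M \<Longrightarrow> c \<le> X \<omega>) \<Longrightarrow> ereal c \<le> E X"
  using E_mono[OF _ H_const[of c], of X] by (simp add: E_const)

lemma E_nonneg: "X \<in> H \<Longrightarrow> (\<And>\<omega>. \<omega> \<in> space M \<Longrightarrow> 0 \<le> X \<omega>) \<Longrightarrow> 0 \<le> E X"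
  using E_ge_const[of X 0] by (simp add: zero_ereal_def)

lemma E_add_const:
  assumes "X \<in> H" shows "E (\<lambda>\<omega>. c + X \<omega>) = ereal c + E X"
proof (rule antisym)
  have "E (\<lambda>\<omega>. c + X \<omega>) \<le> E (\<lambda>_. c) + E X"
    by (rule E_subadditive) (auto simp: H_const E_const assms)
  then show "E (\<lambda>\<omega>. c + X \<omega>) \<le> ereal c + E X" by (simp add: E_const)
  have "E (\<lambda>\<omega>. - c + (c + X \<omega>)) \<le> E (\<lambda>_. - c) + E (\<lambda>\<omega>. c + X \<omega>)"
    by (rule E_subadditive) (auto simp: H_const E_const assms H_add)
  then have "E X \<le> ereal (- c) + E (\<lambda>\<omega>. c + X \<omega>)" by (simp add: E_const)
  then show "ereal c + E X \<le> E (\<lambda>\<omega>. c + X \<omega>)"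
    by (cases "E X"; cases "E (\<lambda>\<omega>. c + X \<omega>)") auto
qed

lemma capacity_bounds:
  assumes "A \<in> sets M" shows "0 \<le> capacity E A" "capacity E A \<le> 1"
  using E_nonneg[OF H_indicator[OF assms]] E_le_const[OF H_indicator[OF assms], of 1]
  by (auto simp: capacity_def indicator_def one_ereal_def split: if_splits)

lemma cap_ereal: "A \<in> sets M \<Longrightarrow> capacity E A = ereal (cap E A)"
  unfolding cap_def using capacity_bounds[of A]
  by (cases "capacity E A") auto

lemma cap_bounds: "A \<in> sets M \<Longrightarrow> 0 \<le> cap E A" "A \<in> sets M \<Longrightarrow> cap E A \<le> 1"
  using capacity_bounds[of A] cap_ereal[of A] by (auto simp: one_ereal_def zero_ereal_def)

lemma cap_mono:
  assumes "A \<in> sets M" "B \<in> sets M" "A \<subseteq> B" shows "cap E A \<le> cap E B"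
proof -
  have "capacity E A \<le> capacity E B" unfolding capacity_def
    using assms by (intro E_mono H_indicator) (auto simp: indicator_def)
  then show ?thesis using assms by (simp add: cap_ereal)
qed

lemma cap_Un:
  assumes "A \<in> sets M" "B \<in> sets M"
  shows "cap E (A \<union> B) \<le> cap E A + cap E B"
proof -
  have "capacity E (A \<union> B) \<le> E (\<lambda>\<omega>. indicat_real A \<omega> + indicat_real B \<omega>)" unfolding capacity_def
    using assms by (intro E_mono H_indicator H_add) (auto simp: indicator_def)
  also have "\<dots> \<le> capacity E A + capacity E B"
    using assms capacity_bounds[of A] capacity_bounds[of B] unfolding capacity_def
    by (intro E_subadditive H_indicator) auto
  finally show ?thesis using assms by (simp add: cap_ereal sets.Un)
qed

lemma cap_empty: "cap E {} = 0"
  using E_const[of 0] by (simp add: cap_def capacity_def indicator_def[abs_def])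

lemma cap_space: "cap E (space M) = 1"
proof -
  have "E (indicat_real (space M)) = E (\<lambda>_. 1)" by (rule E_cong) (auto simp: H_indicator)
  then show ?thesis by (simp add: cap_def capacity_def E_const)
qed

lemma cap_UN:
  assumes "finite I" "\<And>i. i \<in> I \<Longrightarrow> A i \<in> sets M"
  shows "cap E (\<Union>i\<in>I. A i) \<le> (\<Sum>i\<in>I. cap E (A i))"
  using assms
proof (induction I rule: finite_induct)
  case empty then show ?case by (simp add: cap_empty)
next
  case (insert i I)
  have "cap E (A i \<union> (\<Union>i\<in>I. A i)) \<le> cap E (A i) + cap E (\<Union>i\<in>I. A i)"
    using insert by (intro cap_Un) auto
  with insert show ?case by (simp add: )
qed

text \<open>The form in which independence is used: for an integrand that is affine in a nonnegative
  function of the new variable, the inner expectation is explicit, so that all side conditions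
  of the definition can be verified.\<close>

lemma indep_step:
  assumes ind: "indep_seq H E Xs" and n: "n \<ge> 1"
    and F: "F \<in> borel_measurable (borel_vec n)" and G: "G \<in> borel_measurable (borel_vec n)"
    and k: "k \<in> borel_measurable borel"
    and FH: "(\<lambda>\<omega>. F (random_vec n Xs \<omega>)) \<in> H" and GH: "(\<lambda>\<omega>. G (random_vec n Xs \<omega>)) \<in> H"
    and kH: "(\<lambda>\<omega>. k (Xs (Suc n) \<omega>)) \<in> H"
    and Fb: "\<And>x. 0 \<le> F x" "\<And>x. F x \<le> c" and Gb: "\<And>x. 0 \<le> G x" "\<And>x. G x \<le> c"
    and k0: "\<And>y. 0 \<le> k y"
    and e: "E (\<lambda>\<omega>. k (Xs (Suc n) \<omega>)) = ereal e"
  shows "E (\<lambda>\<omega>. F (random_vec n Xs \<omega>) + G (random_vec n Xs \<omega>) * k (Xs (Suc n) \<omega>))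
       = E (\<lambda>\<omega>. F (random_vec n Xs \<omega>) + G (random_vec n Xs \<omega>) * e)"
proof -
  define \<psi> where "\<psi> = (\<lambda>(x, y). F x + G x * k (y (1::nat)))"
  have \<psi>m: "\<psi> \<in> borel_measurable (borel_vec n \<Otimes>\<^sub>M borel_vec 1)"
    unfolding \<psi>_def using F G k by measurable
  have kH': "(\<lambda>\<omega>. g * k (Xs (Suc n) \<omega>)) \<in> H" for g by (rule H_cmult[OF kH])
  have e0: "0 \<le> e" using E_nonneg[OF kH] k0 e by simp
  have rv: "random_vec 1 (\<lambda>_. Xs (Suc n)) \<omega> 1 = Xs (Suc n) \<omega>" for \<omega>
    by (simp add: random_vec_def)
  have Ex: "E (\<lambda>\<omega>. F x + G x * k (Xs (Suc n) \<omega>)) = ereal (F x + G x * e)" for x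
    by (subst E_add_const[OF kH'], subst E_pos_homogeneous[OF kH Gb(1)]) (simp add: e)
  have nn: "\<bar>F x + G x * k y\<bar> = F x + G x * k y" for x y
    using Fb Gb k0 by simp
  have nn': "\<bar>F x + G x * e\<bar> = F x + G x * e" for x
    using Fb Gb e0 by simp
  have XH: "(\<lambda>\<omega>. F (random_vec n Xs \<omega>) + G (random_vec n Xs \<omega>) * k (Xs (Suc n) \<omega>)) \<in> H"
    by (intro H_add H_mult FH GH kH)
  have eH: "(\<lambda>\<omega>. F (random_vec n Xs \<omega>) + G (random_vec n Xs \<omega>) * e) \<in> H"
    by (intro H_add H_mult FH GH H_const)
  have "E (\<lambda>\<omega>. F (random_vec n Xs \<omega>) + G (random_vec n Xs \<omega>) * e) \<le> ereal (c + c * e)"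
    using Fb Gb e0 by (intro E_le_const eH add_mono mult_right_mono) auto
  then have fin: "E (\<lambda>\<omega>. F (random_vec n Xs \<omega>) + G (random_vec n Xs \<omega>) * e) < \<infinity>"
    by (rule order.strict_trans1) simp
  have "indep_vec H E 1 (\<lambda>_. Xs (Suc n)) n Xs" using ind n by (simp add: indep_seq_def)
  from this[unfolded indep_vec_def Let_def, rule_format, OF \<psi>m]
  show ?thesis
    unfolding \<psi>_def rv prod.case nn Ex real_of_ereal.simps nn' 
    using XH kH' eH fin by (auto simp: H_add H_const)
qed

end

section \<open>Independence: unions of events and exponential moments of maxima\<close>

definition trunc_at :: "real \<Rightarrow> real \<Rightarrow> real" where
  "trunc_at b z = max (- b) (min b z)"

text \<open>The exponential of the partial sum, stopped at the first index at which the partial sum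
  exceeds \<open>y\<close>. Written as a product, it belongs to the space of random variables because each
  factor does.\<close>

primrec stopped_exp :: "(nat \<Rightarrow> real \<Rightarrow> real) \<Rightarrow> real \<Rightarrow> nat \<Rightarrow> (nat \<Rightarrow> real) \<Rightarrow> real" where
  "stopped_exp f y 0 x = 1"
| "stopped_exp f y (Suc n) x =
     (if \<forall>k\<in>{1..n}. (\<Sum>i=1..k. f i (x i)) \<le> y then exp (f (Suc n) (x (Suc n))) else 1) * stopped_exp f y n x"

lemma sum_upto_cong: "\<lbrakk>\<And>i. i \<in> {1..n::nat} \<Longrightarrow> x i = x' i; k \<in> {1..n}\<rbrakk> \<Longrightarrow> (\<Sum>i=1..k. f i (x i)) = (\<Sum>i=1..k. f i (x' i))"
  by (rule sum.cong) auto

lemma stopped_exp_cong: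
  "(\<And>i. i \<in> {1..n} \<Longrightarrow> x i = x' i) \<Longrightarrow> stopped_exp f y n x = stopped_exp f y n x'"
proof (induction n)
  case (Suc n)
  have *: "(\<forall>k\<in>{1..n}. (\<Sum>i=1..k. f i (x i)) \<le> y) \<longleftrightarrow> (\<forall>k\<in>{1..n}. (\<Sum>i=1..k. f i (x' i)) \<le> y)"
    using sum_upto_cong[of n x x' _ f] Suc.prems by auto
  show ?case
    unfolding stopped_exp.simps * using Suc by simp
qed simp

lemma stopped_exp_nonneg: "0 \<le> stopped_exp f y n x"
  by (induction n) auto

lemma stopped_exp_le:
  assumes "\<And>i x. f i x \<le> b" "0 \<le> b"
  shows "stopped_exp f y n x \<le> exp (real n * b)"
proof (induction n)
  case (Suc n)
  have "(if \<forall>k\<in>{1..n}. (\<Sum>i=1..k. f i (x i)) \<le> y then exp (f (Suc n) (x (Suc n))) else 1) \<le> exp b"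
    using assms by auto
  then have "stopped_exp f y (Suc n) x \<le> exp b * exp (real n * b)"
    unfolding stopped_exp.simps using Suc stopped_exp_nonneg by (intro mult_mono) auto
  then show ?case by (simp add: mult_exp_exp algebra_simps)
qed simp

lemma stopped_exp_alive:
  "(\<forall>k\<in>{1..n}. (\<Sum>i=1..k. f i (x i)) \<le> y) \<Longrightarrow> stopped_exp f y n x = exp (\<Sum>i=1..n. f i (x i))"
proof (induction n)
  case (Suc n)
  then have "\<forall>k\<in>{1..n}. (\<Sum>i=1..k. f i (x i)) \<le> y" by auto
  with Suc show ?case by (simp add: mult_exp_exp add.commute)
qed simp

text \<open>Stopping happens above the level \<open>y\<close>, so that Markov's inequality for the stopped
  exponential controls the maximum of the partial sums.\<close>

lemma stopped_exp_dead:
  "\<exists>k\<in>{1..n}. y < (\<Sum>i=1..k. f i (x i)) \<Longrightarrow> exp y \<le> stopped_exp f y n x"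
proof (induction n)
  case (Suc n)
  show ?case
  proof (cases "\<forall>k\<in>{1..n}. (\<Sum>i=1..k. f i (x i)) \<le> y")
    case True
    with Suc.prems have "y < (\<Sum>i=1..Suc n. f i (x i))"
      by (metis atLeastAtMost_iff le_Suc_eq not_le)
    with True stopped_exp_alive[where n = n and x = x and f = f and y = y] show ?thesis
      by (simp add: mult_exp_exp add.commute)
  next
    case False
    with Suc.IH show ?thesis by (auto simp: not_le)
  qed
qed simp

lemma stopped_exp_measurable:
  assumes "\<And>i. f i \<in> borel_measurable borel" "n \<le> m"
  shows "stopped_exp f y n \<in> borel_measurable (borel_vec m)"
  using assms(2)
proof (induction n)
  case 0
  have "(\<lambda>x. stopped_exp f y 0 x) \<in> borel_measurable (borel_vec m)" by simp
  then show ?case .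
next
  case (Suc n)
  have *: "(\<lambda>x. f i (x i)) \<in> borel_measurable (borel_vec m)" if "i \<in> {1..m}" for i
    using assms(1) that by (intro measurable_compose[OF measurable_component_singleton]) auto
  have "(\<lambda>x. \<Sum>i=1..k. f i (x i)) \<in> borel_measurable (borel_vec m)" if "k \<in> {1..n}" for k
    using that Suc.prems by (intro borel_measurable_sum *) auto
  with * have "(\<lambda>x. stopped_exp f y (Suc n) x) \<in> borel_measurable (borel_vec m)"
    unfolding stopped_exp.simps using Suc
    by (intro borel_measurable_times measurable_If borel_measurable_exp pred_intros_finite) 
       (auto intro!: borel_measurable_le)
  then show ?case by simp
qed

context sublinear_expectation_space begin

lemma E_indicator_pred:
  assumes "Measurable.pred M P"
  shows "E (\<lambda>\<omega>. if P \<omega> then 1 else 0) = ereal (cap E {\<omega>\<in>space M. P \<omega>})"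
proof -
  have "{\<omega>\<in>space M. P \<omega>} \<in> sets M" using assms by simp
  then have "E (indicat_real {\<omega>\<in>space M. P \<omega>}) = ereal (cap E {\<omega>\<in>space M. P \<omega>})"
    using cap_ereal by (simp add: capacity_def)
  moreover have "E (\<lambda>\<omega>. if P \<omega> then 1 else 0) = E (indicat_real {\<omega>\<in>space M. P \<omega>})"
    by (rule E_cong[OF H_indicator_pred[OF assms]]) auto
  ultimately show ?thesis by simp
qed

lemma random_vec_component: "i \<in> {1..n} \<Longrightarrow> random_vec n Xs \<omega> i = Xs i \<omega>"
  by (simp add: random_vec_def)

lemma pred_component_gt:
  "i \<in> {1..n} \<Longrightarrow> Measurable.pred (borel_vec n) (\<lambda>x. c < \<bar>x i\<bar> )" for c :: real
  by (auto intro!: borel_measurable_less borel_measurable_abs measurable_component_singleton)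

text \<open>On the event that none of the first \<open>n\<close> events has occurred, the next one contributes its
  capacity; on the other event it contributes nothing. The indicator of the union is thus affine
  in the indicator of the new event, and sublinearity costs nothing.\<close>

lemma cap_union_indep:
  assumes ind: "indep_seq H E Xs" and XH: "\<And>i. i \<ge> 1 \<Longrightarrow> Xs i \<in> H" and "n \<ge> 1"
  shows "1 - cap E {\<omega>\<in>space M. \<exists>i\<in>{1..n}. c i < \<bar>Xs i \<omega>\<bar>}
    = (\<Prod>i=1..n. 1 - cap E {\<omega>\<in>space M. c i < \<bar>Xs i \<omega>\<bar>})"
  using \<open>n \<ge> 1\<close>
proof (induction n rule: nat_induct_at_least)
  case base then show ?case by simp
next
  case (Suc n)
  have Xm: "Xs i \<in> borel_measurable M" if "i \<ge> 1" for i using XH[OF that] H_measurable by auto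
  define B where "B = (\<lambda>n \<omega>. \<exists>i\<in>{1..n}. c i < \<bar>Xs i \<omega>\<bar>)"
  define F :: "(nat \<Rightarrow> real) \<Rightarrow> real" where "F = (\<lambda>x. if \<exists>i\<in>{1..n}. c i < \<bar>x i\<bar> then 1 else 0)"
  define k :: "real \<Rightarrow> real" where "k = (\<lambda>y. if c (Suc n) < \<bar>y\<bar> then 1 else 0)"
  define v where "v = cap E {\<omega>\<in>space M. c (Suc n) < \<bar>Xs (Suc n) \<omega>\<bar>}"
  have Bm: "Measurable.pred M (B n)" for n
    unfolding B_def using Xm by (intro pred_intros_finite) (auto intro!: borel_measurable_less borel_measurable_abs)
  have Bm1: "Measurable.pred M (\<lambda>\<omega>. c (Suc n) < \<bar>Xs (Suc n) \<omega>\<bar>)"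
    using Xm by (auto intro!: borel_measurable_less borel_measurable_abs)
  have Fm: "F \<in> borel_measurable (borel_vec n)"
    unfolding F_def by (intro measurable_If pred_intros_finite pred_component_gt) auto
  have km: "k \<in> borel_measurable borel" unfolding k_def by measurable
  have FX: "F (random_vec n Xs \<omega>) = (if B n \<omega> then 1 else 0)" for \<omega>
    unfolding F_def B_def by (auto simp: random_vec_component)
  have kX: "k (Xs (Suc n) \<omega>) = (if c (Suc n) < \<bar>Xs (Suc n) \<omega>\<bar> then 1 else 0)" for \<omega> by (simp add: k_def)
  have FH: "(\<lambda>\<omega>. F (random_vec n Xs \<omega>)) \<in> H" unfolding FX by (rule H_indicator_pred[OF Bm])
  have kH: "(\<lambda>\<omega>. k (Xs (Suc n) \<omega>)) \<in> H" unfolding kX by (rule H_indicator_pred[OF Bm1])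
  have ek: "E (\<lambda>\<omega>. k (Xs (Suc n) \<omega>)) = ereal v"
    unfolding kX v_def by (rule E_indicator_pred[OF Bm1])
  have v01: "0 \<le> v" "v \<le> 1" unfolding v_def using Bm1 by (auto intro!: cap_bounds)
  have "E (\<lambda>\<omega>. F (random_vec n Xs \<omega>) + (1 - F (random_vec n Xs \<omega>)) * k (Xs (Suc n) \<omega>))
     = E (\<lambda>\<omega>. F (random_vec n Xs \<omega>) + (1 - F (random_vec n Xs \<omega>)) * v)"
    by (rule indep_step[OF ind Suc.hyps Fm _ km FH _ kH, where c = 1 and G = "\<lambda>x. 1 - F x"])
       (auto intro!: H_diff H_const FH ek Fm, auto simp: F_def k_def)
  also have "(\<lambda>\<omega>. F (random_vec n Xs \<omega>) + (1 - F (random_vec n Xs \<omega>)) * k (Xs (Suc n) \<omega>))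
     = (\<lambda>\<omega>. if B (Suc n) \<omega> then 1 else 0)"
    unfolding FX kX using Suc.hyps by (auto simp: B_def fun_eq_iff atLeastAtMostSuc_conv)
  also have "(\<lambda>\<omega>. F (random_vec n Xs \<omega>) + (1 - F (random_vec n Xs \<omega>)) * v)
     = (\<lambda>\<omega>. v + (1 - v) * (if B n \<omega> then 1 else 0))"
    unfolding FX by (auto simp: fun_eq_iff)
  also have "E \<dots> = ereal v + E (\<lambda>\<omega>. (1 - v) * (if B n \<omega> then 1 else 0))"
    by (rule E_add_const[OF H_cmult[OF H_indicator_pred[OF Bm]]])
  also have "E (\<lambda>\<omega>. (1 - v) * (if B n \<omega> then 1 else 0)) = ereal (1 - v) * E (\<lambda>\<omega>. if B n \<omega> then 1 else 0)"
    using v01 by (intro E_pos_homogeneous H_indicator_pred Bm) auto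
  finally have "cap E {\<omega>\<in>space M. B (Suc n) \<omega>} = v + (1 - v) * cap E {\<omega>\<in>space M. B n \<omega>}"
    by (simp add: E_indicator_pred[OF Bm])
  then have "1 - cap E {\<omega>\<in>space M. B (Suc n) \<omega>} = (1 - cap E {\<omega>\<in>space M. B n \<omega>}) * (1 - v)"
    by (simp add: algebra_simps)
  then show ?case using Suc.IH Suc.hyps unfolding B_def v_def by simp
qed

text \<open>\<open>1 - \<Prod>(1 - v\<^sub>i) \<ge> 1 - exp (- \<Sum>v\<^sub>i)\<close>, and \<open>1 - exp (- S)\<close> is concave in \<open>S\<close>.\<close>

lemma cap_union_lower:
  assumes ind: "indep_seq H E Xs" and XH: "\<And>i. i \<ge> 1 \<Longrightarrow> Xs i \<in> H" and "n \<ge> 1"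
  shows "(1 - exp (-1)) * min 1 (\<Sum>i=1..n. cap E {\<omega>\<in>space M. c i < \<bar>Xs i \<omega>\<bar>})
    \<le> cap E {\<omega>\<in>space M. \<exists>i\<in>{1..n}. c i < \<bar>Xs i \<omega>\<bar>}"
proof -
  define v where "v = (\<lambda>i. cap E {\<omega>\<in>space M. c i < \<bar>Xs i \<omega>\<bar>})"
  define S where "S = sum v {1..n}"
  have Xm: "Xs i \<in> borel_measurable M" if "i \<ge> 1" for i using XH[OF that] H_measurable by auto
  have v01: "0 \<le> v i" "v i \<le> 1" if "i \<ge> 1" for i
    unfolding v_def using Xm[OF that] by (auto intro!: cap_bounds)
  have S0: "0 \<le> S" unfolding S_def using v01 by (intro sum_nonneg) auto
  have "(\<Prod>i=1..n. 1 - v i) \<le> (\<Prod>i=1..n. exp (- v i))"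
    using v01 exp_ge_add_one_self[of "- v i" for i] by (intro prod_mono) auto
  also have "\<dots> = exp (- S)" by (simp add: S_def sum_negf flip: exp_sum)
  finally have 1: "1 - exp (- S) \<le> cap E {\<omega>\<in>space M. \<exists>i\<in>{1..n}. c i < \<bar>Xs i \<omega>\<bar>}"
    using cap_union_indep[OF ind XH \<open>n \<ge> 1\<close>, of c] by (simp add: v_def)
  have "(1 - exp (-1)) * min 1 S \<le> 1 - exp (- S)"
  proof (cases "S \<ge> 1")
    case True then show ?thesis by simp
  next
    case False
    \<comment> \<open>convexity of the exponential on the unit interval\<close>
    have "exp ((1 - S) * 0 + S * (-1)) \<le> (1 - S) * exp 0 + S * exp (-1 :: real)"
      using convex_onD[OF exp_convex, of S 0 "-1"] S0 False by simp
    with False show ?thesis by (simp add: algebra_simps)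
  qed
  with 1 show ?thesis by (simp add: S_def v_def)
qed

text \<open>Conditionally on the past, one step multiplies the expectation of the stopped exponential by at
  most \<open>1 + d i\<close>, both before stopping and (as \<open>d i\<close> is nonnegative) after it.\<close>

lemma cap_max_exp:
  assumes ind: "indep_seq H E Xs" and XH: "\<And>i. i \<ge> 1 \<Longrightarrow> Xs i \<in> H" and "n \<ge> 1"
    and fm: "\<And>i. f i \<in> borel_measurable borel" and fb: "\<And>i x. f i x \<le> b" "0 \<le> b"
    and fH: "\<And>i. i \<in> {1..n} \<Longrightarrow> (\<lambda>\<omega>. exp (f i (Xs i \<omega>))) \<in> H"
    and d: "\<And>i. i \<in> {1..n} \<Longrightarrow> E (\<lambda>\<omega>. exp (f i (Xs i \<omega>))) \<le> ereal (1 + d i)" "\<And>i. 0 \<le> d i"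
  shows "cap E {\<omega>\<in>space M. \<exists>k\<in>{1..n}. y < (\<Sum>i=1..k. f i (Xs i \<omega>))} \<le> exp ((\<Sum>i=1..n. d i) - y)"
proof -
  have Xm: "Xs i \<in> borel_measurable M" if "i \<ge> 1" for i using XH[OF that] H_measurable by auto
  have fXm: "(\<lambda>\<omega>. f i (Xs i \<omega>)) \<in> borel_measurable M" if "i \<ge> 1" for i
    using Xm[OF that] fm by simp
  define A where "A = (\<lambda>n (x::nat \<Rightarrow> real). \<forall>k\<in>{1..n}. (\<Sum>i=1..k. f i (x i)) \<le> y)"
  have Am: "Measurable.pred (borel_vec m) (A m)" for m
  proof -
    have *: "(\<lambda>x. f i (x i)) \<in> borel_measurable (borel_vec m)" if "i \<in> {1..m}" for i
      using fm that by (intro measurable_compose[OF measurable_component_singleton]) auto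
    have "(\<lambda>x. \<Sum>i=1..k. f i (x i)) \<in> borel_measurable (borel_vec m)" if "k \<in> {1..m}" for k
      using that by (intro borel_measurable_sum *) auto
    then show ?thesis
      unfolding A_def by (intro pred_intros_finite) (auto intro!: borel_measurable_le)
  qed
  have AXm: "Measurable.pred M (\<lambda>\<omega>. A m (\<lambda>i. Xs i \<omega>))" for m
    unfolding A_def using fXm by (intro pred_intros_finite) (auto intro!: borel_measurable_le borel_measurable_sum)
  have Acong: "A m (random_vec m Xs \<omega>) = A m (\<lambda>i. Xs i \<omega>)" for m \<omega>
    unfolding A_def using sum_upto_cong[of m "random_vec m Xs \<omega>" "\<lambda>i. Xs i \<omega>" _ f]
    by (auto simp: random_vec_component)
  define Z where "Z = stopped_exp f y"
  have Zcong: "Z m (random_vec m Xs \<omega>) = Z m (\<lambda>i. Xs i \<omega>)" for m \<omega>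
    unfolding Z_def by (rule stopped_exp_cong) (simp add: random_vec_component)
  have ZS: "Z (Suc m) x = (if A m x then exp (f (Suc m) (x (Suc m))) else 1) * Z m x" for m x
    by (simp add: Z_def A_def)
  have Z0: "0 \<le> Z m x" for m x unfolding Z_def by (rule stopped_exp_nonneg)
  have ind1: "(\<lambda>\<omega>. if A m (\<lambda>i. Xs i \<omega>) then 1 else 0) \<in> H" "(\<lambda>\<omega>. if A m (\<lambda>i. Xs i \<omega>) then 0 else 1) \<in> H" for m
    by (rule H_indicator_pred[OF AXm[of m]], rule H_cong[OF H_diff[OF H_const[of 1] H_indicator_pred[OF AXm[of m]]]]) simp
  have ZH: "(\<lambda>\<omega>. Z m (\<lambda>i. Xs i \<omega>)) \<in> H" if "m \<le> n" for m
    using that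
  proof (induction m)
    case 0 then show ?case by (simp add: Z_def H_const)
  next
    case (Suc m)
    have "(\<lambda>\<omega>. ((if A m (\<lambda>i. Xs i \<omega>) then 1 else 0) * exp (f (Suc m) (Xs (Suc m) \<omega>))
         + (if A m (\<lambda>i. Xs i \<omega>) then 0 else 1)) * Z m (\<lambda>i. Xs i \<omega>)) \<in> H"
      using Suc by (intro H_mult H_add ind1 fH) auto
    then show ?case by (rule H_cong) (simp add: ZS)
  qed
  have EZ: "E (\<lambda>\<omega>. Z m (\<lambda>i. Xs i \<omega>)) \<le> ereal (\<Prod>i=1..m. 1 + d i)" if "1 \<le> m" "m \<le> n" for m
    using that
  proof (induction m rule: nat_induct_at_least)
    case base
    then show ?case using d(1)[of 1] by (simp add: Z_def)
  next
    case (Suc m)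
    define F where "F = (\<lambda>x. if A m x then 0 else Z m x)"
    define G where "G = (\<lambda>x. if A m x then Z m x else 0)"
    have FGX: "F (random_vec m Xs \<omega>) = (if A m (\<lambda>i. Xs i \<omega>) then 0 else 1) * Z m (\<lambda>i. Xs i \<omega>)"
      "G (random_vec m Xs \<omega>) = (if A m (\<lambda>i. Xs i \<omega>) then 1 else 0) * Z m (\<lambda>i. Xs i \<omega>)" for \<omega>
      unfolding F_def G_def Acong Zcong by auto
    have FH: "(\<lambda>\<omega>. F (random_vec m Xs \<omega>)) \<in> H" and GH: "(\<lambda>\<omega>. G (random_vec m Xs \<omega>)) \<in> H"
      unfolding FGX using Suc.prems by (auto intro!: H_mult ind1 ZH)
    have Zm: "Z m \<in> borel_measurable (borel_vec m)"
      unfolding Z_def by (rule stopped_exp_measurable) (auto intro: fm)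
    have eH: "(\<lambda>\<omega>. exp (f (Suc m) (Xs (Suc m) \<omega>))) \<in> H" using Suc.prems by (intro fH) auto
    have "E (\<lambda>\<omega>. exp (f (Suc m) (Xs (Suc m) \<omega>))) \<le> ereal (1 + d (Suc m))" using Suc.prems by (intro d) auto
    moreover have "0 \<le> E (\<lambda>\<omega>. exp (f (Suc m) (Xs (Suc m) \<omega>)))" by (rule E_nonneg[OF eH]) simp
    ultimately obtain e where e: "E (\<lambda>\<omega>. exp (f (Suc m) (Xs (Suc m) \<omega>))) = ereal e" "0 \<le> e" "e \<le> 1 + d (Suc m)"
      by (cases "E (\<lambda>\<omega>. exp (f (Suc m) (Xs (Suc m) \<omega>)))") auto
    have Zb: "Z m x \<le> exp (real m * b)" for x unfolding Z_def by (rule stopped_exp_le[OF fb])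
    have "E (\<lambda>\<omega>. Z (Suc m) (\<lambda>i. Xs i \<omega>))
       = E (\<lambda>\<omega>. F (random_vec m Xs \<omega>) + G (random_vec m Xs \<omega>) * exp (f (Suc m) (Xs (Suc m) \<omega>)))"
      by (intro arg_cong[of _ _ E] ext) (simp add: ZS FGX)
    also have "\<dots> = E (\<lambda>\<omega>. F (random_vec m Xs \<omega>) + G (random_vec m Xs \<omega>) * e)"
    proof (rule indep_step[OF ind Suc.hyps _ _ _ FH GH _, where c = "exp (real m * b)" and k = "\<lambda>x. exp (f (Suc m) x)"])
      show "F \<in> borel_measurable (borel_vec m)" "G \<in> borel_measurable (borel_vec m)"
        unfolding F_def G_def using Am Zm by (auto intro!: measurable_If)
      show "(\<lambda>x. exp (f (Suc m) x)) \<in> borel_measurable borel" using fm by measurable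
    qed (use eH e Z0 Zb in \<open>auto simp: F_def G_def\<close>)
    also have "\<dots> \<le> E (\<lambda>\<omega>. (1 + d (Suc m)) * Z m (\<lambda>i. Xs i \<omega>))"
    proof (rule E_mono)
      show "(\<lambda>\<omega>. (1 + d (Suc m)) * Z m (\<lambda>i. Xs i \<omega>)) \<in> H" using Suc.prems by (intro H_cmult ZH) auto
      show "(\<lambda>\<omega>. F (random_vec m Xs \<omega>) + G (random_vec m Xs \<omega>) * e) \<in> H"
        by (intro H_add H_mult FH GH H_const)
      show "F (random_vec m Xs \<omega>) + G (random_vec m Xs \<omega>) * e \<le> (1 + d (Suc m)) * Z m (\<lambda>i. Xs i \<omega>)" for \<omega>
        using mult_right_mono[OF e(3) Z0[of m "\<lambda>i. Xs i \<omega>"]] mult_right_mono[OF _ Z0[of m "\<lambda>i. Xs i \<omega>"], of 1 "1 + d (Suc m)"]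
          d(2)[of "Suc m"] unfolding FGX by (cases "A m (\<lambda>i. Xs i \<omega>)") (simp_all add: mult.commute)
    qed
    also have "\<dots> = ereal (1 + d (Suc m)) * E (\<lambda>\<omega>. Z m (\<lambda>i. Xs i \<omega>))"
      using d(2)[of "Suc m"] Suc.prems by (intro E_pos_homogeneous ZH) auto
    also have "\<dots> \<le> ereal (1 + d (Suc m)) * ereal (\<Prod>i=1..m. 1 + d i)"
      using Suc d(2)[of "Suc m"] by (intro ereal_mult_left_mono) auto
    also have "\<dots> = ereal (\<Prod>i=1..Suc m. 1 + d i)" using Suc.hyps by (simp add: mult.commute)
    finally show ?case .
  qed
  define P where "P = (\<lambda>\<omega>. \<exists>k\<in>{1..n}. y < (\<Sum>i=1..k. f i (Xs i \<omega>)))"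
  have Pm: "Measurable.pred M P"
    unfolding P_def using fXm by (intro pred_intros_finite) (auto intro!: borel_measurable_less borel_measurable_sum)
  have "ereal (cap E {\<omega>\<in>space M. P \<omega>}) = E (\<lambda>\<omega>. if P \<omega> then 1 else 0)"
    by (rule E_indicator_pred[symmetric, OF Pm])
  also have "\<dots> \<le> E (\<lambda>\<omega>. exp (- y) * Z n (\<lambda>i. Xs i \<omega>))"
  proof (intro E_mono H_cmult ZH H_indicator_pred Pm)
    show "(if P \<omega> then 1 else 0) \<le> exp (- y) * Z n (\<lambda>i. Xs i \<omega>)" for \<omega>
    proof (cases "P \<omega>")
      case True
      then have "exp y \<le> Z n (\<lambda>i. Xs i \<omega>)" unfolding Z_def P_def by (rule stopped_exp_dead)
      then show ?thesis using True by (simp add: exp_minus field_simps)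
    qed (simp add: Z0)
  qed auto
  also have "\<dots> = ereal (exp (- y)) * E (\<lambda>\<omega>. Z n (\<lambda>i. Xs i \<omega>))"
    by (intro E_pos_homogeneous ZH) auto
  also have "\<dots> \<le> ereal (exp (- y)) * ereal (\<Prod>i=1..n. 1 + d i)"
    using EZ[of n] \<open>n \<ge> 1\<close> by (intro ereal_mult_left_mono) auto
  also have "\<dots> \<le> ereal (exp (- y) * (\<Prod>i=1..n. exp (d i)))"
    using d(2) exp_ge_add_one_self by (auto intro!: mult_left_mono prod_mono)
  also have "exp (- y) * (\<Prod>i=1..n. exp (d i)) = exp ((\<Sum>i=1..n. d i) - y)"
    by (simp add: mult_exp_exp flip: exp_sum)
  finally show ?thesis by (simp add: P_def)
qed

end

section \<open>Truncation and a Fuk-Nagaev bound for maximal sums\<close>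

lemma trunc_at_lipschitz: "\<bar>trunc_at b x - trunc_at b y\<bar> \<le> \<bar>x - y\<bar>"
  unfolding trunc_at_def max_def min_def by (auto simp: abs_if)

lemma trunc_at_le: "0 \<le> b \<Longrightarrow> \<bar>trunc_at b z\<bar> \<le> b" "0 \<le> b \<Longrightarrow> \<bar>trunc_at b z\<bar> \<le> \<bar>z\<bar>"
  by (auto simp: trunc_at_def max_def min_def abs_if)

lemma trunc_at_id: "\<bar>z\<bar> \<le> b \<Longrightarrow> trunc_at b z = z"
  by (auto simp: trunc_at_def max_def min_def)

lemma trunc_at_minus: "0 \<le> b \<Longrightarrow> trunc_at b (- z) = - trunc_at b z"
  by (auto simp: trunc_at_def max_def min_def abs_if)

lemma exp_lipschitz_below:
  fixes x y b :: real assumes "x \<le> b" "y \<le> b"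
  shows "\<bar>exp x - exp y\<bar> \<le> exp b * \<bar>x - y\<bar>"
proof -
  have *: "exp v - exp u \<le> exp b * (v - u)" if "u \<le> v" "v \<le> b" for u v :: real
  proof -
    have "exp v - exp u = exp v * (1 - exp (u - v))" by (simp add: exp_diff algebra_simps)
    also have "\<dots> \<le> exp v * (v - u)"
      using exp_ge_add_one_self[of "u - v"] by (intro mult_left_mono) (simp_all add: algebra_simps)
    also have "\<dots> \<le> exp b * (v - u)" using that by (intro mult_right_mono) auto
    finally show ?thesis .
  qed
  show ?thesis
    using *[of x y] *[of y x] assms by (cases x y rule: linorder_cases) auto
qed

lemma trunc_ratio_le:
  fixes z b \<tau> :: real assumes "0 < b" "0 < \<tau>" "\<tau> \<le> 1"
  shows "\<bar>trunc_at b z\<bar> / b \<le> (\<bar>z\<bar> / b) powr \<tau>"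
proof (cases "z = 0")
  case True then show ?thesis using assms by (simp add: trunc_at_def)
next
  case False
  let ?r = "\<bar>trunc_at b z\<bar> / b"
  have r: "0 \<le> ?r" "?r \<le> 1" "?r \<le> \<bar>z\<bar> / b" using assms trunc_at_le[of b z] by (auto simp: divide_simps)
  have "?r = ?r powr 1" by (rule powr_one[symmetric, OF r(1)])
  also have "\<dots> \<le> ?r powr \<tau>"
  proof (cases "?r = 0")
    case False
    show ?thesis by (rule powr_mono'[OF assms(3) r(1,2)])
  next
    case True
    show ?thesis unfolding True by simp
  qed
  also have "\<dots> \<le> (\<bar>z\<bar> / b) powr \<tau>" by (rule powr_mono2[OF less_imp_le[OF assms(2)] r(1,3)])
  finally show ?thesis .
qed

lemma exp_le_linear_quadratic: "exp w \<le> 1 + w + w\<^sup>2 * exp \<bar>w\<bar>" for w :: real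
proof -
  have "1 - w \<le> exp (- w)" using exp_ge_add_one_self[of "- w"] by simp
  then have "(1 - w) * exp w \<le> exp (- w) * exp w" by (intro mult_right_mono) auto
  then have 1: "exp w \<le> 1 + w * exp w" by (simp add: mult_exp_exp algebra_simps)
  have "w * (exp w - 1) \<le> w\<^sup>2 * exp \<bar>w\<bar>"
  proof (cases "w \<ge> 0")
    case True
    then have "w * (exp w - 1) \<le> w * (w * exp w)" using 1 by (intro mult_left_mono) auto
    then show ?thesis using True by (simp add: power2_eq_square)
  next
    case False
    have "1 - exp w \<le> - w" using exp_ge_add_one_self[of w] by linarith
    then have "(- w) * (1 - exp w) \<le> (- w) * (- w)" using False by (intro mult_left_mono) auto
    also have "\<dots> \<le> w\<^sup>2 * exp \<bar>w\<bar>" by (simp add: power2_eq_square mult_le_cancel_left1)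
    finally show ?thesis by (simp add: algebra_simps)
  qed
  with 1 show ?thesis by (simp add: algebra_simps)
qed

text \<open>For \<open>\<tau> \<le> 1\<close> the linear term of the exponential is itself dominated by the power \<open>\<tau>\<close>, since
  truncated values are at most \<open>b\<close>.\<close>

lemma exp_trunc_le_small:
  fixes u b \<tau> z :: real assumes "0 \<le> u" "0 < b" "0 < \<tau>" "\<tau> \<le> 1"
  shows "exp (u / b * trunc_at b z) \<le> 1 + 3 * exp (2 * u) * (\<bar>z\<bar> / b) powr \<tau>"
proof -
  define w where "w = u / b * trunc_at b z"
  define \<rho> where "\<rho> = (\<bar>z\<bar> / b) powr \<tau>"
  have r0: "0 \<le> \<rho>" by (simp add: \<rho>_def)
  have r: "\<bar>trunc_at b z\<bar> / b \<le> \<rho>" unfolding \<rho>_def using assms by (intro trunc_ratio_le)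
  have w1: "\<bar>w\<bar> = u * (\<bar>trunc_at b z\<bar> / b)" using assms by (simp add: w_def abs_mult)
  have w2: "\<bar>w\<bar> \<le> u * \<rho>" unfolding w1 using r assms by (intro mult_left_mono)
  have "\<bar>trunc_at b z\<bar> / b \<le> 1" using assms trunc_at_le(1)[of b z] by simp
  then have w3: "\<bar>w\<bar> \<le> u" unfolding w1 using mult_left_mono[OF _ assms(1)] by fastforce
  have ueu: "u \<le> exp u" using exp_ge_add_one_self[of u] by linarith
  have "1 - \<bar>w\<bar> \<le> exp (- \<bar>w\<bar>)" using exp_ge_add_one_self[of "- \<bar>w\<bar>"] by simp
  then have "(1 - \<bar>w\<bar>) * exp \<bar>w\<bar> \<le> exp (- \<bar>w\<bar>) * exp \<bar>w\<bar>" by (intro mult_right_mono) auto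
  then have "exp \<bar>w\<bar> \<le> 1 + \<bar>w\<bar> * exp \<bar>w\<bar>" by (simp add: mult_exp_exp algebra_simps)
  also have "\<dots> \<le> 1 + (u * \<rho>) * exp u"
    using w2 w3 assms r0 by (intro add_left_mono mult_mono) auto
  also have "\<dots> = 1 + (u * exp u) * \<rho>" by simp
  also have "\<dots> \<le> 1 + (exp u * exp u) * \<rho>"
    using ueu r0 by (intro add_left_mono mult_right_mono) auto
  also have "\<dots> \<le> 1 + 3 * exp (2 * u) * \<rho>" using r0 by (simp add: mult_exp_exp mult_right_mono)
  finally have "exp \<bar>w\<bar> \<le> 1 + 3 * exp (2 * u) * \<rho>" .
  moreover have "exp w \<le> exp \<bar>w\<bar>" by simp
  ultimately show ?thesis unfolding w_def \<rho>_def by linarith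
qed

text \<open>For \<open>1 \<le> \<tau> \<le> 2\<close> the second-order remainder and the truncation error are both dominated by the
  power \<open>\<tau>\<close>, and the linear term is kept without truncation so that its expectation can vanish.\<close>

lemma exp_trunc_le_large:
  fixes u b \<tau> z :: real assumes "0 \<le> u" "0 < b" "1 \<le> \<tau>" "\<tau> \<le> 2"
  shows "exp (u / b * trunc_at b z) \<le> 1 + (u / b * z + 3 * exp (2 * u) * (\<bar>z\<bar> / b) powr \<tau>)"
proof -
  define w where "w = u / b * trunc_at b z"
  define \<rho> where "\<rho> = (\<bar>z\<bar> / b) powr \<tau>"
  have r0: "0 \<le> \<rho>" by (simp add: \<rho>_def)
  have w1: "\<bar>w\<bar> = u * (\<bar>trunc_at b z\<bar> / b)" using assms by (simp add: w_def abs_mult)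
  have "\<bar>trunc_at b z\<bar> / b \<le> 1" using assms trunc_at_le(1)[of b z] by simp
  then have w3: "\<bar>w\<bar> \<le> u" unfolding w1 using mult_left_mono[OF _ assms(1)] by fastforce
  have c2: "(\<bar>trunc_at b z\<bar> / b)\<^sup>2 \<le> \<rho>"
  proof (cases "z = 0")
    case True then show ?thesis using assms r0 by (simp add: trunc_at_def)
  next
    case False
    let ?r = "\<bar>trunc_at b z\<bar> / b"
    have r: "0 \<le> ?r" "?r \<le> 1" "?r \<le> \<bar>z\<bar> / b" using assms trunc_at_le[of b z] by (auto simp: divide_simps)
    have pos: "0 < ?r" using False assms by (auto simp: trunc_at_def)
    have "?r\<^sup>2 = ?r powr 2" using pos by (subst powr_numeral) auto
    also have "\<dots> \<le> ?r powr \<tau>" by (rule powr_mono'[OF assms(4) r(1,2)])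
    also have "\<dots> \<le> (\<bar>z\<bar> / b) powr \<tau>" using assms(3) by (intro powr_mono2[OF _ r(1,3)]) simp
    finally show ?thesis by (simp add: \<rho>_def)
  qed
  \<comment> \<open>truncation changes only values beyond \<open>b\<close>, where a power \<open>\<tau> \<ge> 1\<close> dominates the first power\<close>
  have c1: "trunc_at b z \<le> z + b * \<rho>"
  proof (cases "\<bar>z\<bar> \<le> b")
    case True then show ?thesis using trunc_at_id[OF True] r0 assms by simp
  next
    case False
    then have "1 < \<bar>z\<bar> / b" using assms by (simp add: divide_simps)
    then have "(\<bar>z\<bar> / b) powr 1 \<le> \<rho>" unfolding \<rho>_def using assms by (intro powr_mono) auto
    then have "\<bar>z\<bar> \<le> b * \<rho>" using assms by (simp add: divide_simps mult.commute split: if_splits)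
    moreover have "trunc_at b z \<le> z + \<bar>z\<bar>" using False assms by (auto simp: trunc_at_def)
    ultimately show ?thesis by linarith
  qed
  have "w \<le> u / b * (z + b * \<rho>)" unfolding w_def using c1 assms by (intro mult_left_mono) auto
  also have "\<dots> = u / b * z + u * \<rho>" using assms by (simp add: field_simps)
  finally have l: "w \<le> u / b * z + u * \<rho>" .
  have "w\<^sup>2 * exp \<bar>w\<bar> = (u\<^sup>2 * (\<bar>trunc_at b z\<bar> / b)\<^sup>2) * exp \<bar>w\<bar>"
    using w1 by (metis power2_abs power_mult_distrib)
  also have "\<dots> \<le> (u\<^sup>2 * \<rho>) * exp u" using w3 c2 r0 by (intro mult_mono mult_left_mono) auto
  finally have q: "w\<^sup>2 * exp \<bar>w\<bar> \<le> u\<^sup>2 * exp u * \<rho>" by (simp add: mult_ac)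
  have e1: "u \<le> exp (2 * u)" using exp_ge_add_one_self[of "2 * u"] assms by linarith
  have "u\<^sup>2 \<le> 2 * exp u" using exp_lower_Taylor_quadratic[OF assms(1)] assms by (simp add: field_simps)
  then have "u\<^sup>2 * exp u \<le> 2 * exp u * exp u" by (intro mult_right_mono) auto
  also have "\<dots> = 2 * exp (2 * u)" by (simp add: mult_exp_exp)
  finally have "u + u\<^sup>2 * exp u \<le> 3 * exp (2 * u)" using e1 by simp
  then have "(u + u\<^sup>2 * exp u) * \<rho> \<le> 3 * exp (2 * u) * \<rho>" using r0 by (rule mult_right_mono)
  then have "1 + w + w\<^sup>2 * exp \<bar>w\<bar> \<le> 1 + (u / b * z + 3 * exp (2 * u) * \<rho>)"
    using l q by (simp add: algebra_simps)
  with exp_le_linear_quadratic[of w] show ?thesis unfolding w_def \<rho>_def by linarith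
qed

text \<open>A substitute for \<open>\<bar>x\<bar>\<close> to the power \<open>\<tau>\<close>, which for \<open>\<tau> < 1\<close> is not locally Lipschitz at the
  origin and hence not among the admissible test functions.\<close>

definition trunc_powr :: "real \<Rightarrow> real \<Rightarrow> real" where
  "trunc_powr \<tau> x = max 1 \<bar>x\<bar> powr \<tau>"

lemma trunc_powr_C_l_Lip:
  assumes "0 < \<tau>" "\<tau> \<le> 2"
  shows "\<bar>trunc_powr \<tau> x - trunc_powr \<tau> y\<bar> \<le> 2 * (1 + \<bar>x\<bar> ^ 1 + \<bar>y\<bar> ^ 1) * \<bar>x - y\<bar>"
proof -
  have *: "v powr \<tau> - u powr \<tau> \<le> 2 * v * (v - u)" if "1 \<le> u" "u \<le> v" for u v :: real
  proof (cases "u = v")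
    case False
    with that have "u < v" by simp
    then have "\<exists>z>u. z < v \<and> v powr \<tau> - u powr \<tau> = (v - u) * (\<tau> * z powr (\<tau> - 1))"
      by (rule MVT2) (use that in \<open>auto intro!: has_real_derivative_powr\<close>)
    then obtain z where z: "u < z" "z < v" "v powr \<tau> - u powr \<tau> = (v - u) * (\<tau> * z powr (\<tau> - 1))"
      by blast
    have "z powr (\<tau> - 1) \<le> z powr 1" using z that assms by (intro powr_mono) auto
    also have "\<dots> \<le> v" using z that by simp
    finally have "\<tau> * z powr (\<tau> - 1) \<le> 2 * v" using assms by (intro mult_mono) auto
    then show ?thesis using z(3) that by (simp add: mult.commute mult_left_mono)
  qed simp
  define u v where "u = max 1 \<bar>x\<bar>" and "v = max 1 \<bar>y\<bar>"
  have uv1: "1 \<le> u" "1 \<le> v" by (auto simp: u_def v_def)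
  have "\<bar>u powr \<tau> - v powr \<tau>\<bar> \<le> 2 * max u v * \<bar>u - v\<bar>"
  proof (cases "u \<le> v")
    case True
    then have "u powr \<tau> \<le> v powr \<tau>" using assms by (intro powr_mono2) (auto simp: u_def)
    with *[of u v] True uv1 show ?thesis by (simp add: max_def)
  next
    case False
    then have "v powr \<tau> \<le> u powr \<tau>" using assms by (intro powr_mono2) (auto simp: v_def)
    with *[of v u] False uv1 show ?thesis by (simp add: max_def)
  qed
  also have "\<dots> \<le> 2 * (1 + \<bar>x\<bar> ^ 1 + \<bar>y\<bar> ^ 1) * \<bar>x - y\<bar>"
    unfolding u_def v_def by (intro mult_mono) auto
  finally show ?thesis by (simp add: trunc_powr_def u_def v_def)
qed

lemma trunc_powr_ge: "0 < \<tau> \<Longrightarrow> \<bar>x\<bar> powr \<tau> \<le> trunc_powr \<tau> x"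
  unfolding trunc_powr_def by (intro powr_mono2) auto

lemma trunc_powr_ge1: "0 < \<tau> \<Longrightarrow> 1 \<le> trunc_powr \<tau> x"
  unfolding trunc_powr_def by (intro ge_one_powr_ge_zero) auto

context sublinear_expectation_space begin

lemma trunc_powr_H: "X \<in> H \<Longrightarrow> 0 < \<tau> \<Longrightarrow> \<tau> \<le> 2 \<Longrightarrow> (\<lambda>\<omega>. trunc_powr \<tau> (X \<omega>)) \<in> H"
  by (rule H_compose[OF _ _ trunc_powr_C_l_Lip]) auto

lemma exp_trunc_H:
  assumes "X \<in> H" "0 \<le> t" "0 \<le> b"
  shows "(\<lambda>\<omega>. exp (t * trunc_at b (a * X \<omega>))) \<in> H"
proof (rule H_lipschitz[OF assms(1)])
  fix x y :: real
  have *: "t * trunc_at b z \<le> t * b" for z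
    using trunc_at_le(1)[of b z] assms by (intro mult_left_mono) auto
  have "\<bar>exp (t * trunc_at b (a * x)) - exp (t * trunc_at b (a * y))\<bar>
    \<le> exp (t * b) * \<bar>t * trunc_at b (a * x) - t * trunc_at b (a * y)\<bar>"
    by (rule exp_lipschitz_below[OF * *])
  also have "\<dots> = exp (t * b) * (t * \<bar>trunc_at b (a * x) - trunc_at b (a * y)\<bar>)"
    using assms by (simp add: abs_mult flip: right_diff_distrib)
  also have "\<dots> \<le> exp (t * b) * (t * \<bar>a * x - a * y\<bar>)"
    using assms by (intro mult_left_mono trunc_at_lipschitz) auto
  also have "\<dots> = (exp (t * b) * t * \<bar>a\<bar>) * \<bar>x - y\<bar>"
    by (simp add: abs_mult flip: right_diff_distrib)
  finally show "\<bar>exp (t * trunc_at b (a * x)) - exp (t * trunc_at b (a * y))\<bar> \<le> (exp (t * b) * t * \<bar>a\<bar>) * \<bar>x - y\<bar>" .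
qed

lemma E_exp_trunc:
  assumes "X \<in> H" "0 \<le> u" "0 < b" "0 < \<tau>" "\<tau> \<le> 2"
    and L: "E (\<lambda>\<omega>. trunc_powr \<tau> (X \<omega>)) \<le> ereal L"
    and mean: "\<tau> \<le> 1 \<or> E (\<lambda>\<omega>. a * X \<omega>) \<le> 0"
  shows "E (\<lambda>\<omega>. exp (u / b * trunc_at b (a * X \<omega>)))
    \<le> ereal (1 + 3 * exp (2 * u) * (\<bar>a\<bar> powr \<tau> / b powr \<tau>) * L)"
proof -
  define K where "K = 3 * exp (2 * u) * (\<bar>a\<bar> powr \<tau> / b powr \<tau>)"
  have K0: "0 \<le> K" by (simp add: K_def)
  have TH: "(\<lambda>\<omega>. K * trunc_powr \<tau> (X \<omega>)) \<in> H" using assms by (intro H_cmult trunc_powr_H)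
  have eH: "(\<lambda>\<omega>. exp (u / b * trunc_at b (a * X \<omega>))) \<in> H" using assms by (intro exp_trunc_H) auto
  have pw: "3 * exp (2 * u) * (\<bar>a * x\<bar> / b) powr \<tau> \<le> K * trunc_powr \<tau> x" for x
  proof -
    have "3 * exp (2 * u) * (\<bar>a * x\<bar> / b) powr \<tau> = K * \<bar>x\<bar> powr \<tau>"
      using assms by (simp add: K_def abs_mult powr_mult powr_divide)
    also have "\<dots> \<le> K * trunc_powr \<tau> x" using K0 trunc_powr_ge[of \<tau> x] assms by (intro mult_left_mono)
    finally show ?thesis .
  qed
  have ET: "E (\<lambda>\<omega>. K * trunc_powr \<tau> (X \<omega>)) \<le> ereal (K * L)"
  proof -
    have "E (\<lambda>\<omega>. K * trunc_powr \<tau> (X \<omega>)) = ereal K * E (\<lambda>\<omega>. trunc_powr \<tau> (X \<omega>))"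
      using assms K0 by (intro E_pos_homogeneous trunc_powr_H)
    also have "\<dots> \<le> ereal K * ereal L" using L K0 by (intro ereal_mult_left_mono) auto
    finally show ?thesis by simp
  qed
  show ?thesis
  proof (cases "\<tau> \<le> 1")
    case True
    have "E (\<lambda>\<omega>. exp (u / b * trunc_at b (a * X \<omega>))) \<le> E (\<lambda>\<omega>. 1 + K * trunc_powr \<tau> (X \<omega>))"
    proof (intro E_mono eH H_add H_const TH)
      fix \<omega>
      show "exp (u / b * trunc_at b (a * X \<omega>)) \<le> 1 + K * trunc_powr \<tau> (X \<omega>)"
        using exp_trunc_le_small[of u b \<tau> "a * X \<omega>"] assms True pw[of "X \<omega>"] by linarith
    qed
    also have "\<dots> = ereal 1 + E (\<lambda>\<omega>. K * trunc_powr \<tau> (X \<omega>))" by (rule E_add_const[OF TH])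
    also have "\<dots> \<le> ereal 1 + ereal (K * L)" using ET by (rule add_left_mono)
    finally show ?thesis by (simp add: K_def)
  next
    case False
    with mean have m: "E (\<lambda>\<omega>. a * X \<omega>) \<le> 0" by simp
    have aH: "(\<lambda>\<omega>. a * X \<omega>) \<in> H" using assms by (intro H_cmult)
    have "E (\<lambda>\<omega>. u / b * (a * X \<omega>)) = ereal (u / b) * E (\<lambda>\<omega>. a * X \<omega>)"
      using assms by (intro E_pos_homogeneous aH) auto
    also have "\<dots> \<le> ereal (u / b) * 0" using assms m by (intro ereal_mult_left_mono) auto
    finally have m': "E (\<lambda>\<omega>. u / b * (a * X \<omega>)) \<le> 0" by simp
    have "E (\<lambda>\<omega>. exp (u / b * trunc_at b (a * X \<omega>))) \<le> E (\<lambda>\<omega>. 1 + (u / b * (a * X \<omega>) + K * trunc_powr \<tau> (X \<omega>)))"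
    proof (intro E_mono eH H_add H_const TH H_cmult assms(1))
      fix \<omega>
      show "exp (u / b * trunc_at b (a * X \<omega>)) \<le> 1 + (u / b * (a * X \<omega>) + K * trunc_powr \<tau> (X \<omega>))"
        using exp_trunc_le_large[of u b \<tau> "a * X \<omega>"] assms False pw[of "X \<omega>"] by linarith
    qed
    also have "\<dots> = ereal 1 + E (\<lambda>\<omega>. u / b * (a * X \<omega>) + K * trunc_powr \<tau> (X \<omega>))"
      by (intro E_add_const H_add H_cmult TH assms(1))
    also have "E (\<lambda>\<omega>. u / b * (a * X \<omega>) + K * trunc_powr \<tau> (X \<omega>))
      \<le> E (\<lambda>\<omega>. u / b * (a * X \<omega>)) + E (\<lambda>\<omega>. K * trunc_powr \<tau> (X \<omega>))"
    proof (intro E_subadditive H_cmult aH trunc_powr_H assms)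
      have "0 \<le> E (\<lambda>\<omega>. K * trunc_powr \<tau> (X \<omega>))"
        using K0 trunc_powr_ge1[of \<tau>] assms by (intro E_nonneg TH mult_nonneg_nonneg) (auto intro: order_trans[OF zero_le_one])
      then show "\<not> (E (\<lambda>\<omega>. u / b * (a * X \<omega>)) = \<infinity> \<and> E (\<lambda>\<omega>. K * trunc_powr \<tau> (X \<omega>)) = - \<infinity>)"
        "\<not> (E (\<lambda>\<omega>. u / b * (a * X \<omega>)) = - \<infinity> \<and> E (\<lambda>\<omega>. K * trunc_powr \<tau> (X \<omega>)) = \<infinity>)"
        using ET by auto
    qed
    also have "\<dots> \<le> 0 + ereal (K * L)" by (intro add_mono m' ET)
    finally show ?thesis by (simp add: K_def add_left_mono)
  qed
qed

text \<open>Writing \<open>\<rho>\<close> for \<open>B / b powr \<tau>\<close>, the exponent \<open>u = - ln \<rho> / 2\<close> bounds the accumulated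
  exponential moments by \<open>exp 3\<close>, and Markov's inequality gives the stated power of \<open>\<rho>\<close>. For
  \<open>\<rho> \<ge> 1\<close> the bound exceeds one.\<close>

lemma cap_max_trunc:
  assumes ind: "indep_seq H E Xs" and XH: "\<And>i. i \<ge> 1 \<Longrightarrow> Xs i \<in> H" and n: "n \<ge> 1"
    and b: "0 < b" and y: "0 < y" and \<tau>: "0 < \<tau>" "\<tau> \<le> 2"
    and L: "\<And>i. i \<in> {1..n} \<Longrightarrow> E (\<lambda>\<omega>. trunc_powr \<tau> (Xs i \<omega>)) \<le> ereal L" "0 \<le> L"
    and mean: "\<And>i. i \<in> {1..n} \<Longrightarrow> \<tau> \<le> 1 \<or> E (\<lambda>\<omega>. a i * Xs i \<omega>) \<le> 0"
    and B: "L * (\<Sum>i=1..n. \<bar>a i\<bar> powr \<tau>) \<le> B" "0 < B"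
  shows "cap E {\<omega>\<in>space M. \<exists>k\<in>{1..n}. y < (\<Sum>i=1..k. trunc_at b (a i * Xs i \<omega>))}
    \<le> exp 3 * (B / b powr \<tau>) powr (y / (2 * b))"
proof (cases "B / b powr \<tau> < 1")
  case False
  have Xm: "Xs i \<in> borel_measurable M" if "i \<ge> 1" for i using XH[OF that] H_measurable by auto
  have "Measurable.pred M (\<lambda>\<omega>. \<exists>k\<in>{1..n}. y < (\<Sum>i=1..k. trunc_at b (a i * Xs i \<omega>)))"
    unfolding trunc_at_def using Xm
    by (intro pred_intros_finite)
       (auto intro!: borel_measurable_less borel_measurable_sum borel_measurable_max borel_measurable_min borel_measurable_times)
  then have "cap E {\<omega>\<in>space M. \<exists>k\<in>{1..n}. y < (\<Sum>i=1..k. trunc_at b (a i * Xs i \<omega>))} \<le> 1"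
    by (intro cap_bounds) auto
  also have "1 \<le> exp 3 * (B / b powr \<tau>) powr (y / (2 * b))"
  proof -
    have "1 \<le> (B / b powr \<tau>) powr (y / (2 * b))"
      using False y b by (intro ge_one_powr_ge_zero) auto
    then show ?thesis using mult_mono[of 1 "exp 3" 1 "(B / b powr \<tau>) powr (y / (2 * b))"] by simp
  qed
  finally show ?thesis .
next
  case True
  define \<rho> where "\<rho> = B / b powr \<tau>"
  have \<rho>: "0 < \<rho>" "\<rho> < 1" using True B b by (auto simp: \<rho>_def)
  \<comment> \<open>the exponent that makes the exponential moments of the partial sums bounded\<close>
  define u where "u = - ln \<rho> / 2"
  have u: "0 < u" "exp (2 * u) = 1 / \<rho>" using \<rho> by (auto simp: u_def exp_minus field_simps)
  define t where "t = u / b"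
  have t: "0 < t" using u b by (simp add: t_def)
  define f where "f = (\<lambda>i x. t * trunc_at b (a i * x))"
  define d where "d = (\<lambda>i. 3 * exp (2 * u) * (\<bar>a i\<bar> powr \<tau> / b powr \<tau>) * L)"
  have "cap E {\<omega>\<in>space M. \<exists>k\<in>{1..n}. t * y < (\<Sum>i=1..k. f i (Xs i \<omega>))} \<le> exp ((\<Sum>i=1..n. d i) - t * y)"
  proof (rule cap_max_exp[OF ind XH n])
    show "f i \<in> borel_measurable borel" for i unfolding f_def trunc_at_def by measurable
    show "f i x \<le> u" for i x
      unfolding f_def t_def using trunc_at_le(1)[of b "a i * x"] b u by (simp add: field_simps)
    show "0 \<le> u" using u by simp
    show "0 \<le> d i" for i using L by (simp add: d_def)
    fix i assume i: "i \<in> {1..n}"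
    show "(\<lambda>\<omega>. exp (f i (Xs i \<omega>))) \<in> H" unfolding f_def using i t b by (intro exp_trunc_H XH) auto
    show "E (\<lambda>\<omega>. exp (f i (Xs i \<omega>))) \<le> ereal (1 + d i)"
      unfolding f_def t_def d_def using i u b by (intro E_exp_trunc XH \<tau> L mean) auto
  qed
  also have "(\<lambda>\<omega>. \<exists>k\<in>{1..n}. t * y < (\<Sum>i=1..k. f i (Xs i \<omega>)))
      = (\<lambda>\<omega>. \<exists>k\<in>{1..n}. y < (\<Sum>i=1..k. trunc_at b (a i * Xs i \<omega>)))"
    unfolding f_def sum_distrib_left[symmetric] using t by simp
  also have "(\<Sum>i=1..n. d i) = 3 / \<rho> * ((L * (\<Sum>i=1..n. \<bar>a i\<bar> powr \<tau>)) / b powr \<tau>)"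
    unfolding d_def u(2) by (simp add: sum_distrib_left sum_divide_distrib mult_ac)
  also have "exp (\<dots> - t * y) \<le> exp (3 - t * y)"
  proof -
    have "3 / \<rho> * ((L * (\<Sum>i=1..n. \<bar>a i\<bar> powr \<tau>)) / b powr \<tau>) \<le> 3 / \<rho> * (B / b powr \<tau>)"
      using B \<rho> by (intro mult_left_mono divide_right_mono) auto
    also have "\<dots> = 3" using \<rho> unfolding \<rho>_def[symmetric] by simp
    finally show ?thesis by simp
  qed
  also have "exp (3 - t * y) = exp 3 * \<rho> powr (y / (2 * b))"
    using \<rho> b by (simp add: powr_def exp_diff t_def u_def exp_minus field_simps flip: exp_add)
  finally show ?thesis by (simp add: \<rho>_def)
qed

text \<open>Unless some summand exceeds \<open>b\<close>, truncation at \<open>b\<close> changes nothing; the truncated sums are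
  estimated from above and, with the signs of the coefficients reversed, from below.\<close>

lemma cap_max_sum:
  assumes ind: "indep_seq H E Xs" and XH: "\<And>i. i \<ge> 1 \<Longrightarrow> Xs i \<in> H" and n: "n \<ge> 1"
    and b: "0 < b" and y: "0 < y" and \<tau>: "0 < \<tau>" "\<tau> \<le> 2"
    and L: "\<And>i. i \<in> {1..n} \<Longrightarrow> E (\<lambda>\<omega>. trunc_powr \<tau> (Xs i \<omega>)) \<le> ereal L" "0 \<le> L"
    and mean: "\<And>i. i \<in> {1..n} \<Longrightarrow> \<tau> \<le> 1 \<or> E (\<lambda>\<omega>. a i * Xs i \<omega>) \<le> 0 \<and> E (\<lambda>\<omega>. - a i * Xs i \<omega>) \<le> 0"
    and B: "L * (\<Sum>i=1..n. \<bar>a i\<bar> powr \<tau>) \<le> B" "0 < B"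
  shows "cap E {\<omega>\<in>space M. \<exists>k\<in>{1..n}. y < \<bar>\<Sum>i=1..k. a i * Xs i \<omega>\<bar>}
    \<le> (\<Sum>i=1..n. cap E {\<omega>\<in>space M. b < \<bar>a i * Xs i \<omega>\<bar>})
      + 2 * exp 3 * (B / b powr \<tau>) powr (y / (2 * b))"
proof -
  have Xm: "Xs i \<in> borel_measurable M" if "i \<ge> 1" for i using XH[OF that] H_measurable by auto
  define T where "T = (\<lambda>c \<omega>. \<exists>k\<in>{1..n}. y < (\<Sum>i=1..k. trunc_at b (c * a i * Xs i \<omega>)))"
  have Tm: "{\<omega>\<in>space M. T c \<omega>} \<in> sets M" for c
  proof -
    have "Measurable.pred M (T c)"
      unfolding trunc_at_def T_def using Xm
      by (intro pred_intros_finite)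
        (auto intro!: borel_measurable_less borel_measurable_sum borel_measurable_max borel_measurable_min borel_measurable_times)
    then show ?thesis by simp
  qed
  have aXm: "(\<lambda>\<omega>. a i * Xs i \<omega>) \<in> borel_measurable M" if "i \<ge> 1" for i using Xm[OF that] by measurable
  define U where "U = (\<Union>i\<in>{1..n}. {\<omega>\<in>space M. b < \<bar>a i * Xs i \<omega>\<bar>})"
  have Um: "{\<omega>\<in>space M. b < \<bar>a i * Xs i \<omega>\<bar>} \<in> sets M" if "i \<in> {1..n}" for i
  proof -
    have "Measurable.pred M (\<lambda>\<omega>. b < \<bar>a i * Xs i \<omega>\<bar>)"
      using aXm[of i] that by (auto intro!: borel_measurable_less borel_measurable_abs)
    then show ?thesis by simp
  qed
  then have Um': "U \<in> sets M" unfolding U_def by auto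
  have m1: "\<tau> \<le> 1 \<or> E (\<lambda>\<omega>. a i * Xs i \<omega>) \<le> 0" and m2: "\<tau> \<le> 1 \<or> E (\<lambda>\<omega>. - a i * Xs i \<omega>) \<le> 0"
    if "i \<in> {1..n}" for i using mean[OF that] by auto
  have T1: "cap E {\<omega>\<in>space M. T 1 \<omega>} \<le> exp 3 * (B / b powr \<tau>) powr (y / (2 * b))"
    unfolding T_def using cap_max_trunc[where a = a, OF ind XH n b y \<tau> L m1 B] by simp
  have T2: "cap E {\<omega>\<in>space M. T (-1) \<omega>} \<le> exp 3 * (B / b powr \<tau>) powr (y / (2 * b))"
    unfolding T_def using cap_max_trunc[where a = "\<lambda>i. - a i" and B = B, OF ind XH n b y \<tau> L m2] B by simp
  have sub: "{\<omega>\<in>space M. \<exists>k\<in>{1..n}. y < \<bar>\<Sum>i=1..k. a i * Xs i \<omega>\<bar>}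
      \<subseteq> U \<union> ({\<omega>\<in>space M. T 1 \<omega>} \<union> {\<omega>\<in>space M. T (-1) \<omega>})"
  proof safe
    fix \<omega> k assume \<omega>: "\<omega> \<in> space M" "\<omega> \<notin> U" "\<not> T (-1) \<omega>" and k: "k \<in> {1..n}" "y < \<bar>\<Sum>i=1..k. a i * Xs i \<omega>\<bar>"
    have le: "\<bar>a i * Xs i \<omega>\<bar> \<le> b" if "i \<in> {1..k}" for i
    proof -
      have "i \<in> {1..n}" using that k(1) by auto
      then have "\<not> b < \<bar>a i * Xs i \<omega>\<bar>" using \<omega>(1,2) unfolding U_def by blast
      then show ?thesis by simp
    qed
    have c1: "(\<Sum>i=1..k. trunc_at b (1 * a i * Xs i \<omega>)) = (\<Sum>i=1..k. a i * Xs i \<omega>)"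
      by (rule sum.cong) (use le in \<open>auto intro!: trunc_at_id\<close>)
    have "(\<Sum>i=1..k. trunc_at b (- 1 * a i * Xs i \<omega>)) = (\<Sum>i=1..k. - (a i * Xs i \<omega>))"
      by (rule sum.cong) (use le b in \<open>auto simp: trunc_at_minus intro!: trunc_at_id\<close>)
    then have c2: "(\<Sum>i=1..k. trunc_at b (- 1 * a i * Xs i \<omega>)) = - (\<Sum>i=1..k. a i * Xs i \<omega>)"
      by (simp add: sum_negf)
    have "\<not> y < - (\<Sum>i=1..k. a i * Xs i \<omega>)" using \<omega>(3) k(1) unfolding T_def c2[symmetric] by blast
    then have "y < (\<Sum>i=1..k. trunc_at b (1 * a i * Xs i \<omega>))" using k(2) c1 by linarith
    then show "T 1 \<omega>" using k(1) unfolding T_def by blast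
  qed
  have "Measurable.pred M (\<lambda>\<omega>. \<exists>k\<in>{1..n}. y < \<bar>\<Sum>i=1..k. a i * Xs i \<omega>\<bar>)"
    using aXm by (intro pred_intros_finite) (auto intro!: borel_measurable_less borel_measurable_abs borel_measurable_sum)
  then have "cap E {\<omega>\<in>space M. \<exists>k\<in>{1..n}. y < \<bar>\<Sum>i=1..k. a i * Xs i \<omega>\<bar>}
    \<le> cap E (U \<union> ({\<omega>\<in>space M. T 1 \<omega>} \<union> {\<omega>\<in>space M. T (-1) \<omega>}))"
    using Tm Um' sub by (intro cap_mono) auto
  also have "\<dots> \<le> cap E U + (cap E {\<omega>\<in>space M. T 1 \<omega>} + cap E {\<omega>\<in>space M. T (-1) \<omega>})"
    using Tm Um' by (intro order_trans[OF cap_Un] add_left_mono cap_Un) auto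
  also have "cap E U \<le> (\<Sum>i=1..n. cap E {\<omega>\<in>space M. b < \<bar>a i * Xs i \<omega>\<bar>})"
    unfolding U_def using Um by (intro cap_UN) auto
  finally show ?thesis using T1 T2 by linarith
qed

text \<open>A dyadic decomposition of the values of \<open>Y\<close> dominates the truncated power by a series of
  indicators, to which countable subadditivity applies. The bound depends on the
  tail alone and hence is common to all variables with the same tail.\<close>

lemma E_trunc_powr_finite:
  assumes csub: "countably_subadditive_expectation M H E" and \<tau>: "0 < \<tau>" "\<tau> \<le> 2" "\<tau> < s"
  shows "\<exists>L\<ge>0. \<forall>Y\<in>H. (\<forall>w\<ge>1. cap E {\<omega>\<in>space M. w < \<bar>Y \<omega>\<bar>} \<le> C * w powr (- s))
     \<longrightarrow> E (\<lambda>\<omega>. trunc_powr \<tau> (Y \<omega>)) \<le> ereal L"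
proof -
  define D where "D = (\<lambda>k::nat. \<bar>C\<bar> * 2 powr \<tau> * (2 powr (\<tau> - s)) ^ k)"
  have sD: "summable D" unfolding D_def
    using \<tau> by (intro summable_mult summable_geometric) (auto simp: powr_less_one)
  have D0: "0 \<le> D k" for k by (simp add: D_def)
  show ?thesis
  proof (intro exI[of _ "1 + suminf D"] conjI ballI impI)
    show "0 \<le> 1 + suminf D" using suminf_nonneg[OF sD D0] by simp
    fix Y assume Y: "Y \<in> H" and G: "\<forall>w\<ge>1. cap E {\<omega>\<in>space M. w < \<bar>Y \<omega>\<bar>} \<le> C * w powr (- s)"
    have Ym: "Y \<in> borel_measurable M" using Y H_measurable by auto
    define c where "c = (\<lambda>k::nat. (2::real) ^ k)"
    define W where "W = (\<lambda>k \<omega>. (if c k < \<bar>Y \<omega>\<bar> then 1 else 0 :: real))"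
    define V where "V = case_nat (\<lambda>_. 1) (\<lambda>k \<omega>. c (Suc k) powr \<tau> * W k \<omega>)"
    have Wm: "Measurable.pred M (\<lambda>\<omega>. c k < \<bar>Y \<omega>\<bar>)" for k
      using Ym by measurable
    have WH: "W k \<in> H" for k unfolding W_def by (rule H_indicator_pred[OF Wm])
    have VH: "V k \<in> H" for k unfolding V_def using WH by (auto intro!: H_const H_cmult split: nat.split)
    have V0: "0 \<le> V k \<omega>" for k \<omega> unfolding V_def W_def by (auto split: nat.split)
    have EV: "E (V (Suc k)) \<le> ereal (D k)" for k
    proof -
      have "E (V (Suc k)) = ereal (c (Suc k) powr \<tau>) * E (W k)"
        unfolding V_def nat.case using WH by (intro E_pos_homogeneous) auto
      also have "E (W k) = ereal (cap E {\<omega>\<in>space M. c k < \<bar>Y \<omega>\<bar>})"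
        unfolding W_def by (rule E_indicator_pred[OF Wm])
      also have "ereal (c (Suc k) powr \<tau>) * \<dots> \<le> ereal (c (Suc k) powr \<tau> * (\<bar>C\<bar> * c k powr (- s)))"
      proof -
        have "cap E {\<omega>\<in>space M. c k < \<bar>Y \<omega>\<bar>} \<le> C * c k powr (- s)"
          using G by (simp add: c_def)
        also have "\<dots> \<le> \<bar>C\<bar> * c k powr (- s)" by (intro mult_right_mono) auto
        finally show ?thesis by (simp add: mult_left_mono)
      qed
      also have "c (Suc k) powr \<tau> * (\<bar>C\<bar> * c k powr (- s)) = D k"
        unfolding c_def D_def
        by (simp add: powr_mult powr_powr powr_realpow[symmetric] powr_diff powr_minus field_simps flip: powr_add)
      finally show ?thesis .
    qed
    have "E (\<lambda>\<omega>. trunc_powr \<tau> (Y \<omega>)) \<le> (\<Sum>k. E (V k))"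
    proof (rule csub[unfolded countably_subadditive_expectation_def, rule_format, OF trunc_powr_H[OF Y \<tau>(1,2)] VH])
      show "0 \<le> trunc_powr \<tau> (Y \<omega>)" for \<omega> by (simp add: trunc_powr_def)
      show "0 \<le> V k \<omega>" for k \<omega> by (rule V0)
      fix \<omega>
      have "\<exists>k. trunc_powr \<tau> (Y \<omega>) \<le> V k \<omega>"
      proof (cases "\<bar>Y \<omega>\<bar> \<le> 1")
        case True then show ?thesis by (intro exI[of _ 0]) (simp add: V_def trunc_powr_def)
      next
        case False
        have "\<exists>k. \<bar>Y \<omega>\<bar> \<le> c k" unfolding c_def
          by (metis less_imp_le one_less_numeral_iff real_arch_pow semiring_norm(76))
        then obtain k where k: "\<bar>Y \<omega>\<bar> \<le> c k" "\<And>j. j < k \<Longrightarrow> \<not> \<bar>Y \<omega>\<bar> \<le> c j"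
          using exists_least_iff[of "\<lambda>k. \<bar>Y \<omega>\<bar> \<le> c k"] by blast
        with False obtain j where j: "k = Suc j" by (cases k) (auto simp: c_def)
        have "trunc_powr \<tau> (Y \<omega>) \<le> c (Suc j) powr \<tau>"
          unfolding trunc_powr_def using k(1) False \<tau> unfolding j by (intro powr_mono2) auto
        moreover have "W j \<omega> = 1" using k(2)[of j] j by (simp add: W_def not_le)
        ultimately show ?thesis by (intro exI[of _ "Suc j"]) (simp add: V_def)
      qed
      then obtain k where "ereal (trunc_powr \<tau> (Y \<omega>)) \<le> ereal (V k \<omega>)" by auto
      also have "\<dots> \<le> (\<Sum>k. ereal (V k \<omega>))"
        using sum_le_suminf[of "\<lambda>k. ereal (V k \<omega>)" "{k}"] V0 summable_ereal_pos[of "\<lambda>k. ereal (V k \<omega>)"] by simp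
      finally show "ereal (trunc_powr \<tau> (Y \<omega>)) \<le> (\<Sum>k. ereal (V k \<omega>))" .
    qed
    also have "\<dots> \<le> (\<Sum>k. ereal (case_nat 1 D k))"
    proof (rule suminf_le_pos)
      show "E (V k) \<le> ereal (case_nat 1 D k)" for k
        using EV by (cases k) (auto simp: V_def E_const)
      show "0 \<le> E (V k)" for k using V0 by (intro E_nonneg VH)
    qed
    also have "\<dots> = ereal (1 + suminf D)"
    proof -
      have "case_nat 1 D sums (suminf D + case_nat 1 D 0)"
        using summable_sums[OF sD] by (subst sums_Suc_iff[symmetric]) simp
      then have "(\<lambda>k. ereal (case_nat 1 D k)) sums ereal (suminf D + 1)" by (simp add: sums_ereal)
      then show ?thesis using sums_unique by (metis add.commute)
    qed
    finally show "E (\<lambda>\<omega>. trunc_powr \<tau> (Y \<omega>)) \<le> ereal (1 + suminf D)" .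
  qed
qed

end

section \<open>Lattice sums over the rows of the array\<close>

text \<open>The index pairs \<open>(i, n)\<close> that contribute to the kernel, in terms of \<open>w = v powr (1/\<theta>)\<close>. The
  parameter \<open>n0\<close> discards finitely many rows, on which the weights of the array are arbitrary.\<close>

definition lattice_region :: "real \<Rightarrow> nat \<Rightarrow> real \<Rightarrow> (nat \<times> nat) set" where
  "lattice_region r n0 w = {(i, n). 1 \<le> i \<and> i \<le> n \<and> n0 \<le> n \<and> real i * real n powr (r - 1) < w}"

definition lattice_term :: "real \<Rightarrow> real \<Rightarrow> nat \<times> nat \<Rightarrow> real" where
  "lattice_term r \<theta> = (\<lambda>(i, n). real n powr (r - 2) * (real i * real n powr (r - 1)) powr (- \<theta>))"

text \<open>The summand factorises, which reduces all counting to one-dimensional power sums.\<close>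

lemma lattice_term_eq:
  "lattice_term r \<theta> (i, n) = real i powr (- \<theta>) * real n powr ((r - 1) * (1 - \<theta>) - 1)"
proof -
  have "(real i * real n powr (r - 1)) powr (- \<theta>) = real i powr (- \<theta>) * real n powr ((r - 1) * (- \<theta>))"
    by (simp add: powr_mult powr_powr)
  then have "lattice_term r \<theta> (i, n) = real i powr (- \<theta>) * (real n powr (r - 2) * real n powr ((r - 1) * (- \<theta>)))"
    by (simp add: lattice_term_def)
  also have "real n powr (r - 2) * real n powr ((r - 1) * (- \<theta>)) = real n powr ((r - 1) * (1 - \<theta>) - 1)"
    by (simp add: powr_add[symmetric] algebra_simps)
  finally show ?thesis .
qed

lemma lattice_term_nonneg: "0 \<le> lattice_term r \<theta> x"
  by (cases x) (simp add: lattice_term_eq)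

lemma harm_upper: "1 \<le> x \<Longrightarrow> (\<Sum>i=1..nat \<lfloor>x\<rfloor>. 1 / real i) \<le> 1 + ln x"
proof -
  assume x: "1 \<le> x"
  define m where "m = nat \<lfloor>x\<rfloor>"
  have m: "1 \<le> m" "real m \<le> x" using x by (auto simp: m_def le_nat_floor)
  obtain k where k: "m = Suc k" using m(1) by (cases m) auto
  have "harm (Suc k) - ln (real (Suc k)) \<le> 1"
    using decseqD[OF decseq_harm_diff_ln, of 0 k] by (simp add: harm_expand)
  then have "harm m \<le> 1 + ln (real m)" by (simp add: k)
  also have "ln (real m) \<le> ln x" using m by simp
  finally show ?thesis by (simp add: harm_def m_def inverse_eq_divide)
qed

lemma harm_lower: "ln (real m + 1) \<le> (\<Sum>i=1..m. 1 / real i)"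
  using ln_le_harm[of m] by (simp add: harm_def inverse_eq_divide)

lemma powr_sum_upper:
  assumes "0 < \<alpha>"
  shows "\<exists>C>0. \<forall>x\<ge>0. (\<Sum>n=1..nat \<lfloor>x\<rfloor>. real n powr (\<alpha> - 1)) \<le> C * x powr \<alpha>"
proof (cases "1 \<le> \<alpha>")
  case True
  have "(\<Sum>n=1..nat \<lfloor>x\<rfloor>. real n powr (\<alpha> - 1)) \<le> 1 * x powr \<alpha>" if "0 \<le> x" for x
  proof (cases "x = 0")
    case False
    with that have x: "0 < x" by simp
    have "(\<Sum>n=1..nat \<lfloor>x\<rfloor>. real n powr (\<alpha> - 1)) \<le> (\<Sum>n=1..nat \<lfloor>x\<rfloor>. x powr (\<alpha> - 1))"
    proof (rule sum_mono)
      fix n assume n: "n \<in> {1..nat \<lfloor>x\<rfloor>}"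
      then have "real n \<le> x" using that by (simp add: le_nat_iff le_floor_iff)
      then show "real n powr (\<alpha> - 1) \<le> x powr (\<alpha> - 1)" using True by (intro powr_mono2) auto
    qed
    also have "\<dots> = real (nat \<lfloor>x\<rfloor>) * x powr (\<alpha> - 1)" by simp
    also have "\<dots> \<le> x * x powr (\<alpha> - 1)" using that by (intro mult_right_mono) auto
    also have "\<dots> = x powr \<alpha>" using x powr_mult_base[of x "\<alpha> - 1"] by simp
    finally show ?thesis by simp
  qed simp
  then show ?thesis by (intro exI[of _ 1]) auto
next
  case False
  \<comment> \<open>by the mean value theorem, the sum is dominated by a telescoping one\<close>
  have step: "\<alpha> * real (Suc m) powr (\<alpha> - 1) \<le> real (Suc m) powr \<alpha> - real m powr \<alpha>" for m
  proof (cases "m = 0")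
    case False
    have "\<exists>z>real m. z < real (Suc m) \<and> real (Suc m) powr \<alpha> - real m powr \<alpha> = (real (Suc m) - real m) * (\<alpha> * z powr (\<alpha> - 1))"
      by (rule MVT2) (use False in \<open>auto intro!: has_real_derivative_powr\<close>)
    then obtain z where z: "z > real m" "z < real (Suc m)" "real (Suc m) powr \<alpha> - real m powr \<alpha> = \<alpha> * z powr (\<alpha> - 1)" by auto
    have "real (Suc m) powr (\<alpha> - 1) \<le> z powr (\<alpha> - 1)"
      using z \<open>\<not> 1 \<le> \<alpha>\<close> by (intro powr_mono2') auto
    then show ?thesis using z(3) assms by simp
  qed (use False assms in simp)
  have S: "\<alpha> * (\<Sum>n=1..m. real n powr (\<alpha> - 1)) \<le> real m powr \<alpha>" for m
  proof (induction m)
    case (Suc m)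
    have "\<alpha> * (\<Sum>n=1..Suc m. real n powr (\<alpha> - 1)) = \<alpha> * (\<Sum>n=1..m. real n powr (\<alpha> - 1)) + \<alpha> * real (Suc m) powr (\<alpha> - 1)"
      by (simp add: algebra_simps)
    with Suc step[of m] show ?case by linarith
  qed (use assms in simp)
  have "(\<Sum>n=1..nat \<lfloor>x\<rfloor>. real n powr (\<alpha> - 1)) \<le> 1 / \<alpha> * x powr \<alpha>" if "0 \<le> x" for x
  proof -
    have "real (nat \<lfloor>x\<rfloor>) powr \<alpha> \<le> x powr \<alpha>" using that assms by (intro powr_mono2) auto
    with S[of "nat \<lfloor>x\<rfloor>"] show ?thesis using assms by (simp add: field_simps)
  qed
  then show ?thesis using assms by (intro exI[of _ "1 / \<alpha>"]) auto
qed

lemma powr_sum_lower: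
  assumes x: "4 \<le> x"
  shows "min 1 ((1/2) powr (\<alpha> - 1)) / 4 * x powr \<alpha> \<le> (\<Sum>n \<in> {nat \<lfloor>x/2\<rfloor> + 1..nat \<lfloor>x\<rfloor>}. real n powr (\<alpha> - 1))"
proof -
  define c where "c = min 1 ((1/2::real) powr (\<alpha> - 1))"
  have c0: "0 \<le> c" by (simp add: c_def)
  have card: "x / 4 \<le> real (card {nat \<lfloor>x/2\<rfloor> + 1..nat \<lfloor>x\<rfloor>})"
  proof -
    have *: "real (nat \<lfloor>x\<rfloor>) \<ge> x - 1" "real (nat \<lfloor>x/2\<rfloor>) \<le> x / 2" using x by linarith+
    have "nat \<lfloor>x/2\<rfloor> \<le> nat \<lfloor>x\<rfloor>" using x by (intro nat_mono floor_mono) simp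
    then have "real (card {nat \<lfloor>x/2\<rfloor> + 1..nat \<lfloor>x\<rfloor>}) = real (nat \<lfloor>x\<rfloor>) - real (nat \<lfloor>x/2\<rfloor>)"
      by (simp only: card_atLeastAtMost of_nat_diff add_diff_cancel_right diff_Suc_Suc Suc_eq_plus1)
    with * show ?thesis using x by linarith
  qed
  have el: "c * x powr (\<alpha> - 1) \<le> real n powr (\<alpha> - 1)" if n: "n \<in> {nat \<lfloor>x/2\<rfloor> + 1..nat \<lfloor>x\<rfloor>}" for n
  proof -
    have nx: "real n \<le> x" "x / 2 \<le> real n"
      using n x by (auto simp: le_nat_iff le_floor_iff) linarith
    show ?thesis
    proof (cases "1 \<le> \<alpha>")
      case True
      have "c * x powr (\<alpha> - 1) \<le> (1/2) powr (\<alpha> - 1) * x powr (\<alpha> - 1)" by (intro mult_right_mono) (auto simp: c_def)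
      also have "\<dots> = (x / 2) powr (\<alpha> - 1)" using x by (simp add: powr_mult[symmetric])
      also have "\<dots> \<le> real n powr (\<alpha> - 1)" using nx x True by (intro powr_mono2) auto
      finally show ?thesis .
    next
      case False
      have "c * x powr (\<alpha> - 1) \<le> 1 * x powr (\<alpha> - 1)" by (intro mult_right_mono) (auto simp: c_def)
      also have "\<dots> \<le> real n powr (\<alpha> - 1)" using nx x False by (simp, intro powr_mono2') auto
      finally show ?thesis .
    qed
  qed
  have "c / 4 * x powr \<alpha> = x / 4 * (c * x powr (\<alpha> - 1))" using x powr_mult_base[of x "\<alpha> - 1"] by simp
  also have "\<dots> \<le> real (card {nat \<lfloor>x/2\<rfloor> + 1..nat \<lfloor>x\<rfloor>}) * (c * x powr (\<alpha> - 1))"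
    using card c0 by (intro mult_right_mono) auto
  also have "\<dots> \<le> (\<Sum>n \<in> {nat \<lfloor>x/2\<rfloor> + 1..nat \<lfloor>x\<rfloor>}. real n powr (\<alpha> - 1))"
    by (rule sum_bounded_below) (rule el)
  finally show ?thesis by (simp add: c_def)
qed

lemma powr_neg_ratio: "0 < x \<Longrightarrow> x powr (- \<theta>) / x powr (1 - \<theta>) = 1 / x" for x :: real
  using powr_diff[of x "- \<theta>" "1 - \<theta>"] by (simp add: powr_minus_divide)

lemma lattice_sum_le_box:
  assumes "finite I" "\<And>i. i \<in> I \<Longrightarrow> finite (N i)" "F \<subseteq> Sigma I N"
  shows "sum (lattice_term r \<theta>) F
    \<le> (\<Sum>i\<in>I. real i powr (- \<theta>) * (\<Sum>n\<in>N i. real n powr ((r - 1) * (1 - \<theta>) - 1)))"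
proof -
  have "sum (lattice_term r \<theta>) F \<le> sum (lattice_term r \<theta>) (Sigma I N)"
    using assms by (intro sum_mono2 lattice_term_nonneg) auto
  also have "\<dots> = (\<Sum>i\<in>I. \<Sum>n\<in>N i. lattice_term r \<theta> (i, n))"
    using assms by (subst sum.Sigma) auto
  finally show ?thesis by (simp add: lattice_term_eq sum_distrib_left)
qed

lemma lattice_sum_box:
  assumes "finite I" "\<And>i. i \<in> I \<Longrightarrow> finite (N i)"
  shows "sum (lattice_term r \<theta>) (Sigma I N)
    = (\<Sum>i\<in>I. real i powr (- \<theta>) * (\<Sum>n\<in>N i. real n powr ((r - 1) * (1 - \<theta>) - 1)))"
proof -
  have "(\<Sum>i\<in>I. \<Sum>n\<in>N i. lattice_term r \<theta> (i, n)) = (\<Sum>(i, n)\<in>Sigma I N. lattice_term r \<theta> (i, n))"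
    using assms by (intro sum.Sigma) auto
  then have "sum (lattice_term r \<theta>) (Sigma I N) = (\<Sum>i\<in>I. \<Sum>n\<in>N i. lattice_term r \<theta> (i, n))" by simp
  then show ?thesis by (simp add: lattice_term_eq sum_distrib_left)
qed

lemma lattice_upper_gt1:
  assumes "1 < r" "1 < \<theta>"
  shows "\<exists>C>0. \<forall>w F. finite F \<longrightarrow> F \<subseteq> lattice_region r 1 w \<longrightarrow> sum (lattice_term r \<theta>) F \<le> C"
proof -
  define \<gamma> where "\<gamma> = (r - 1) * (1 - \<theta>) - 1"
  have \<gamma>: "\<gamma> < - 1" using assms by (simp add: \<gamma>_def mult_pos_neg)
  have s1: "summable (\<lambda>n. real n powr (- \<theta>))" using assms by (simp add: summable_real_powr_iff)
  have s2: "summable (\<lambda>n. real n powr \<gamma>)" using \<gamma> by (simp add: summable_real_powr_iff)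
  define A where "A = (\<Sum>n. real n powr (- \<theta>))"
  define B where "B = (\<Sum>n. real n powr \<gamma>)"
  have A0: "0 \<le> A" "0 \<le> B" unfolding A_def B_def using s1 s2 by (auto intro!: suminf_nonneg)
  have "sum (lattice_term r \<theta>) F \<le> A * B + 1" if F: "finite F" for F
  proof -
    have "sum (lattice_term r \<theta>) F \<le> (\<Sum>i\<in>fst ` F. real i powr (- \<theta>) * (\<Sum>n\<in>snd ` F. real n powr \<gamma>))"
      unfolding \<gamma>_def using F by (intro lattice_sum_le_box) force+
    also have "\<dots> = (\<Sum>i\<in>fst ` F. real i powr (- \<theta>)) * (\<Sum>n\<in>snd ` F. real n powr \<gamma>)"
      by (simp add: sum_distrib_right)
    also have "\<dots> \<le> A * B"
      unfolding A_def B_def using F s1 s2 by (intro mult_mono sum_le_suminf sum_nonneg suminf_nonneg) auto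
    finally show ?thesis by simp
  qed
  then show ?thesis using A0 by (intro exI[of _ "A * B + 1"]) (auto intro!: add_nonneg_pos)
qed

text \<open>The region lies in a square with side a power of \<open>w\<close>, on which the summand is \<open>1/(i n)\<close>; both
  harmonic sums contribute a logarithm.\<close>

lemma lattice_upper_eq1:
  assumes "1 < r" "1 \<le> w" "finite F" "F \<subseteq> lattice_region r 1 w"
  shows "sum (lattice_term r 1) F \<le> (1 + ln w / (r - 1))\<^sup>2"
proof -
  define x where "x = w powr (1 / (r - 1))"
  have x1: "1 \<le> x" unfolding x_def using assms by (intro ge_one_powr_ge_zero) auto
  have "F \<subseteq> {1..nat \<lfloor>x\<rfloor>} \<times> {1..nat \<lfloor>x\<rfloor>}"
  proof
    fix z assume "z \<in> F"
    with assms(4) obtain i n where z: "z = (i, n)" "1 \<le> i" "i \<le> n" "real i * real n powr (r - 1) < w"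
      by (auto simp: lattice_region_def)
    have "1 * real n powr (r - 1) \<le> real i * real n powr (r - 1)" using z by (intro mult_right_mono) auto
    with z have "real n powr (r - 1) \<le> w" by linarith
    then have "(real n powr (r - 1)) powr (1 / (r - 1)) \<le> x" unfolding x_def using assms by (intro powr_mono2) auto
    then have "real n \<le> x" using assms by (simp add: powr_powr)
    then have "n \<le> nat \<lfloor>x\<rfloor>" by (simp add: le_nat_floor)
    with z show "z \<in> {1..nat \<lfloor>x\<rfloor>} \<times> {1..nat \<lfloor>x\<rfloor>}" by auto
  qed
  then have "sum (lattice_term r 1) F
      \<le> (\<Sum>i\<in>{1..nat \<lfloor>x\<rfloor>}. real i powr (- 1) * (\<Sum>n\<in>{1..nat \<lfloor>x\<rfloor>}. real n powr ((r - 1) * (1 - 1) - 1)))"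
    by (intro lattice_sum_le_box) auto
  also have "\<dots> = (\<Sum>i=1..nat \<lfloor>x\<rfloor>. 1 / real i)\<^sup>2"
    by (simp add: powr_minus_divide power2_eq_square sum_distrib_right)
  also have "\<dots> \<le> (1 + ln x)\<^sup>2"
    using harm_upper[OF x1] by (intro power_mono sum_nonneg) auto
  also have "ln x = ln w / (r - 1)" using assms by (simp add: x_def ln_powr)
  finally show ?thesis .
qed

text \<open>For fixed \<open>i\<close>, the sum over \<open>n\<close> is dominated by its largest index, which is of order \<open>w/i\<close> to
  the power \<open>1/(r-1)\<close>, and gives \<open>w powr (1 - \<theta>) / i\<close>. As \<open>i \<le> n\<close> forces \<open>i powr r \<le> w\<close>, the sum
  over \<open>i\<close> is logarithmic.\<close>

lemma lattice_upper_lt1: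
  assumes "1 < r" "0 < \<theta>" "\<theta> < 1"
  shows "\<exists>C>0. \<forall>w\<ge>1. \<forall>F. finite F \<longrightarrow> F \<subseteq> lattice_region r 1 w
    \<longrightarrow> sum (lattice_term r \<theta>) F \<le> C * w powr (1 - \<theta>) * (1 + ln w / r)"
proof -
  define \<alpha> where "\<alpha> = (r - 1) * (1 - \<theta>)"
  have \<alpha>: "0 < \<alpha>" using assms by (simp add: \<alpha>_def)
  obtain C where C: "0 < C" "\<And>x. 0 \<le> x \<Longrightarrow> (\<Sum>n=1..nat \<lfloor>x\<rfloor>. real n powr (\<alpha> - 1)) \<le> C * x powr \<alpha>"
    using powr_sum_upper[OF \<alpha>] by blast
  have "sum (lattice_term r \<theta>) F \<le> C * w powr (1 - \<theta>) * (1 + ln w / r)"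
    if w: "1 \<le> w" and F: "finite F" "F \<subseteq> lattice_region r 1 w" for w F
  proof -
    define x where "x = w powr (1 / r)"
    define N where "N = (\<lambda>i::nat. (w / real i) powr (1 / (r - 1)))"
    have x1: "1 \<le> x" unfolding x_def using assms w by (intro ge_one_powr_ge_zero) auto
    have "F \<subseteq> (SIGMA i:{1..nat \<lfloor>x\<rfloor>}. {1..nat \<lfloor>N i\<rfloor>})"
    proof
      fix z assume "z \<in> F"
      with F(2) obtain i n where z: "z = (i, n)" "1 \<le> i" "i \<le> n" "real i * real n powr (r - 1) < w"
        by (auto simp: lattice_region_def)
      have "real i powr r = real i * real i powr (r - 1)" using z powr_mult_base[of "real i" "r - 1"] by simp
      also have "\<dots> \<le> real i * real n powr (r - 1)" using z assms by (intro mult_left_mono powr_mono2) auto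
      finally have "real i powr r \<le> w" using z by simp
      then have "(real i powr r) powr (1 / r) \<le> x" unfolding x_def using assms by (intro powr_mono2) auto
      then have "real i \<le> x" using assms by (simp add: powr_powr)
      then have i: "i \<le> nat \<lfloor>x\<rfloor>" by (simp add: le_nat_floor)
      have "real n powr (r - 1) \<le> w / real i" using z by (simp add: field_simps)
      then have "(real n powr (r - 1)) powr (1 / (r - 1)) \<le> N i" unfolding N_def using assms by (intro powr_mono2) auto
      then have "real n \<le> N i" using assms by (simp add: powr_powr)
      then have "n \<le> nat \<lfloor>N i\<rfloor>" by (simp add: le_nat_floor)
      with z i show "z \<in> (SIGMA i:{1..nat \<lfloor>x\<rfloor>}. {1..nat \<lfloor>N i\<rfloor>})" by auto
    qed
    then have "sum (lattice_term r \<theta>) F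
        \<le> (\<Sum>i\<in>{1..nat \<lfloor>x\<rfloor>}. real i powr (- \<theta>) * (\<Sum>n\<in>{1..nat \<lfloor>N i\<rfloor>}. real n powr (\<alpha> - 1)))"
      unfolding \<alpha>_def by (intro lattice_sum_le_box) auto
    also have "\<dots> \<le> (\<Sum>i\<in>{1..nat \<lfloor>x\<rfloor>}. C * w powr (1 - \<theta>) * (1 / real i))"
    proof (rule sum_mono)
      fix i assume i: "i \<in> {1..nat \<lfloor>x\<rfloor>}"
      have "(\<Sum>n\<in>{1..nat \<lfloor>N i\<rfloor>}. real n powr (\<alpha> - 1)) \<le> C * N i powr \<alpha>" by (rule C) (simp add: N_def)
      also have "N i powr \<alpha> = (w / real i) powr (1 - \<theta>)" using assms by (simp add: N_def powr_powr \<alpha>_def)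
      also have "\<dots> = w powr (1 - \<theta>) / real i powr (1 - \<theta>)" using w by (simp add: powr_divide)
      finally have "real i powr (- \<theta>) * (\<Sum>n\<in>{1..nat \<lfloor>N i\<rfloor>}. real n powr (\<alpha> - 1))
        \<le> real i powr (- \<theta>) * (C * (w powr (1 - \<theta>) / real i powr (1 - \<theta>)))" by (intro mult_left_mono) auto
      also have "\<dots> = C * w powr (1 - \<theta>) * (real i powr (- \<theta>) / real i powr (1 - \<theta>))" by simp
      also have "real i powr (- \<theta>) / real i powr (1 - \<theta>) = 1 / real i"
        using i by (intro powr_neg_ratio) simp
      finally show "real i powr (- \<theta>) * (\<Sum>n\<in>{1..nat \<lfloor>N i\<rfloor>}. real n powr (\<alpha> - 1)) \<le> C * w powr (1 - \<theta>) * (1 / real i)" .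
    qed
    also have "\<dots> = C * w powr (1 - \<theta>) * (\<Sum>i=1..nat \<lfloor>x\<rfloor>. 1 / real i)" by (simp only: sum_distrib_left)
    also have "\<dots> \<le> C * w powr (1 - \<theta>) * (1 + ln x)"
      using harm_upper[OF x1] C by (intro mult_left_mono) auto
    also have "ln x = ln w / r" using w by (simp add: x_def ln_powr)
    finally show ?thesis .
  qed
  then show ?thesis using C(1) by blast
qed

lemma lattice_lower_gt1:
  assumes "1 < r" "1 \<le> n0"
  shows "\<exists>c>0. \<exists>w0. \<forall>w\<ge>w0. \<exists>F. finite F \<and> F \<subseteq> lattice_region r n0 w \<and> c \<le> sum (lattice_term r \<theta>) F"
proof (intro exI conjI allI impI)
  show "0 < lattice_term r \<theta> (1, n0)" using assms by (simp add: lattice_term_eq)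
  show "real n0 powr (r - 1) + 1 \<le> w \<Longrightarrow> {(1, n0)} \<subseteq> lattice_region r n0 w" for w
    using assms by (simp add: lattice_region_def)
qed auto

text \<open>With \<open>A\<close> of order \<open>w\<close> to the power \<open>1/(2r)\<close>, the box of pairs with \<open>i \<le> A < n \<le> A\<^sup>2\<close> lies in the
  region and its two harmonic sums are both of order \<open>ln w\<close>.\<close>

lemma lattice_lower_eq1:
  assumes r: "1 < r"
  shows "\<exists>c>0. \<exists>w0. \<forall>w\<ge>w0. \<exists>F. finite F \<and> F \<subseteq> lattice_region r n0 w \<and> c * (ln w)\<^sup>2 \<le> sum (lattice_term r 1) F"
proof -
  \<comment> \<open>beyond \<open>w0\<close>, the side \<open>A\<close> of the box is at least \<open>n0\<close> and satisfies \<open>ln A \<ge> ln x / 2 + 2\<close>,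
    where the \<open>2\<close> absorbs the additive errors of the harmonic sums\<close>
  define w0 where "w0 = max (exp (4 * r * ln 2 + 8 * r)) ((real n0 + 1) powr (2 * r))"
  have "\<exists>F. finite F \<and> F \<subseteq> lattice_region r n0 w \<and> 1 / (32 * r\<^sup>2) * (ln w)\<^sup>2 \<le> sum (lattice_term r 1) F" if w: "w0 \<le> w" for w
  proof -
    have w1: "exp (4 * r * ln 2 + 8 * r) \<le> w" "(real n0 + 1) powr (2 * r) \<le> w" using w by (auto simp: w0_def)
    have wpos: "0 < w" using w1(1) exp_gt_zero[of "4 * r * ln 2 + 8 * r"] by linarith
    have lnw: "4 * r * ln 2 + 8 * r \<le> ln w" using w1(1) wpos by (simp add: ln_ge_iff)
    define x where "x = w powr (1 / (2 * r))"
    define A where "A = nat \<lfloor>x\<rfloor>"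
    have xn0: "real n0 + 1 \<le> x"
    proof -
      have "((real n0 + 1) powr (2 * r)) powr (1 / (2 * r)) \<le> x" unfolding x_def using w1 r by (intro powr_mono2) auto
      then show ?thesis using r by (simp add: powr_powr)
    qed
    have Ax: "real A \<le> x" "x - 1 < real A" unfolding A_def using xn0 by linarith+
    have lnx: "ln x = ln w / (2 * r)" using wpos by (simp add: x_def ln_powr)
    have lnx2: "2 * ln 2 + 4 \<le> ln x"
    proof -
      have "(4 * r * ln 2 + 8 * r) / (2 * r) \<le> ln w / (2 * r)" using lnw r by (intro divide_right_mono) auto
      moreover have "(4 * r * ln 2 + 8 * r) / (2 * r) = 2 * ln 2 + 4" using r by (simp add: field_simps)
      ultimately show ?thesis using lnx by simp
    qed
    have x2: "2 \<le> x"
    proof -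
      have "0 \<le> ln (2 :: real)" by simp
      then have "ln 2 \<le> ln x" using lnx2 by linarith
      then show ?thesis using xn0 by simp
    qed
    have A1: "1 \<le> A" "n0 \<le> A" "x / 2 \<le> real A" using Ax xn0 x2 by linarith+
    have lnA: "ln x / 2 + 2 \<le> ln (real A)"
    proof -
      have "ln (x / 2) \<le> ln (real A)" using A1 x2 by (subst ln_le_cancel_iff) auto
      moreover have "ln (x / 2) = ln x - ln 2" using x2 by (simp add: ln_div)
      ultimately show ?thesis using lnx2 by simp
    qed
    have xw: "x powr (2 * r - 1) < w"
    proof -
      have "x powr (2 * r - 1) < x powr (2 * r)" using x2 by (intro powr_less_mono) auto
      also have "\<dots> = w" using wpos r by (simp add: x_def powr_powr)
      finally show ?thesis .
    qed
    define F where "F = {1..A} \<times> {A + 1..A\<^sup>2}"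
    have "F \<subseteq> lattice_region r n0 w"
    proof
      fix z assume "z \<in> F"
      then obtain i n where z: "z = (i, n)" "1 \<le> i" "i \<le> A" "A + 1 \<le> n" "n \<le> A\<^sup>2" by (auto simp: F_def)
      have "real i * real n powr (r - 1) \<le> x * (x\<^sup>2) powr (r - 1)"
      proof (intro mult_mono powr_mono2)
        show "real i \<le> x" using z Ax by linarith
        have "real n \<le> real A ^ 2" using z(5) by (metis of_nat_le_iff of_nat_power)
        also have "\<dots> \<le> x\<^sup>2" using Ax by (intro power_mono) auto
        finally show "real n \<le> x\<^sup>2" .
      qed (use r x2 in auto)
      also have "(x\<^sup>2) powr (r - 1) = x powr (2 * (r - 1))" using x2 by (simp add: powr_powr flip: powr_numeral)
      also have "x * x powr (2 * (r - 1)) = x powr (2 * r - 1)" using x2 by (simp add: powr_mult_base algebra_simps)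
      finally show "z \<in> lattice_region r n0 w" using z xw A1 by (auto simp: lattice_region_def)
    qed
    moreover have "finite F" by (simp add: F_def)
    moreover have "1 / (32 * r\<^sup>2) * (ln w)\<^sup>2 \<le> sum (lattice_term r 1) F"
    proof -
      have "sum (lattice_term r 1) F = (\<Sum>i\<in>{1..A}. real i powr (- 1) * (\<Sum>n\<in>{A + 1..A\<^sup>2}. real n powr ((r - 1) * (1 - 1) - 1)))"
        unfolding F_def by (rule lattice_sum_box) auto
      also have "\<dots> = (\<Sum>i=1..A. 1 / real i) * (\<Sum>n\<in>{A + 1..A\<^sup>2}. 1 / real n)"
        by (simp add: powr_minus_divide sum_distrib_right)
      finally have eq: "sum (lattice_term r 1) F = (\<Sum>i=1..A. 1 / real i) * (\<Sum>n\<in>{A + 1..A\<^sup>2}. 1 / real n)" .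
      have AA: "A \<le> A\<^sup>2" using A1 by (simp add: power2_eq_square)
      have "(\<Sum>n=1..A\<^sup>2. 1 / real n) = (\<Sum>n=1..A. 1 / real n) + (\<Sum>n\<in>{A + 1..A\<^sup>2}. 1 / real n)"
        using sum.ub_add_nat[of 1 A "\<lambda>n. 1 / real n" "A\<^sup>2 - A"] AA A1 by simp
      moreover have "(\<Sum>n=1..A. 1 / real n) \<le> 1 + ln (real A)" using harm_upper[of "real A"] A1 by simp
      moreover have "2 * ln (real A) \<le> (\<Sum>n=1..A\<^sup>2. 1 / real n)"
      proof -
        have "2 * ln (real A) = ln (real (A\<^sup>2))" using A1 by (simp add: ln_realpow)
        also have "\<dots> \<le> ln (real (A\<^sup>2) + 1)" using A1 by (subst ln_le_cancel_iff) (auto intro: add_pos_pos add_nonneg_pos)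
        also have "\<dots> \<le> (\<Sum>n=1..A\<^sup>2. 1 / real n)" by (rule harm_lower)
        finally show ?thesis .
      qed
      ultimately have s2: "ln x / 2 \<le> (\<Sum>n\<in>{A + 1..A\<^sup>2}. 1 / real n)" using lnA by linarith
      have "ln (real A) \<le> ln (real A + 1)" using A1 by (subst ln_le_cancel_iff) auto
      then have s1: "ln x / 2 \<le> (\<Sum>i=1..A. 1 / real i)" using harm_lower[of A] lnA by linarith
      have lx0: "0 \<le> ln x" using x2 by simp
      have "(ln x / 2) * (ln x / 2) \<le> sum (lattice_term r 1) F"
        unfolding eq using s1 s2 lx0 by (intro mult_mono sum_nonneg) auto
      moreover have "1 / (32 * r\<^sup>2) * (ln w)\<^sup>2 \<le> (ln x / 2) * (ln x / 2)"
        unfolding lnx using r by (simp add: power2_eq_square field_simps)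
      ultimately show ?thesis by linarith
    qed
    ultimately show ?thesis by blast
  qed
  moreover have "0 < 1 / (32 * r\<^sup>2)" using r by simp
  ultimately show ?thesis by blast
qed

text \<open>For \<open>i\<close> up to half of \<open>w powr (1/r)\<close>, the upper half of the range of \<open>n\<close> lies beyond \<open>i\<close> and
  carries a fixed proportion of the sum over \<open>n\<close>. The bound \<open>w/2\<close> in place of \<open>w\<close> keeps the
  inequality that defines the region strict.\<close>

lemma lattice_lower_lt1:
  assumes r: "1 < r" and \<theta>: "0 < \<theta>" "\<theta> < 1"
  shows "\<exists>c>0. \<exists>w0. \<forall>w\<ge>w0. \<exists>F. finite F \<and> F \<subseteq> lattice_region r n0 w
    \<and> c * w powr (1 - \<theta>) * ln w \<le> sum (lattice_term r \<theta>) F"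
proof -
  define \<alpha> where "\<alpha> = (r - 1) * (1 - \<theta>)"
  define c where "c = min 1 ((1/2) powr (\<alpha> - 1)) / 4"
  have c: "0 < c" by (simp add: c_def)
  define c' where "c' = c * (1/2) powr (1 - \<theta>)"
  have c': "0 < c'" using c by (simp add: c'_def)
  define w0 where "w0 = max (exp (2 * r * ln 2)) ((2 * real n0 + 4) powr r)"
  have "\<exists>F. finite F \<and> F \<subseteq> lattice_region r n0 w \<and> c' / (2 * r) * w powr (1 - \<theta>) * ln w \<le> sum (lattice_term r \<theta>) F"
    if w: "w0 \<le> w" for w
  proof -
    have w1: "exp (2 * r * ln 2) \<le> w" "(2 * real n0 + 4) powr r \<le> w" using w by (auto simp: w0_def)
    have wpos: "0 < w" using w1(1) exp_gt_zero[of "2 * r * ln 2"] by linarith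
    have lnw: "2 * r * ln 2 \<le> ln w" using w1(1) wpos by (simp add: ln_ge_iff)
    define x where "x = w powr (1 / r)"
    have xr: "x powr r = w" using wpos r by (simp add: x_def powr_powr)
    have xn0: "2 * real n0 + 4 \<le> x"
    proof -
      have "((2 * real n0 + 4) powr r) powr (1 / r) \<le> x" unfolding x_def using w1 r by (intro powr_mono2) auto
      then show ?thesis using r by (simp add: powr_powr)
    qed
    have lnx: "ln x = ln w / r" using wpos by (simp add: x_def ln_powr)
    define A where "A = nat \<lfloor>x / 2\<rfloor>"
    have Ax: "real A \<le> x / 2" "x / 2 < real A + 1" unfolding A_def using xn0 by linarith+
    define y where "y = (\<lambda>i::nat. (w / (2 * real i)) powr (1 / (r - 1)))"
    have yx: "x \<le> y i" if "i \<in> {1..A}" for i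
    proof -
      have "2 * real i \<le> x" using that Ax by auto
      then have "w / x \<le> w / (2 * real i)"
        using that xn0 wpos by (intro divide_left_mono) auto
      moreover have "x powr (r - 1) = w / x"
        using xn0 xr by (simp add: powr_diff)
      ultimately have "x powr (r - 1) \<le> w / (2 * real i)" by simp
      then have "(x powr (r - 1)) powr (1 / (r - 1)) \<le> y i" unfolding y_def using r by (intro powr_mono2) auto
      then show ?thesis using r xn0 by (simp add: powr_powr)
    qed
    define N where "N = (\<lambda>i. {nat \<lfloor>y i / 2\<rfloor> + 1..nat \<lfloor>y i\<rfloor>})"
    have "Sigma {1..A} N \<subseteq> lattice_region r n0 w"
    proof
      fix z assume "z \<in> Sigma {1..A} N"
      then obtain i n where z: "z = (i, n)" "i \<in> {1..A}" "n \<in> N i" by auto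
      have yi: "x \<le> y i" by (rule yx[OF z(2)])
      have n: "real n \<le> y i" "y i / 2 < real n"
        using z(3) yi xn0 unfolding N_def by (auto simp: le_nat_iff le_floor_iff) linarith
      have "n0 \<le> n" using n(2) yi xn0 by linarith
      moreover have "i \<le> n" using n(2) yi Ax z(2) by auto
      moreover have "real i * real n powr (r - 1) < w"
      proof -
        have "real n powr (r - 1) \<le> y i powr (r - 1)" using n r by (intro powr_mono2) auto
        also have "\<dots> = w / (2 * real i)" using r wpos by (simp add: y_def powr_powr)
        finally have "real i * real n powr (r - 1) \<le> real i * (w / (2 * real i))" by (intro mult_left_mono) auto
        also have "\<dots> = w / 2" using z(2) by simp
        finally show ?thesis using wpos by simp
      qed
      ultimately show "z \<in> lattice_region r n0 w" using z by (auto simp: lattice_region_def)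
    qed
    moreover have "finite (Sigma {1..A} N)" by (auto simp: N_def)
    moreover have "c' / (2 * r) * w powr (1 - \<theta>) * ln w \<le> sum (lattice_term r \<theta>) (Sigma {1..A} N)"
    proof -
      have "c' * w powr (1 - \<theta>) * (\<Sum>i=1..A. 1 / real i) = (\<Sum>i\<in>{1..A}. c' * w powr (1 - \<theta>) * (1 / real i))"
        by (simp only: sum_distrib_left)
      also have "\<dots> \<le> (\<Sum>i\<in>{1..A}. real i powr (- \<theta>) * (\<Sum>n\<in>N i. real n powr (\<alpha> - 1)))"
      proof (rule sum_mono)
        fix i assume i: "i \<in> {1..A}"
        have yi: "4 \<le> y i" using yx[OF i] xn0 by linarith
        have "y i powr \<alpha> = (w / (2 * real i)) powr (1 - \<theta>)" using r by (simp add: y_def powr_powr \<alpha>_def)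
        also have "\<dots> = w powr (1 - \<theta>) * (1/2) powr (1 - \<theta>) / real i powr (1 - \<theta>)"
          using wpos by (simp add: powr_divide powr_mult)
        finally have yp: "y i powr \<alpha> = w powr (1 - \<theta>) * (1/2) powr (1 - \<theta>) / real i powr (1 - \<theta>)" .
        have "1 / real i = real i powr (- \<theta>) / real i powr (1 - \<theta>)"
          using i powr_neg_ratio[of "real i" \<theta>] by simp
        then have "c' * w powr (1 - \<theta>) * (1 / real i) = real i powr (- \<theta>) * (c * y i powr \<alpha>)"
          unfolding yp c'_def by simp
        also have "\<dots> \<le> real i powr (- \<theta>) * (\<Sum>n\<in>N i. real n powr (\<alpha> - 1))"
          unfolding N_def c_def by (intro mult_left_mono powr_sum_lower yi) auto
        finally show "c' * w powr (1 - \<theta>) * (1 / real i) \<le> real i powr (- \<theta>) * (\<Sum>n\<in>N i. real n powr (\<alpha> - 1))" .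
      qed
      also have "\<dots> = sum (lattice_term r \<theta>) (Sigma {1..A} N)"
        unfolding \<alpha>_def by (rule lattice_sum_box[symmetric]) (auto simp: N_def)
      finally have 1: "c' * w powr (1 - \<theta>) * (\<Sum>i=1..A. 1 / real i) \<le> sum (lattice_term r \<theta>) (Sigma {1..A} N)" .
      have "ln (x / 2) \<le> ln (real A + 1)" using Ax xn0 by (subst ln_le_cancel_iff) auto
      then have "ln x - ln 2 \<le> (\<Sum>i=1..A. 1 / real i)" using harm_lower[of A] xn0 by (simp add: ln_div)
      moreover have "ln w / (2 * r) \<le> ln x - ln 2" using lnx lnw r by (simp add: field_simps)
      ultimately have "ln w / (2 * r) \<le> (\<Sum>i=1..A. 1 / real i)" by linarith
      then have "c' * w powr (1 - \<theta>) * (ln w / (2 * r)) \<le> c' * w powr (1 - \<theta>) * (\<Sum>i=1..A. 1 / real i)"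
        using c' by (intro mult_left_mono) auto
      with 1 show ?thesis by simp
    qed
    ultimately show ?thesis by blast
  qed
  moreover have "0 < c' / (2 * r)" using r c' by simp
  ultimately show ?thesis by blast
qed

section \<open>Weighted tail integrals\<close>

text \<open>The order of growth of the kernel.\<close>

definition tail_weight :: "real \<Rightarrow> real \<Rightarrow> real" where
  "tail_weight \<theta> u = (if 1 < \<theta> then 1 else if \<theta> = 1 then (ln u)\<^sup>2 else u powr (1 / \<theta> - 1) * ln u)"

lemma tail_weight_nonneg: "1 \<le> u \<Longrightarrow> 0 \<le> tail_weight \<theta> u"
  by (simp add: tail_weight_def)

lemma tail_weight_measurable [measurable]: "tail_weight \<theta> \<in> borel_measurable borel"
proof -
  have "(\<lambda>u. tail_weight \<theta> u) \<in> borel_measurable borel"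
    unfolding tail_weight_def by measurable
  then show ?thesis .
qed

lemma one_le_ln: "exp 1 \<le> u \<Longrightarrow> 1 \<le> ln u" for u :: real
  using exp_gt_zero[of 1] by (subst ln_ge_iff) linarith+

lemma tail_weight_bounded:
  assumes "0 < \<theta>" "1 \<le> u" "u \<le> U"
  shows "tail_weight \<theta> u \<le> 1 + (ln U)\<^sup>2 + U powr (1 / \<theta>) * ln U"
proof -
  have l: "0 \<le> ln u" "ln u \<le> ln U" "0 \<le> ln U" using assms by auto
  have "u powr (1 / \<theta> - 1) \<le> U powr (1 / \<theta>)" if "\<theta> \<le> 1"
  proof -
    have "u powr (1 / \<theta> - 1) \<le> U powr (1 / \<theta> - 1)" using that assms by (intro powr_mono2) auto
    also have "\<dots> \<le> U powr (1 / \<theta>)" using assms by (intro powr_mono) auto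
    finally show ?thesis .
  qed
  then have "u powr (1 / \<theta> - 1) * ln u \<le> U powr (1 / \<theta>) * ln U" if "\<theta> \<le> 1"
    using that l by (intro mult_mono) auto
  then have 3: "tail_weight \<theta> u \<le> U powr (1 / \<theta>) * ln U" if "\<theta> < 1" using that by (simp add: tail_weight_def)
  have "(ln u)\<^sup>2 \<le> (ln U)\<^sup>2" using l by (intro power_mono) auto
  then have 2: "tail_weight \<theta> u \<le> (ln U)\<^sup>2" if "\<theta> = 1" using that by (simp add: tail_weight_def)
  have 1: "tail_weight \<theta> u \<le> 1" if "1 < \<theta>" using that by (simp add: tail_weight_def)
  have "0 \<le> U powr (1 / \<theta>) * ln U" "0 \<le> (ln U)\<^sup>2" using l by auto
  with 1 2 3 show ?thesis by linarith
qed

text \<open>The growth is regularly varying, so that the value of \<open>\<epsilon>\<close> is irrelevant for finiteness.\<close>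

lemma tail_weight_scale:
  assumes "0 < \<theta>" "0 < \<epsilon>"
  shows "\<exists>C>0. \<exists>v\<ge>1. \<forall>u\<ge>v. tail_weight \<theta> (u / \<epsilon>) \<le> C * tail_weight \<theta> u"
proof -
  define C where "C = 4 + 2 * (1 / \<epsilon>) powr (1 / \<theta> - 1)"
  define v where "v = max 1 (max \<epsilon> (1 / \<epsilon>))"
  have "tail_weight \<theta> (u / \<epsilon>) \<le> C * tail_weight \<theta> u" if u: "v \<le> u" for u
  proof -
    have u1: "1 \<le> u" "\<epsilon> \<le> u" "1 / \<epsilon> \<le> u" using u by (auto simp: v_def)
    have "ln (1 / \<epsilon>) \<le> ln u" using u1 assms by (subst ln_le_cancel_iff) auto
    then have l: "ln (u / \<epsilon>) \<le> 2 * ln u" using u1 assms by (simp add: ln_div)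
    have l0: "0 \<le> ln (u / \<epsilon>)" "0 \<le> ln u" using u1 assms by auto
    have a: "1 \<le> C" by (simp add: C_def add_increasing2)
    have b: "(ln (u / \<epsilon>))\<^sup>2 \<le> C * (ln u)\<^sup>2"
    proof -
      have "(ln (u / \<epsilon>))\<^sup>2 \<le> (2 * ln u)\<^sup>2" using l l0 by (intro power_mono) auto
      also have "\<dots> = 4 * (ln u)\<^sup>2" by (simp add: power_mult_distrib)
      also have "\<dots> \<le> C * (ln u)\<^sup>2" by (intro mult_right_mono) (auto simp: C_def)
      finally show ?thesis .
    qed
    have c: "(u / \<epsilon>) powr (1 / \<theta> - 1) * ln (u / \<epsilon>) \<le> C * (u powr (1 / \<theta> - 1) * ln u)"
    proof -
      have "(u / \<epsilon>) powr (1 / \<theta> - 1) * ln (u / \<epsilon>) \<le> (u / \<epsilon>) powr (1 / \<theta> - 1) * (2 * ln u)"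
        using l by (intro mult_left_mono) auto
      also have "\<dots> = 2 * (1 / \<epsilon>) powr (1 / \<theta> - 1) * (u powr (1 / \<theta> - 1) * ln u)"
        using u1 assms by (simp add: powr_divide)
      also have "\<dots> \<le> C * (u powr (1 / \<theta> - 1) * ln u)"
        using l0 by (intro mult_right_mono) (auto simp: C_def)
      finally show ?thesis .
    qed
    show ?thesis using a b c by (simp add: tail_weight_def)
  qed
  moreover have "0 < C" by (simp add: C_def add_pos_nonneg)
  moreover have "1 \<le> v" by (simp add: v_def)
  ultimately show ?thesis by blast
qed

lemma kernel_upper:
  assumes "1 < r" "0 < \<theta>"
  shows "\<exists>C>0. \<forall>v\<ge>exp 1. \<forall>F. finite F \<longrightarrow> F \<subseteq> lattice_region r 1 (v powr (1 / \<theta>))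
    \<longrightarrow> sum (lattice_term r \<theta>) F \<le> C * tail_weight \<theta> v"
proof -
  have pos: "0 < v" "1 \<le> v" "1 \<le> ln v" "1 \<le> v powr (1 / \<theta>)" if "exp 1 \<le> v" for v :: real
  proof -
    show "0 < v" using that exp_gt_zero[of 1] by linarith
    show v1: "1 \<le> v" using that exp_ge_add_one_self[of 1] by linarith
    show "1 \<le> ln v" by (rule one_le_ln[OF that])
    show "1 \<le> v powr (1 / \<theta>)" using v1 assms by (intro ge_one_powr_ge_zero) auto
  qed
  consider "1 < \<theta>" | "\<theta> = 1" | "\<theta> < 1" by linarith
  then show ?thesis
  proof cases
    case 1
    with lattice_upper_gt1[OF assms(1) 1] show ?thesis by (auto simp: tail_weight_def)
  next
    case 2
    define C where "C = (1 + 1 / (r - 1))\<^sup>2"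
    have "sum (lattice_term r \<theta>) F \<le> C * tail_weight \<theta> v"
      if v: "exp 1 \<le> v" and F: "finite F" "F \<subseteq> lattice_region r 1 (v powr (1 / \<theta>))" for v F
    proof -
      have "sum (lattice_term r \<theta>) F \<le> (1 + ln v / (r - 1))\<^sup>2"
        using lattice_upper_eq1[OF assms(1), of v F] F pos[OF v] 2 by simp
      also have "\<dots> \<le> ((1 + 1 / (r - 1)) * ln v)\<^sup>2"
        using pos[OF v] assms by (intro power_mono) (auto simp: algebra_simps)
      finally show ?thesis using 2 by (simp add: tail_weight_def C_def power_mult_distrib)
    qed
    moreover have "0 < C" unfolding C_def using assms by (intro zero_less_power add_pos_pos) auto
    ultimately show ?thesis by blast
  next
    case 3
    obtain C where C: "0 < C" "\<And>w F. 1 \<le> w \<Longrightarrow> finite F \<Longrightarrow> F \<subseteq> lattice_region r 1 w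
      \<Longrightarrow> sum (lattice_term r \<theta>) F \<le> C * w powr (1 - \<theta>) * (1 + ln w / r)"
      using lattice_upper_lt1[OF assms 3] by blast
    define C' where "C' = C * (1 + 1 / (\<theta> * r))"
    have "sum (lattice_term r \<theta>) F \<le> C' * tail_weight \<theta> v"
      if v: "exp 1 \<le> v" and F: "finite F" "F \<subseteq> lattice_region r 1 (v powr (1 / \<theta>))" for v F
    proof -
      have "sum (lattice_term r \<theta>) F \<le> C * (v powr (1 / \<theta>)) powr (1 - \<theta>) * (1 + ln (v powr (1 / \<theta>)) / r)"
        using F pos[OF v] by (intro C) auto
      also have "(v powr (1 / \<theta>)) powr (1 - \<theta>) = v powr (1 / \<theta> - 1)"
        using assms by (simp add: powr_powr field_simps)
      also have "ln (v powr (1 / \<theta>)) = ln v / \<theta>" using pos[OF v] by (simp add: ln_powr)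
      also have "C * v powr (1 / \<theta> - 1) * (1 + ln v / \<theta> / r) \<le> C * v powr (1 / \<theta> - 1) * ((1 + 1 / (\<theta> * r)) * ln v)"
        using pos[OF v] C assms by (intro mult_left_mono) (auto simp: algebra_simps)
      finally show ?thesis using 3 by (simp add: tail_weight_def C'_def mult_ac)
    qed
    moreover have "0 < C'" unfolding C'_def using assms C by (intro mult_pos_pos add_pos_pos) auto
    ultimately show ?thesis by blast
  qed
qed

lemma kernel_lower:
  assumes "1 < r" "0 < \<theta>" "1 \<le> n0"
  shows "\<exists>c>0. \<exists>v0\<ge>1. \<forall>v\<ge>v0. \<exists>F. finite F \<and> F \<subseteq> lattice_region r n0 (v powr (1 / \<theta>))
    \<and> c * tail_weight \<theta> v \<le> sum (lattice_term r \<theta>) F"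
proof -
  have W: "w0 \<le> v powr (1 / \<theta>)" if "max 1 (\<bar>w0\<bar> powr \<theta>) \<le> v" for v w0
  proof -
    have "(\<bar>w0\<bar> powr \<theta>) powr (1 / \<theta>) \<le> v powr (1 / \<theta>)" using that assms by (intro powr_mono2) auto
    then show ?thesis using assms by (simp add: powr_powr)
  qed
  have red: ?thesis if c: "0 < c" and F: "\<And>w. w0 \<le> w \<Longrightarrow> \<exists>F. finite F \<and> F \<subseteq> lattice_region r n0 w \<and> f w \<le> sum (lattice_term r \<theta>) F"
    and f: "\<And>v. 1 \<le> v \<Longrightarrow> c * tail_weight \<theta> v \<le> f (v powr (1 / \<theta>))" for c w0 f
  proof -
    have "\<exists>F. finite F \<and> F \<subseteq> lattice_region r n0 (v powr (1 / \<theta>)) \<and> c * tail_weight \<theta> v \<le> sum (lattice_term r \<theta>) F"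
      if v: "max 1 (\<bar>w0\<bar> powr \<theta>) \<le> v" for v
      using F[OF W[OF v]] f[of v] v by force
    moreover have "1 \<le> max 1 (\<bar>w0\<bar> powr \<theta>)" by simp
    ultimately show ?thesis using c by blast
  qed
  consider "1 < \<theta>" | "\<theta> = 1" | "\<theta> < 1" by linarith
  then show ?thesis
  proof cases
    case 1
    obtain c w0 where "0 < c" "\<And>w. w0 \<le> w \<Longrightarrow> \<exists>F. finite F \<and> F \<subseteq> lattice_region r n0 w \<and> c \<le> sum (lattice_term r \<theta>) F"
      using lattice_lower_gt1[OF assms(1,3)] by blast
    then show ?thesis by (rule red) (use 1 in \<open>auto simp: tail_weight_def\<close>)
  next
    case 2
    obtain c w0 where "0 < c" "\<And>w. w0 \<le> w \<Longrightarrow> \<exists>F. finite F \<and> F \<subseteq> lattice_region r n0 w \<and> c * (ln w)\<^sup>2 \<le> sum (lattice_term r \<theta>) F"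
      using lattice_lower_eq1[OF assms(1), of n0] unfolding 2 by blast
    then show ?thesis by (rule red) (use 2 in \<open>auto simp: tail_weight_def\<close>)
  next
    case 3
    obtain c w0 where c: "0 < c" and F: "\<forall>w\<ge>w0. \<exists>F. finite F \<and> F \<subseteq> lattice_region r n0 w
        \<and> c * w powr (1 - \<theta>) * ln w \<le> sum (lattice_term r \<theta>) F"
      using lattice_lower_lt1[OF assms(1,2) 3, of n0] by (elim exE conjE)
    show ?thesis
    proof (rule red[OF _ F[rule_format]])
      show "0 < c / \<theta>" using c assms by simp
      fix v :: real assume v: "1 \<le> v"
      have "(v powr (1 / \<theta>)) powr (1 - \<theta>) = v powr (1 / \<theta> - 1)"
        using assms by (simp add: powr_powr field_simps)
      moreover have "ln (v powr (1 / \<theta>)) = ln v / \<theta>" using v by (simp add: ln_powr)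
      ultimately show "c / \<theta> * tail_weight \<theta> v \<le> c * (v powr (1 / \<theta>)) powr (1 - \<theta>) * ln (v powr (1 / \<theta>))"
        using 3 by (simp add: tail_weight_def)
    qed
  qed
qed

lemma antimono_borel: "antimono h \<Longrightarrow> h \<in> borel_measurable borel" for h :: "real \<Rightarrow> real"
proof -
  assume "antimono h"
  then have "mono (\<lambda>u. - h u)" by (auto simp: mono_def antimono_def)
  then have "(\<lambda>u. - h u) \<in> borel_measurable borel" by (rule borel_measurable_mono)
  then show ?thesis by simp
qed

text \<open>The model weight to the power \<open>-p\<close>, where \<open>\<theta> = p q / r\<close>.\<close>

definition threshold :: "real \<Rightarrow> real \<Rightarrow> nat \<Rightarrow> nat \<Rightarrow> real" where
  "threshold r \<theta> i n = (real i * real n powr (r - 1)) powr \<theta>"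

lemma threshold_pos: "1 \<le> i \<Longrightarrow> i \<le> n \<Longrightarrow> 0 < threshold r \<theta> i n"
  by (auto simp: threshold_def)

text \<open>The contribution of row \<open>n\<close> to the kernel, as a function of the integration variable.\<close>

definition row_kernel :: "real \<Rightarrow> real \<Rightarrow> nat \<Rightarrow> real \<Rightarrow> nat \<Rightarrow> real \<Rightarrow> real" where
  "row_kernel r \<theta> n0 \<epsilon> n u = (if n0 \<le> n then
     (\<Sum>i=1..n. lattice_term r \<theta> (i, n) * indicator {\<epsilon> * threshold r \<theta> i n<..} u) else 0)"

lemma row_kernel_nonneg: "0 \<le> row_kernel r \<theta> n0 \<epsilon> n u"
  by (auto simp: row_kernel_def lattice_term_nonneg intro!: sum_nonneg)

lemma row_kernel_measurable [measurable]: "row_kernel r \<theta> n0 \<epsilon> n \<in> borel_measurable borel"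
proof -
  have "(\<lambda>u. row_kernel r \<theta> n0 \<epsilon> n u) \<in> borel_measurable borel"
    unfolding row_kernel_def by measurable
  then show ?thesis .
qed

lemma row_kernel_partial_sum:
  "(\<Sum>j<N. row_kernel r \<theta> n0 \<epsilon> (Suc j) u)
    = sum (lattice_term r \<theta>) {(i, n). 1 \<le> i \<and> i \<le> n \<and> n0 \<le> n \<and> n \<le> N \<and> \<epsilon> * threshold r \<theta> i n < u}"
proof -
  define B where "B = (\<lambda>n. {i\<in>{1..n}. n0 \<le> n \<and> \<epsilon> * threshold r \<theta> i n < u})"
  have row: "row_kernel r \<theta> n0 \<epsilon> n u = (\<Sum>i\<in>B n. lattice_term r \<theta> (i, n))" for n
  proof (cases "n0 \<le> n")
    case True
    have "(\<Sum>i=1..n. lattice_term r \<theta> (i, n) * indicator {\<epsilon> * threshold r \<theta> i n<..} u)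
      = (\<Sum>i=1..n. if \<epsilon> * threshold r \<theta> i n < u then lattice_term r \<theta> (i, n) else 0)"
      by (rule sum.cong) auto
    also have "\<dots> = (\<Sum>i\<in>B n. lattice_term r \<theta> (i, n))"
      unfolding B_def using True by (subst sum.inter_filter[symmetric]) auto
    finally show ?thesis using True by (simp add: row_kernel_def)
  qed (simp add: row_kernel_def B_def)
  have "(\<Sum>j<N. row_kernel r \<theta> n0 \<epsilon> (Suc j) u) = (\<Sum>n=1..N. \<Sum>i\<in>B n. lattice_term r \<theta> (i, n))"
    unfolding row using sum.atLeast1_atMost_eq[of "\<lambda>n. \<Sum>i\<in>B n. lattice_term r \<theta> (i, n)" N] by simp
  also have "\<dots> = (\<Sum>(n, i)\<in>Sigma {1..N} B. lattice_term r \<theta> (i, n))"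
    by (rule sum.Sigma) (auto simp: B_def)
  also have "\<dots> = sum (lattice_term r \<theta>) {(i, n). 1 \<le> i \<and> i \<le> n \<and> n0 \<le> n \<and> n \<le> N \<and> \<epsilon> * threshold r \<theta> i n < u}"
    by (rule sum.reindex_bij_witness[of _ prod.swap prod.swap]) (auto simp: B_def)
  finally show ?thesis .
qed

lemma finite_truncated_region:
  "finite {(i, n). 1 \<le> i \<and> i \<le> n \<and> n0 \<le> n \<and> n \<le> N \<and> P i n}" for N :: nat
  by (rule finite_subset[of _ "{1..N} \<times> {1..N}"]) auto

lemma threshold_less_iff:
  assumes "0 < \<theta>" "0 < \<epsilon>" "0 < u"
  shows "\<epsilon> * threshold r \<theta> i n < u \<longleftrightarrow> real i * real n powr (r - 1) < (u / \<epsilon>) powr (1 / \<theta>)"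
proof -
  define w where "w = real i * real n powr (r - 1)"
  have w: "0 \<le> w" by (simp add: w_def)
  have "\<epsilon> * threshold r \<theta> i n < u \<longleftrightarrow> w powr \<theta> < ((u / \<epsilon>) powr (1 / \<theta>)) powr \<theta>"
    using assms by (simp add: threshold_def w_def[symmetric] powr_powr field_simps)
  also have "\<dots> \<longleftrightarrow> w < (u / \<epsilon>) powr (1 / \<theta>)"
    using assms w powr_mono2[of \<theta> "(u / \<epsilon>) powr (1 / \<theta>)" w] powr_less_mono2[of \<theta> w "(u / \<epsilon>) powr (1 / \<theta>)"]
    by (auto simp: not_less[symmetric])
  finally show ?thesis by (simp add: w_def)
qed

text \<open>The substitution \<open>u = x t\<close> in the integral belonging to a pair with threshold \<open>t\<close> moves all
  dependence on the pair from the argument of \<open>h\<close> into a weight, and Tonelli's theorem applies.\<close>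

lemma tail_sum_eq_kernel_integral:
  fixes h :: "real \<Rightarrow> real"
  assumes h: "antimono h" "\<And>u. 0 \<le> h u" and \<theta>: "0 < \<theta>"
  shows "(\<Sum>j. if n0 \<le> Suc j then ennreal (real (Suc j) powr (r - 2)) *
        (\<Sum>i=1..Suc j. \<integral>\<^sup>+x. ennreal (h (x * threshold r \<theta> i (Suc j))) * indicator {\<epsilon><..} x \<partial>lborel) else 0)
    = (\<integral>\<^sup>+u. ennreal (h u) * (\<Sum>j. ennreal (row_kernel r \<theta> n0 \<epsilon> (Suc j) u)) \<partial>lborel)"
proof -
  have hm [measurable]: "h \<in> borel_measurable borel" by (rule antimono_borel[OF h(1)])
  have one: "ennreal (real n powr (r - 2)) * (\<integral>\<^sup>+x. ennreal (h (x * threshold r \<theta> i n)) * indicator {\<epsilon><..} x \<partial>lborel)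
     = (\<integral>\<^sup>+u. ennreal (h u) * ennreal (lattice_term r \<theta> (i, n) * indicator {\<epsilon> * threshold r \<theta> i n<..} u) \<partial>lborel)"
    if i: "1 \<le> i" "i \<le> n" for i n
  proof -
    define l where "l = threshold r \<theta> i n"
    have l: "0 < l" unfolding l_def by (rule threshold_pos[OF i])
    have lt: "lattice_term r \<theta> (i, n) = real n powr (r - 2) * (1 / l)"
      by (simp add: lattice_term_def l_def threshold_def powr_minus_divide)
    have e: "ennreal (lattice_term r \<theta> (i, n)) = ennreal (real n powr (r - 2)) * ennreal (1 / l)"
      unfolding lt using l by (intro ennreal_mult) auto
    have "(\<integral>\<^sup>+x. ennreal (h (x * l)) * indicator {\<epsilon><..} x \<partial>lborel)
        = ennreal \<bar>1 / l\<bar> * (\<integral>\<^sup>+u. ennreal (h ((0 + 1 / l * u) * l)) * indicator {\<epsilon><..} (0 + 1 / l * u) \<partial>lborel)"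
      using l by (intro nn_integral_real_affine) auto
    also have "\<dots> = ennreal (1 / l) * (\<integral>\<^sup>+u. ennreal (h u) * indicator {\<epsilon> * l<..} u \<partial>lborel)"
      using l by (auto intro!: arg_cong2[where f = "(*)"] nn_integral_cong simp: indicator_def field_simps)
    finally have "ennreal (real n powr (r - 2)) * (\<integral>\<^sup>+x. ennreal (h (x * l)) * indicator {\<epsilon><..} x \<partial>lborel)
       = ennreal (lattice_term r \<theta> (i, n)) * (\<integral>\<^sup>+u. ennreal (h u) * indicator {\<epsilon> * l<..} u \<partial>lborel)"
      by (simp only: e mult.assoc)
    also have "\<dots> = (\<integral>\<^sup>+u. ennreal (lattice_term r \<theta> (i, n)) * (ennreal (h u) * indicator {\<epsilon> * l<..} u) \<partial>lborel)"
      by (intro nn_integral_cmult[symmetric]) measurable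
    also have "\<dots> = (\<integral>\<^sup>+u. ennreal (h u) * ennreal (lattice_term r \<theta> (i, n) * indicator {\<epsilon> * l<..} u) \<partial>lborel)"
      by (intro nn_integral_cong) (auto simp: indicator_def mult.commute)
    finally show ?thesis by (simp add: l_def)
  qed
  have row: "(if n0 \<le> n then ennreal (real n powr (r - 2)) *
        (\<Sum>i=1..n. \<integral>\<^sup>+x. ennreal (h (x * threshold r \<theta> i n)) * indicator {\<epsilon><..} x \<partial>lborel) else 0)
     = (\<integral>\<^sup>+u. ennreal (h u) * ennreal (row_kernel r \<theta> n0 \<epsilon> n u) \<partial>lborel)" for n
  proof (cases "n0 \<le> n")
    case True
    have "ennreal (real n powr (r - 2)) *
        (\<Sum>i=1..n. \<integral>\<^sup>+x. ennreal (h (x * threshold r \<theta> i n)) * indicator {\<epsilon><..} x \<partial>lborel)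
      = (\<Sum>i=1..n. \<integral>\<^sup>+u. ennreal (h u) * ennreal (lattice_term r \<theta> (i, n) * indicator {\<epsilon> * threshold r \<theta> i n<..} u) \<partial>lborel)"
      unfolding sum_distrib_left by (intro sum.cong one) auto
    also have "\<dots> = (\<integral>\<^sup>+u. (\<Sum>i=1..n. ennreal (h u) * ennreal (lattice_term r \<theta> (i, n) * indicator {\<epsilon> * threshold r \<theta> i n<..} u)) \<partial>lborel)"
      by (intro nn_integral_sum[symmetric]) measurable
    also have "\<dots> = (\<integral>\<^sup>+u. ennreal (h u) * ennreal (row_kernel r \<theta> n0 \<epsilon> n u) \<partial>lborel)"
      using True by (intro nn_integral_cong) (simp add: row_kernel_def sum_distrib_left[symmetric] sum_ennreal lattice_term_nonneg)
    finally show ?thesis using True by simp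
  qed (simp add: row_kernel_def)
  have "(\<Sum>j. \<integral>\<^sup>+u. ennreal (h u) * ennreal (row_kernel r \<theta> n0 \<epsilon> (Suc j) u) \<partial>lborel)
    = (\<integral>\<^sup>+u. (\<Sum>j. ennreal (h u) * ennreal (row_kernel r \<theta> n0 \<epsilon> (Suc j) u)) \<partial>lborel)"
    by (intro nn_integral_suminf[symmetric]) measurable
  then show ?thesis unfolding row by simp
qed

text \<open>Above some \<open>U\<close> the kernel is bounded by the weight; below, it is bounded by its value at \<open>U\<close>
  since it is increasing, and \<open>h \<le> 1\<close>.\<close>

lemma tail_sum_finite:
  fixes h :: "real \<Rightarrow> real"
  assumes h: "antimono h" "\<And>u. 0 \<le> h u" "\<And>u. h u \<le> 1" and r: "1 < r" and \<theta>: "0 < \<theta>" and \<epsilon>: "0 < \<epsilon>"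
    and fin: "(\<integral>\<^sup>+u. ennreal (h u * tail_weight \<theta> u) * indicator {exp 1..} u \<partial>lborel) < \<infinity>"
  shows "(\<Sum>j. ennreal (real (Suc j) powr (r - 2)) *
        (\<Sum>i=1..Suc j. \<integral>\<^sup>+x. ennreal (h (x * threshold r \<theta> i (Suc j))) * indicator {\<epsilon><..} x \<partial>lborel)) < \<infinity>"
proof -
  have hm [measurable]: "h \<in> borel_measurable borel" by (rule antimono_borel[OF h(1)])
  obtain C1 where C1: "0 < C1" "\<And>v F. exp 1 \<le> v \<Longrightarrow> finite F \<Longrightarrow> F \<subseteq> lattice_region r 1 (v powr (1 / \<theta>))
    \<Longrightarrow> sum (lattice_term r \<theta>) F \<le> C1 * tail_weight \<theta> v" using kernel_upper[OF r \<theta>] by blast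
  obtain C2 v2 where C2: "0 < C2" "1 \<le> v2" "\<And>u. v2 \<le> u \<Longrightarrow> tail_weight \<theta> (u / \<epsilon>) \<le> C2 * tail_weight \<theta> u"
    using tail_weight_scale[OF \<theta> \<epsilon>] by blast
  define U where "U = max (exp 1) (max v2 (\<epsilon> * exp 1))"
  have U: "exp 1 \<le> U" "v2 \<le> U" "\<epsilon> * exp 1 \<le> U" "1 \<le> U" "0 < U"
    using C2(2) exp_gt_zero[of "1::real"] by (auto simp: U_def)
  define C where "C = C1 * C2"
  define K where "K = (\<lambda>u. \<Sum>j. ennreal (row_kernel r \<theta> 1 \<epsilon> (Suc j) u))"
  have part: "(\<Sum>j<N. row_kernel r \<theta> 1 \<epsilon> (Suc j) u) \<le> C * tail_weight \<theta> v" if v: "U \<le> v" "u \<le> v" for N u v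
  proof -
    have v0: "0 < v" using v U by linarith
    have sub: "{(i, n). 1 \<le> i \<and> i \<le> n \<and> 1 \<le> n \<and> n \<le> N \<and> \<epsilon> * threshold r \<theta> i n < u}
      \<subseteq> lattice_region r 1 ((v / \<epsilon>) powr (1 / \<theta>))"
      unfolding lattice_region_def using v by (auto simp: threshold_less_iff[OF \<theta> \<epsilon> v0, symmetric])
    have "exp 1 \<le> v / \<epsilon>" using v U \<epsilon> by (simp add: field_simps)
    then have "(\<Sum>j<N. row_kernel r \<theta> 1 \<epsilon> (Suc j) u) \<le> C1 * tail_weight \<theta> (v / \<epsilon>)"
      unfolding row_kernel_partial_sum by (intro C1 finite_truncated_region sub)
    also have "\<dots> \<le> C1 * (C2 * tail_weight \<theta> v)" using C1 C2 v U by (intro mult_left_mono C2(3)) auto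
    finally show ?thesis by (simp add: C_def)
  qed
  have Kle: "K u \<le> ennreal (C * tail_weight \<theta> v)" if v: "U \<le> v" "u \<le> v" for u v
    unfolding K_def
  proof (rule suminf_le_const)
    show "(\<Sum>j<N. ennreal (row_kernel r \<theta> 1 \<epsilon> (Suc j) u)) \<le> ennreal (C * tail_weight \<theta> v)" for N
      using part[OF v, of N] by (simp add: sum_ennreal row_kernel_nonneg ennreal_leI)
  qed auto
  have K0: "K u = 0" if "u \<le> 0" for u
  proof -
    have "row_kernel r \<theta> 1 \<epsilon> n u = 0" for n
    proof -
      have "\<not> \<epsilon> * threshold r \<theta> i n < u" for i
        using that \<epsilon> by (simp add: threshold_def not_less order_trans[OF that])
      then show ?thesis by (simp add: row_kernel_def)
    qed
    then show ?thesis by (simp add: K_def)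
  qed
  have "(\<integral>\<^sup>+u. ennreal (h u) * K u \<partial>lborel)
    \<le> (\<integral>\<^sup>+u. ennreal (C * tail_weight \<theta> U) * indicator {0..U} u
        + ennreal C * (ennreal (h u * tail_weight \<theta> u) * indicator {exp 1..} u) \<partial>lborel)"
  proof (rule nn_integral_mono)
    fix u :: real
    consider "u \<le> 0" | "0 < u" "u \<le> U" | "U < u" by linarith
    then show "ennreal (h u) * K u \<le> ennreal (C * tail_weight \<theta> U) * indicator {0..U} u
        + ennreal C * (ennreal (h u * tail_weight \<theta> u) * indicator {exp 1..} u)"
    proof cases
      case 2
      have "ennreal (h u) * K u \<le> 1 * ennreal (C * tail_weight \<theta> U)"
        using Kle[of U u] 2 h by (intro mult_mono) auto
      then show ?thesis using 2 by (auto simp: add_increasing2)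
    next
      case 3
      have "ennreal (h u) * K u \<le> ennreal (h u) * ennreal (C * tail_weight \<theta> u)"
        using Kle[of u u] 3 by (intro mult_left_mono) auto
      also have "\<dots> = ennreal C * ennreal (h u * tail_weight \<theta> u)"
        using h C1 C2 3 U tail_weight_nonneg[of u \<theta>] by (simp add: ennreal_mult[symmetric] C_def mult_ac)
      finally show ?thesis using 3 U by (auto simp: add_increasing)
    qed (simp add: K0)
  qed
  also have "\<dots> = ennreal (C * tail_weight \<theta> U) * emeasure lborel {0..U}
      + ennreal C * (\<integral>\<^sup>+u. ennreal (h u * tail_weight \<theta> u) * indicator {exp 1..} u \<partial>lborel)"
    by (subst nn_integral_add) (auto simp: nn_integral_cmult)
  also have "\<dots> < \<infinity>" using fin U by (auto simp: ennreal_mult_less_top)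
  finally show ?thesis
    using tail_sum_eq_kernel_integral[OF h(1,2) \<theta>, of 1 r \<epsilon>] by (simp add: K_def)
qed

lemma tail_weight_integral_finite:
  fixes h :: "real \<Rightarrow> real"
  assumes h: "antimono h" "\<And>u. 0 \<le> h u" "\<And>u. h u \<le> 1" and r: "1 < r" and \<theta>: "0 < \<theta>" and \<epsilon>: "0 < \<epsilon>"
    and n0: "1 \<le> n0"
    and fin: "(\<Sum>j. if n0 \<le> Suc j then ennreal (real (Suc j) powr (r - 2)) *
        (\<Sum>i=1..Suc j. \<integral>\<^sup>+x. ennreal (h (x * threshold r \<theta> i (Suc j))) * indicator {\<epsilon><..} x \<partial>lborel) else 0) < \<infinity>"
  shows "(\<integral>\<^sup>+u. ennreal (h u * tail_weight \<theta> u) * indicator {exp 1..} u \<partial>lborel) < \<infinity>"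
proof -
  have hm [measurable]: "h \<in> borel_measurable borel" by (rule antimono_borel[OF h(1)])
  obtain c v1 where c: "0 < c" "1 \<le> v1" "\<And>v. v1 \<le> v \<Longrightarrow> \<exists>F. finite F \<and> F \<subseteq> lattice_region r n0 (v powr (1 / \<theta>))
    \<and> c * tail_weight \<theta> v \<le> sum (lattice_term r \<theta>) F" using kernel_lower[OF r \<theta> n0] by blast
  have e1: "0 < 1 / \<epsilon>" using \<epsilon> by simp
  obtain C2 v2 where C2: "0 < C2" "1 \<le> v2" "\<And>u. v2 \<le> u \<Longrightarrow> tail_weight \<theta> (u / (1 / \<epsilon>)) \<le> C2 * tail_weight \<theta> u"
    using tail_weight_scale[OF \<theta> e1] by blast
  define U where "U = max (exp 1) (\<epsilon> * max v1 v2)"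
  have U: "exp 1 \<le> U" "\<epsilon> * v1 \<le> U" "\<epsilon> * v2 \<le> U" "0 < U" "1 \<le> U"
    using exp_gt_zero[of "1::real"] exp_ge_add_one_self[of "1::real"] \<epsilon> unfolding U_def
    by (auto simp: max_mult_distrib_left le_max_iff_disj less_max_iff_disj)
  define K where "K = (\<lambda>u. \<Sum>j. ennreal (row_kernel r \<theta> n0 \<epsilon> (Suc j) u))"
  have Kge: "ennreal (c / C2 * tail_weight \<theta> u) \<le> K u" if u: "U \<le> u" for u
  proof -
    have u0: "0 < u" using u U by linarith
    have uv: "v1 \<le> u / \<epsilon>" "v2 \<le> u / \<epsilon>" using u U \<epsilon> by (auto simp: field_simps)
    obtain F where F: "finite F" "F \<subseteq> lattice_region r n0 ((u / \<epsilon>) powr (1 / \<theta>))"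
      "c * tail_weight \<theta> (u / \<epsilon>) \<le> sum (lattice_term r \<theta>) F" using c(3)[OF uv(1)] by blast
    define N where "N = Max (insert 0 (snd ` F))"
    have "F \<subseteq> {(i, n). 1 \<le> i \<and> i \<le> n \<and> n0 \<le> n \<and> n \<le> N \<and> \<epsilon> * threshold r \<theta> i n < u}"
    proof
      fix z assume z: "z \<in> F"
      then have "snd z \<le> N" unfolding N_def using F(1) by (intro Max_ge) auto
      with z F(2) show "z \<in> {(i, n). 1 \<le> i \<and> i \<le> n \<and> n0 \<le> n \<and> n \<le> N \<and> \<epsilon> * threshold r \<theta> i n < u}"
        by (auto simp: lattice_region_def threshold_less_iff[OF \<theta> \<epsilon> u0])
    qed
    then have "sum (lattice_term r \<theta>) F \<le> (\<Sum>j<N. row_kernel r \<theta> n0 \<epsilon> (Suc j) u)"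
      unfolding row_kernel_partial_sum by (intro sum_mono2 finite_truncated_region lattice_term_nonneg)
    moreover have "tail_weight \<theta> u \<le> C2 * tail_weight \<theta> (u / \<epsilon>)"
      using C2(3)[OF uv(2)] \<epsilon> by simp
    then have "c / C2 * tail_weight \<theta> u \<le> c / C2 * (C2 * tail_weight \<theta> (u / \<epsilon>))"
      using c C2 by (intro mult_left_mono) auto
    ultimately have "c / C2 * tail_weight \<theta> u \<le> (\<Sum>j<N. row_kernel r \<theta> n0 \<epsilon> (Suc j) u)"
      using F(3) C2 by simp
    then have "ennreal (c / C2 * tail_weight \<theta> u) \<le> (\<Sum>j<N. ennreal (row_kernel r \<theta> n0 \<epsilon> (Suc j) u))"
      by (simp add: sum_ennreal row_kernel_nonneg ennreal_leI)
    also have "\<dots> \<le> K u" unfolding K_def by (intro sum_le_suminf) auto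
    finally show ?thesis .
  qed
  define B where "B = 1 + (ln U)\<^sup>2 + U powr (1 / \<theta>) * ln U"
  have "(\<integral>\<^sup>+u. ennreal (h u * tail_weight \<theta> u) * indicator {exp 1..} u \<partial>lborel)
    \<le> (\<integral>\<^sup>+u. ennreal B * indicator {0..U} u + ennreal (C2 / c) * (ennreal (h u) * K u) \<partial>lborel)"
  proof (rule nn_integral_mono)
    fix u :: real
    consider "u < exp 1" | "exp 1 \<le> u" "u \<le> U" | "U < u" by linarith
    then show "ennreal (h u * tail_weight \<theta> u) * indicator {exp 1..} u
      \<le> ennreal B * indicator {0..U} u + ennreal (C2 / c) * (ennreal (h u) * K u)"
    proof cases
      case 2
      have u1: "1 \<le> u" using 2 exp_ge_add_one_self[of "1::real"] by linarith
      have "h u * tail_weight \<theta> u \<le> 1 * B"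
        unfolding B_def using h 2 u1 tail_weight_nonneg[of u \<theta>] by (intro mult_mono tail_weight_bounded \<theta>) auto
      then have "ennreal (h u * tail_weight \<theta> u) \<le> ennreal B" by (simp add: ennreal_leI)
      then show ?thesis using 2 u1 by (auto simp: add_increasing2)
    next
      case 3
      have tn: "0 \<le> tail_weight \<theta> u" using 3 U by (intro tail_weight_nonneg) linarith
      have "ennreal (h u * tail_weight \<theta> u) = ennreal (C2 / c) * (ennreal (h u) * ennreal (c / C2 * tail_weight \<theta> u))"
        using h c C2 tn by (simp add: ennreal_mult[symmetric])
      also have "\<dots> \<le> ennreal (C2 / c) * (ennreal (h u) * K u)"
        using Kge[of u] 3 by (intro mult_left_mono) auto
      finally show ?thesis using 3 U by (auto simp: add_increasing)
    qed auto
  qed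
  also have "\<dots> = ennreal B * emeasure lborel {0..U} + ennreal (C2 / c) * (\<integral>\<^sup>+u. ennreal (h u) * K u \<partial>lborel)"
    unfolding K_def by (subst nn_integral_add) (auto simp: nn_integral_cmult)
  also have "(\<integral>\<^sup>+u. ennreal (h u) * K u \<partial>lborel) < \<infinity>"
    using fin unfolding tail_sum_eq_kernel_integral[OF h(1,2) \<theta>] K_def .
  then have "ennreal B * emeasure lborel {0..U} + ennreal (C2 / c) * (\<integral>\<^sup>+u. ennreal (h u) * K u \<partial>lborel) < \<infinity>"
    using U by (auto simp: ennreal_mult_less_top)
  finally show ?thesis .
qed

lemma tail_integral_rescale:
  fixes h :: "real \<Rightarrow> real"
  assumes [measurable]: "h \<in> borel_measurable borel" and c: "0 < c"
  shows "(\<integral>\<^sup>+x. ennreal (h (c * x * l)) * indicator {\<epsilon><..} x \<partial>lborel)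
    = ennreal (1 / c) * (\<integral>\<^sup>+x. ennreal (h (x * l)) * indicator {c * \<epsilon><..} x \<partial>lborel)"
proof -
  have "(\<integral>\<^sup>+x. ennreal (h (c * x * l)) * indicator {\<epsilon><..} x \<partial>lborel)
    = ennreal \<bar>1 / c\<bar> * (\<integral>\<^sup>+x. ennreal (h (c * (0 + 1 / c * x) * l)) * indicator {\<epsilon><..} (0 + 1 / c * x) \<partial>lborel)"
    using c by (intro nn_integral_real_affine) auto
  also have "\<dots> = ennreal (1 / c) * (\<integral>\<^sup>+x. ennreal (h (x * l)) * indicator {c * \<epsilon><..} x \<partial>lborel)"
    using c by (auto intro!: arg_cong2[where f = "(*)"] nn_integral_cong simp: indicator_def field_simps)
  finally show ?thesis .
qed

lemma tail_weight_ge: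
  assumes "0 < \<theta>" "exp 1 \<le> u"
  shows "u powr (1 / \<theta> - 1) \<le> tail_weight \<theta> u" "1 \<le> tail_weight \<theta> u"
proof -
  have u: "1 \<le> u" "1 \<le> ln u"
    using assms(2) exp_ge_add_one_self[of "1::real"] one_le_ln[OF assms(2)] by linarith+
  have a: "u powr (1 / \<theta> - 1) \<le> u powr 0" if "1 \<le> \<theta>"
    using that u assms by (intro powr_mono) auto
  have b: "u powr (1 / \<theta> - 1) * 1 \<le> u powr (1 / \<theta> - 1) * ln u"
    using u by (intro mult_left_mono) auto
  have c: "1 \<le> (ln u)\<^sup>2" using u by simp
  have d: "1 \<le> u powr (1 / \<theta> - 1)" if "\<theta> < 1"
    using that u assms by (intro ge_one_powr_ge_zero) auto
  have e: "1 \<le> u powr (1 / \<theta> - 1) * ln u" if "\<theta> < 1" using b d[OF that] by linarith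
  show "u powr (1 / \<theta> - 1) \<le> tail_weight \<theta> u"
    using a b c u by (auto simp: tail_weight_def)
  show "1 \<le> tail_weight \<theta> u"
    using c e by (auto simp: tail_weight_def)
qed

text \<open>Integrating over \<open>[U/2, U]\<close> alone bounds \<open>h U\<close>, since \<open>h\<close> is decreasing.\<close>

lemma tail_decay:
  fixes h :: "real \<Rightarrow> real"
  assumes h: "antimono h" "\<And>u. 0 \<le> h u" "\<And>u. h u \<le> 1" and \<theta>: "0 < \<theta>"
    and fin: "(\<integral>\<^sup>+u. ennreal (h u * tail_weight \<theta> u) * indicator {exp 1..} u \<partial>lborel) < \<infinity>"
  shows "\<exists>C>0. \<forall>u\<ge>1. h u \<le> C * u powr (- (1 / \<theta>))"
proof -
  define \<kappa> where "\<kappa> = 1 / \<theta>"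
  have k: "0 < \<kappa>" using \<theta> by (simp add: \<kappa>_def)
  obtain J where J: "(\<integral>\<^sup>+u. ennreal (h u * tail_weight \<theta> u) * indicator {exp 1..} u \<partial>lborel) = ennreal J" "0 \<le> J"
    using fin by (cases "\<integral>\<^sup>+u. ennreal (h u * tail_weight \<theta> u) * indicator {exp 1..} u \<partial>lborel") auto
  define c where "c = min 1 ((1/2::real) powr (\<kappa> - 1))"
  have c: "0 < c" by (simp add: c_def)
  have e0: "0 < exp (1::real)" by simp
  have big: "h U \<le> 2 * J / c * U powr (- \<kappa>)" if U: "2 * exp 1 \<le> U" for U
  proof -
    have U0: "0 < U" using U e0 by linarith
    have low: "c * U powr (\<kappa> - 1) \<le> u powr (\<kappa> - 1)" if u: "U / 2 \<le> u" "u \<le> U" for u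
    proof (cases "1 \<le> \<kappa>")
      case True
      have "c * U powr (\<kappa> - 1) \<le> (1/2) powr (\<kappa> - 1) * U powr (\<kappa> - 1)" by (intro mult_right_mono) (auto simp: c_def)
      also have "\<dots> = (U / 2) powr (\<kappa> - 1)" using U0 by (simp add: powr_mult[symmetric])
      also have "\<dots> \<le> u powr (\<kappa> - 1)" using u U0 True by (intro powr_mono2) auto
      finally show ?thesis .
    next
      case False
      have "c * U powr (\<kappa> - 1) \<le> 1 * U powr (\<kappa> - 1)" by (intro mult_right_mono) (auto simp: c_def)
      also have "\<dots> \<le> u powr (\<kappa> - 1)" using u U0 False by (simp, intro powr_mono2') auto
      finally show ?thesis .
    qed
    have "ennreal (h U * (c * U powr (\<kappa> - 1))) * emeasure lborel {U/2..U}
      = (\<integral>\<^sup>+u. ennreal (h U * (c * U powr (\<kappa> - 1))) * indicator {U/2..U} u \<partial>lborel)"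
      by (simp add: nn_integral_cmult)
    also have "\<dots> \<le> (\<integral>\<^sup>+u. ennreal (h u * tail_weight \<theta> u) * indicator {exp 1..} u \<partial>lborel)"
    proof (rule nn_integral_mono)
      fix u
      show "ennreal (h U * (c * U powr (\<kappa> - 1))) * indicator {U/2..U} u
        \<le> ennreal (h u * tail_weight \<theta> u) * indicator {exp 1..} u"
      proof (cases "u \<in> {U/2..U}")
        case True
        then have u: "exp 1 \<le> u" "U / 2 \<le> u" "u \<le> U" using U by auto
        have "h U * (c * U powr (\<kappa> - 1)) \<le> h u * tail_weight \<theta> u"
          using h(1)[THEN antimonoD, OF u(3)] h(2) c low[OF u(2,3)] tail_weight_ge(1)[OF \<theta> u(1)]
          by (intro mult_mono) (auto simp: \<kappa>_def)
        with True u show ?thesis by (simp add: ennreal_leI)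
      qed simp
    qed
    finally have le: "ennreal (h U * (c * U powr (\<kappa> - 1))) * emeasure lborel {U/2..U} \<le> ennreal J"
      unfolding J(1) .
    have "emeasure lborel {U/2..U} = ennreal (U / 2)" using U0 by simp
    then have "ennreal (h U * (c * U powr (\<kappa> - 1))) * ennreal (U / 2) \<le> ennreal J"
      using le by simp
    then have "h U * (c * U powr (\<kappa> - 1)) * (U / 2) \<le> J"
      using h(2) c U0 J(2) by (simp add: ennreal_mult[symmetric])
    moreover have pU: "U powr (\<kappa> - 1) * U = U powr \<kappa>" using U0 powr_mult_base[of U "\<kappa> - 1"] by (simp add: mult.commute)
    have "h U * (c * U powr (\<kappa> - 1)) * (U / 2) = c / 2 * (h U * (U powr (\<kappa> - 1) * U))" by simp
    ultimately have "c / 2 * (h U * U powr \<kappa>) \<le> J" unfolding pU by linarith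
    then have "h U * U powr \<kappa> \<le> 2 * J / c" using c by (simp add: field_simps)
    then have "h U * U powr \<kappa> * U powr (- \<kappa>) \<le> 2 * J / c * U powr (- \<kappa>)" by (intro mult_right_mono) auto
    then show ?thesis using U0 by (simp add: mult.assoc powr_add[symmetric])
  qed
  define C where "C = 2 * J / c + (2 * exp 1) powr \<kappa>"
  have "h u \<le> C * u powr (- \<kappa>)" if u: "1 \<le> u" for u
  proof (cases "2 * exp 1 \<le> u")
    case True
    have "2 * J / c * u powr (- \<kappa>) \<le> C * u powr (- \<kappa>)" by (intro mult_right_mono) (auto simp: C_def)
    with big[OF True] show ?thesis by linarith
  next
    case False
    have "u powr \<kappa> \<le> (2 * exp 1) powr \<kappa>" using False u k by (intro powr_mono2) auto
    also have "\<dots> \<le> C" using J c by (simp add: C_def)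
    finally have "1 \<le> C * u powr (- \<kappa>)" using u by (simp add: powr_minus_divide field_simps)
    with h(3)[of u] show ?thesis by linarith
  qed
  moreover have "0 < C" unfolding C_def using J c by (intro add_nonneg_pos) auto
  ultimately show ?thesis unfolding \<kappa>_def by blast
qed

lemma threshold_mono: "0 < \<theta> \<Longrightarrow> 1 < r \<Longrightarrow> i \<le> i' \<Longrightarrow> n \<le> n' \<Longrightarrow> threshold r \<theta> i n \<le> threshold r \<theta> i' n'"
  unfolding threshold_def by (intro powr_mono2 mult_mono) auto

text \<open>The thresholds increase with \<open>n\<close>, and prolonging the range of \<open>i\<close> from \<open>n\<close> to \<open>2 n\<close> at most
  doubles a sum of decreasing terms.\<close>

lemma threshold_sum_doubling:
  fixes h :: "real \<Rightarrow> real"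
  assumes h: "antimono h" "\<And>u. 0 \<le> h u" and "0 < \<theta>" "1 < r" "0 \<le> c" "n \<le> m" "m \<le> 2 * n"
  shows "(\<Sum>i=1..m. h (c * threshold r \<theta> i m)) \<le> 2 * (\<Sum>i=1..n. h (c * threshold r \<theta> i n))"
proof -
  have le: "h (c * threshold r \<theta> i' n') \<le> h (c * threshold r \<theta> i n)" if "i \<le> i'" "n \<le> n'" for i i' n'
    using that assms by (intro antimonoD[OF h(1)] mult_left_mono threshold_mono) auto
  have "(\<Sum>i=1..m. h (c * threshold r \<theta> i m)) \<le> (\<Sum>i=1..m. h (c * threshold r \<theta> i n))"
    using assms by (intro sum_mono le) auto
  also have "\<dots> \<le> (\<Sum>i=1..n+n. h (c * threshold r \<theta> i n))"
    using assms by (intro sum_mono2) auto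
  also have "\<dots> = (\<Sum>i=1..n. h (c * threshold r \<theta> i n)) + (\<Sum>i=n+1..n+n. h (c * threshold r \<theta> i n))"
    by (rule sum.ub_add_nat) simp
  also have "(\<Sum>i=n+1..n+n. h (c * threshold r \<theta> i n)) = (\<Sum>i=1..n. h (c * threshold r \<theta> (i + n) n))"
    using sum.shift_bounds_cl_nat_ivl[of "\<lambda>i. h (c * threshold r \<theta> i n)" 1 n n] by (simp add: add.commute)
  also have "\<dots> \<le> (\<Sum>i=1..n. h (c * threshold r \<theta> i n))" by (intro sum_mono le) auto
  finally show ?thesis by simp
qed

text \<open>The cap at one is harmless as soon as the row sums at one fixed point are bounded. If the row
  sum exceeded two in a late row \<open>m\<close>, doubling would make the row sums exceed one in all rows from
  \<open>m/2\<close> to \<open>m\<close>; since \<open>n powr (r - 2) \<ge> 1/n\<close>, these rows would contribute at least \<open>1/2\<close> to a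
  convergent series.\<close>

lemma tail_weight_integral_finite_of_capped_sums:
  fixes h :: "real \<Rightarrow> real"
  assumes h: "antimono h" "\<And>u. 0 \<le> h u" "\<And>u. h u \<le> 1" and r: "1 < r" and \<theta>: "0 < \<theta>" and c: "0 < c"
    and n0: "1 \<le> n0"
    and fin: "(\<Sum>j. if n0 \<le> Suc j then ennreal (real (Suc j) powr (r - 2)) *
        (\<integral>\<^sup>+x. ennreal (min 1 (\<Sum>i=1..Suc j. h (c * x * threshold r \<theta> i (Suc j)))) * indicator {1<..} x \<partial>lborel) else 0) < \<infinity>"
  shows "(\<integral>\<^sup>+u. ennreal (h u * tail_weight \<theta> u) * indicator {exp 1..} u \<partial>lborel) < \<infinity>"
proof -
  have hm [measurable]: "h \<in> borel_measurable borel" by (rule antimono_borel[OF h(1)])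
  define A where "A = (\<lambda>n x. \<Sum>i=1..n. h (c * x * threshold r \<theta> i n))"
  have A0: "0 \<le> A n x" for n x unfolding A_def using h by (intro sum_nonneg) auto
  have Aanti: "A n y \<le> A n x" if "x \<le> y" for n x y
    unfolding A_def using that c
    by (intro sum_mono antimonoD[OF h(1)] mult_right_mono mult_left_mono) (auto simp: threshold_def)
  have Am [measurable]: "A n \<in> borel_measurable borel" for n
  proof -
    have "(\<lambda>x. A n x) \<in> borel_measurable borel" unfolding A_def by measurable
    then show ?thesis .
  qed
  define I where "I = (\<lambda>n. \<integral>\<^sup>+x. ennreal (min 1 (A n x)) * indicator {1<..} x \<partial>lborel)"
  have fin': "(\<Sum>j. if n0 \<le> Suc j then ennreal (real (Suc j) powr (r - 2)) * I (Suc j) else 0) < \<infinity>"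
    using fin unfolding I_def A_def .
  define u where "u = (\<lambda>n. if n0 \<le> n then real n powr (r - 2) * min 1 (A n 2) else 0)"
  have u0: "0 \<le> u n" for n using A0 by (auto simp: u_def)
  have Ige: "ennreal (min 1 (A n 2)) \<le> I n" for n
  proof -
    have "ennreal (min 1 (A n 2)) = ennreal (min 1 (A n 2)) * emeasure lborel {1<..2::real}" by simp
    also have "\<dots> = (\<integral>\<^sup>+x. ennreal (min 1 (A n 2)) * indicator {1<..2} (x::real) \<partial>lborel)"
      by (subst nn_integral_cmult_indicator) auto
    also have "\<dots> \<le> I n" unfolding I_def
    proof (rule nn_integral_mono)
      fix x :: real
      show "ennreal (min 1 (A n 2)) * indicator {1<..2} x \<le> ennreal (min 1 (A n x)) * indicator {1<..} x"
      proof (cases "x \<in> {1<..2}")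
        case True
        then have "min 1 (A n 2) \<le> min 1 (A n x)" using Aanti[of x 2 n] by auto
        with True show ?thesis by (auto intro!: ennreal_leI)
      qed simp
    qed
    finally show ?thesis .
  qed
  have "(\<Sum>j. ennreal (u (Suc j))) \<le> (\<Sum>j. if n0 \<le> Suc j then ennreal (real (Suc j) powr (r - 2)) * I (Suc j) else 0)"
  proof (rule suminf_le)
    fix j
    show "ennreal (u (Suc j)) \<le> (if n0 \<le> Suc j then ennreal (real (Suc j) powr (r - 2)) * I (Suc j) else 0)"
      using Ige[of "Suc j"] A0 by (auto simp: u_def ennreal_mult intro!: mult_left_mono)
  qed auto
  then have "(\<Sum>j. ennreal (u (Suc j))) < \<infinity>" using fin' by (rule order.strict_trans1)
  then have "summable (\<lambda>j. u (Suc j))" using u0 by (intro summable_suminf_not_top) auto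
  then have "summable u" by (simp add: summable_Suc_iff)
  then obtain N where N: "\<And>m n. N \<le> m \<Longrightarrow> norm (sum u {m..<n}) < 1 / 2"
    unfolding summable_Cauchy by (metis half_gt_zero_iff zero_less_one)
  define n1 where "n1 = 2 * (N + n0)"
  \<comment> \<open>a large sum in one row would force sums exceeding one in all rows down to half its length\<close>
  have bound: "A m 2 \<le> 2" if m: "n1 \<le> m" for m
  proof (rule ccontr)
    assume "\<not> A m 2 \<le> 2"
    then have big: "2 < A m 2" by simp
    define k where "k = m - m div 2"
    have k: "m \<le> 2 * k" "N \<le> k" "n0 \<le> k" "k \<le> m" "1 \<le> k" using m n0 by (auto simp: k_def n1_def)
    have "1 / real m \<le> u n" if n: "n \<in> {k..<Suc m}" for n
    proof -
      have nn: "n \<le> m" "m \<le> 2 * n" "1 \<le> n" "n0 \<le> n" using n k by auto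
      have "A m 2 \<le> 2 * A n 2"
        unfolding A_def using threshold_sum_doubling[OF h(1,2) \<theta> r _ nn(1,2), of "c * 2"] c by simp
      then have "1 < A n 2" using big by simp
      then have un: "u n = real n powr (r - 2)" using nn by (simp add: u_def)
      have "real m powr (- 1) \<le> real n powr (- 1)" using nn by (intro powr_mono2') auto
      also have "\<dots> \<le> real n powr (r - 2)" using nn r by (intro powr_mono) auto
      finally show ?thesis using un by (simp add: powr_minus_divide)
    qed
    then have "real (card {k..<Suc m}) * (1 / real m) \<le> sum u {k..<Suc m}"
      using sum_bounded_below[of "{k..<Suc m}" "1 / real m" u] by auto
    moreover have "1 / 2 \<le> real (card {k..<Suc m}) * (1 / real m)"
    proof -
      have "m \<le> 2 * card {k..<Suc m}" using k by (auto simp: k_def)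
      then have "real m \<le> 2 * real (card {k..<Suc m})" by linarith
      then show ?thesis using k by (simp add: field_simps)
    qed
    moreover have "norm (sum u {k..<Suc m}) < 1 / 2" using N k by blast
    ultimately show False unfolding real_norm_def by linarith
  qed
  have row: "(\<integral>\<^sup>+x. ennreal (A n x) * indicator {2<..} x \<partial>lborel) \<le> 2 * I n" if "n1 \<le> n" for n
  proof -
    have "(\<integral>\<^sup>+x. ennreal (A n x) * indicator {2<..} x \<partial>lborel)
      \<le> (\<integral>\<^sup>+x. 2 * (ennreal (min 1 (A n x)) * indicator {1<..} x) \<partial>lborel)"
    proof (rule nn_integral_mono)
      fix x :: real
      show "ennreal (A n x) * indicator {2<..} x \<le> 2 * (ennreal (min 1 (A n x)) * indicator {1<..} x)"
      proof (cases "2 < x")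
        case True
        then have "A n x \<le> 2" using Aanti[of 2 x n] bound[OF that] by simp
        then have "A n x \<le> 2 * min 1 (A n x)" using A0[of n x] by auto
        then have "ennreal (A n x) \<le> ennreal (2 * min 1 (A n x))" by (rule ennreal_leI)
        also have "\<dots> = 2 * ennreal (min 1 (A n x))" using A0[of n x] by (subst ennreal_mult) auto
        finally show ?thesis using True by simp
      qed simp
    qed
    also have "\<dots> = 2 * I n" unfolding I_def by (intro nn_integral_cmult) measurable
    finally show ?thesis .
  qed
  have split: "(\<integral>\<^sup>+x. ennreal (A n x) * indicator {2<..} x \<partial>lborel)
    = ennreal (1 / c) * (\<Sum>i=1..n. \<integral>\<^sup>+x. ennreal (h (x * threshold r \<theta> i n)) * indicator {c * 2<..} x \<partial>lborel)" for n
  proof -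
    have "(\<integral>\<^sup>+x. ennreal (A n x) * indicator {2<..} x \<partial>lborel)
      = (\<integral>\<^sup>+x. (\<Sum>i=1..n. ennreal (h (c * x * threshold r \<theta> i n)) * indicator {2<..} x) \<partial>lborel)"
      unfolding A_def sum_distrib_right[symmetric]
      by (intro nn_integral_cong arg_cong2[where f = "(*)"] sum_ennreal[symmetric] refl) (rule h(2))
    also have "\<dots> = (\<Sum>i=1..n. \<integral>\<^sup>+x. ennreal (h (c * x * threshold r \<theta> i n)) * indicator {2<..} x \<partial>lborel)"
      by (intro nn_integral_sum) measurable
    finally show ?thesis unfolding tail_integral_rescale[OF hm c] sum_distrib_left .
  qed
  define S where "S = (\<lambda>n. ennreal (real n powr (r - 2)) *
        (\<Sum>i=1..n. \<integral>\<^sup>+x. ennreal (h (x * threshold r \<theta> i n)) * indicator {c * 2<..} x \<partial>lborel))"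
  have Sle: "S n \<le> ennreal (2 * c) * (ennreal (real n powr (r - 2)) * I n)" if "n1 \<le> n" for n
  proof -
    have cc: "ennreal c * ennreal (1 / c) = 1" using c by (simp add: ennreal_mult[symmetric])
    have "S n = ennreal (real n powr (r - 2)) * (ennreal c * (\<integral>\<^sup>+x. ennreal (A n x) * indicator {2<..} x \<partial>lborel))"
      unfolding split S_def mult.assoc[symmetric, of "ennreal c"] cc by simp
    also have "\<dots> \<le> ennreal (real n powr (r - 2)) * (ennreal c * (2 * I n))"
      using row[OF that] by (intro mult_left_mono) auto
    also have "\<dots> = ennreal (2 * c) * (ennreal (real n powr (r - 2)) * I n)"
      using c by (simp add: ennreal_mult mult_ac)
    finally show ?thesis .
  qed
  have "(\<Sum>j. if n1 \<le> Suc j then S (Suc j) else 0)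
    \<le> (\<Sum>j. ennreal (2 * c) * (if n0 \<le> Suc j then ennreal (real (Suc j) powr (r - 2)) * I (Suc j) else 0))"
  proof (intro suminf_le)
    fix j
    show "(if n1 \<le> Suc j then S (Suc j) else 0)
      \<le> ennreal (2 * c) * (if n0 \<le> Suc j then ennreal (real (Suc j) powr (r - 2)) * I (Suc j) else 0)"
    proof (cases "n1 \<le> Suc j")
      case True
      then have "n0 \<le> Suc j" by (simp add: n1_def)
      with True Sle[OF True] show ?thesis by (simp del: of_nat_Suc)
    qed simp
  qed auto
  also have "\<dots> = ennreal (2 * c) * (\<Sum>j. if n0 \<le> Suc j then ennreal (real (Suc j) powr (r - 2)) * I (Suc j) else 0)"
    by (rule ennreal_suminf_cmult)
  also have "\<dots> < \<infinity>" using fin' by (simp add: ennreal_mult_less_top)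
  finally have "(\<Sum>j. if n1 \<le> Suc j then S (Suc j) else 0) < \<infinity>" .
  moreover have "1 \<le> n1" using n0 by (simp add: n1_def)
  ultimately show ?thesis
    using c unfolding S_def by (intro tail_weight_integral_finite[OF h r \<theta>, of "c * 2" n1]) auto
qed

lemma nn_integral_powr_tail_finite:
  fixes \<rho> \<epsilon> :: real assumes "1 < \<rho>" "0 < \<epsilon>"
  shows "(\<integral>\<^sup>+x. ennreal (x powr (- \<rho>)) * indicator {\<epsilon><..} x \<partial>lborel) < \<infinity>"
proof -
  have "((\<lambda>x. x powr (- \<rho>)) has_integral - (\<epsilon> powr (- \<rho> + 1)) / (- \<rho> + 1)) {\<epsilon>..}"
    using assms by (intro has_integral_powr_to_inf) auto
  then have "((\<lambda>x. if x \<in> {\<epsilon>..} then x powr (- \<rho>) else 0) has_integral - (\<epsilon> powr (- \<rho> + 1)) / (- \<rho> + 1)) UNIV"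
    by (subst has_integral_restrict_UNIV)
  then have "(\<integral>\<^sup>+x. ennreal (if x \<in> {\<epsilon>..} then x powr (- \<rho>) else 0) \<partial>lborel) = ennreal (- (\<epsilon> powr (- \<rho> + 1)) / (- \<rho> + 1))"
    by (intro nn_integral_has_integral_lborel) auto
  moreover have "(\<integral>\<^sup>+x. ennreal (x powr (- \<rho>)) * indicator {\<epsilon><..} x \<partial>lborel)
    \<le> (\<integral>\<^sup>+x. ennreal (if x \<in> {\<epsilon>..} then x powr (- \<rho>) else 0) \<partial>lborel)"
    by (intro nn_integral_mono) (auto simp: indicator_def)
  ultimately show ?thesis by (metis ennreal_less_top infinity_ennreal_def order.strict_trans1)
qed

section \<open>Choquet expectations as weighted tail integrals\<close>

lemma nn_integral_Ici_eq_SUP: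
  fixes f :: "real \<Rightarrow> ennreal" and b :: "nat \<Rightarrow> real"
  assumes [measurable]: "f \<in> borel_measurable borel" and b: "incseq b" "filterlim b at_top sequentially"
  shows "(\<integral>\<^sup>+x. f x * indicator {a..} x \<partial>lborel) = (SUP n. \<integral>\<^sup>+x. f x * indicator {a..b n} x \<partial>lborel)"
proof -
  have "(SUP n. \<integral>\<^sup>+x. f x * indicator {a..b n} x \<partial>lborel) = (\<integral>\<^sup>+x. (SUP n. f x * indicator {a..b n} x) \<partial>lborel)"
  proof (rule nn_integral_monotone_convergence_SUP[symmetric])
    show "incseq (\<lambda>n x. f x * indicator {a..b n} x)"
      using b(1) by (auto simp: incseq_def le_fun_def indicator_def intro: order_trans)
  qed measurable
  also have "(\<lambda>x. SUP n. f x * indicator {a..b n} x) = (\<lambda>x. f x * indicator {a..} x)"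
  proof (rule ext, rule antisym)
    fix x
    show "(SUP n. f x * indicator {a..b n} x) \<le> f x * indicator {a..} x"
      by (rule SUP_least) (auto simp: indicator_def)
    have "eventually (\<lambda>n. x \<le> b n) sequentially" using b(2) by (simp add: filterlim_at_top)
    then obtain n where n: "x \<le> b n" by (auto simp: eventually_sequentially)
    have "f x * indicator {a..} x \<le> f x * indicator {a..b n} x" using n by (auto simp: indicator_def)
    then show "f x * indicator {a..} x \<le> (SUP n. f x * indicator {a..b n} x)"
      by (meson SUP_upper UNIV_I order_trans)
  qed
  finally show ?thesis by simp
qed

lemma nn_integral_tail_substitution:
  fixes g \<phi> \<phi>' :: "real \<Rightarrow> real"
  assumes g: "g \<in> borel_measurable borel"
    and deriv: "\<And>u. a \<le> u \<Longrightarrow> (\<phi> has_real_derivative \<phi>' u) (at u)"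
    and cont: "continuous_on {a..} \<phi>'" and nonneg: "\<And>u. a \<le> u \<Longrightarrow> 0 \<le> \<phi>' u"
    and top: "filterlim \<phi> at_top at_top" and h: "\<And>u. 0 \<le> g u"
    and \<phi>'m: "\<phi>' \<in> borel_measurable borel" and \<phi>m: "\<phi> \<in> borel_measurable borel"
  shows "(\<integral>\<^sup>+x. ennreal (g x) * indicator {\<phi> a..} x \<partial>lborel)
       = (\<integral>\<^sup>+u. ennreal (g (\<phi> u) * \<phi>' u) * indicator {a..} u \<partial>lborel)"
proof -
  define b where "b = (\<lambda>n::nat. a + 1 + real n)"
  have b: "incseq b" "filterlim b at_top sequentially"
    unfolding b_def incseq_def
    by (auto intro: filterlim_tendsto_add_at_top[OF tendsto_const filterlim_real_sequentially])
  have inc: "\<phi> u \<le> \<phi> v" if "a \<le> u" "u \<le> v" for u v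
    using that by (intro DERIV_nonneg_imp_nondecreasing[of u v \<phi>]) (auto intro!: exI deriv nonneg)
  have \<phi>b: "incseq (\<lambda>n. \<phi> (b n))" "filterlim (\<lambda>n. \<phi> (b n)) at_top sequentially"
    using b inc filterlim_compose[OF top b(2)] by (auto simp: incseq_def b_def)
  have gm: "(\<lambda>x. ennreal (g x)) \<in> borel_measurable borel" using g by measurable
  have gm': "(\<lambda>u. ennreal (g (\<phi> u) * \<phi>' u)) \<in> borel_measurable borel" using g \<phi>m \<phi>'m by measurable
  have "(\<integral>\<^sup>+x. ennreal (g x) * indicator {\<phi> a..\<phi> (b n)} x \<partial>lborel)
      = (\<integral>\<^sup>+u. ennreal (g (\<phi> u) * \<phi>' u) * indicator {a..b n} u \<partial>lborel)" for n
  proof -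
    have "(\<integral>\<^sup>+x. ennreal (g x) * indicator {\<phi> a..\<phi> (b n)} x \<partial>lborel)
        = (\<integral>\<^sup>+u. ennreal (g (\<phi> u)) * \<phi>' u * indicator {a..b n} u \<partial>lborel)"
      by (rule nn_integral_substitution_aux[OF gm])
         (auto simp: b_def intro!: deriv nonneg continuous_on_subset[OF cont])
    also have "\<dots> = (\<integral>\<^sup>+u. ennreal (g (\<phi> u) * \<phi>' u) * indicator {a..b n} u \<partial>lborel)"
      by (intro nn_integral_cong) (auto simp: indicator_def ennreal_mult h nonneg)
    finally show ?thesis .
  qed
  then show ?thesis
    using nn_integral_Ici_eq_SUP[OF gm \<phi>b, of "\<phi> a"] nn_integral_Ici_eq_SUP[OF gm' b, of a] by simp
qed

lemma tail_integral_finite_cong: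
  fixes g :: "real \<Rightarrow> real"
  assumes gm: "g \<in> borel_measurable borel" and "\<And>u. g u \<le> 1" "0 < c"
  shows "(\<integral>\<^sup>+x. ennreal (g x) * indicator {0<..} x \<partial>lborel) < \<infinity>
     \<longleftrightarrow> (\<integral>\<^sup>+x. ennreal (g x) * indicator {c..} x \<partial>lborel) < \<infinity>"
proof
  have "(\<integral>\<^sup>+x. ennreal (g x) * indicator {c..} x \<partial>lborel) \<le> (\<integral>\<^sup>+x. ennreal (g x) * indicator {0<..} x \<partial>lborel)"
    using assms(3) by (intro nn_integral_mono) (auto simp: indicator_def)
  then show "(\<integral>\<^sup>+x. ennreal (g x) * indicator {0<..} x \<partial>lborel) < \<infinity> \<Longrightarrow> (\<integral>\<^sup>+x. ennreal (g x) * indicator {c..} x \<partial>lborel) < \<infinity>"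
    by (rule order.strict_trans1)
  assume fin: "(\<integral>\<^sup>+x. ennreal (g x) * indicator {c..} x \<partial>lborel) < \<infinity>"
  have "ennreal (g x) \<le> 1" for x using assms(2)[of x] by (metis ennreal_1 ennreal_leI)
  then have "(\<integral>\<^sup>+x. ennreal (g x) * indicator {0<..} x \<partial>lborel)
    \<le> (\<integral>\<^sup>+x. indicator {0..c} x + ennreal (g x) * indicator {c..} x \<partial>lborel)"
    by (intro nn_integral_mono) (auto simp: indicator_def)
  also have "\<dots> = emeasure lborel {0..c} + (\<integral>\<^sup>+x. ennreal (g x) * indicator {c..} x \<partial>lborel)"
    using gm by (subst nn_integral_add) auto
  also have "\<dots> < \<infinity>" using fin assms(3) by simp
  finally show "(\<integral>\<^sup>+x. ennreal (g x) * indicator {0<..} x \<partial>lborel) < \<infinity>" .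
qed

context sublinear_expectation_space begin

lemma tail_sets: "Y \<in> borel_measurable M \<Longrightarrow> {\<omega>\<in>space M. x < Y \<omega>} \<in> sets M" for Y :: "'a \<Rightarrow> real"
  by measurable

lemma tail_antimono:
  assumes "Y \<in> borel_measurable M" shows "antimono (\<lambda>x::real. cap E {\<omega>\<in>space M. x < Y \<omega>})"
  using assms by (intro antimonoI cap_mono tail_sets) auto

lemma tail_nonneg: "Y \<in> borel_measurable M \<Longrightarrow> 0 \<le> cap E {\<omega>\<in>space M. x < Y \<omega>}" for x :: real
  by (intro cap_bounds tail_sets)

lemma tail_le1: "Y \<in> borel_measurable M \<Longrightarrow> cap E {\<omega>\<in>space M. x < Y \<omega>} \<le> 1" for x :: real
  by (intro cap_bounds tail_sets)

lemma tail_borel: "Y \<in> borel_measurable M \<Longrightarrow> (\<lambda>x::real. cap E {\<omega>\<in>space M. x < Y \<omega>}) \<in> borel_measurable borel"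
  by (intro antimono_borel tail_antimono)

lemma Choquet_positive_part:
  fixes Y :: "'a \<Rightarrow> real"
  assumes "Y \<in> borel_measurable M"
  shows "(\<integral>\<^sup>+x\<in>{0<..}. e2ennreal (capacity E {\<omega>\<in>space M. Y \<omega> > x}) \<partial>lborel)
    = (\<integral>\<^sup>+x. ennreal (cap E {\<omega>\<in>space M. x < Y \<omega>}) * indicator {0<..} x \<partial>lborel)"
  by (simp add: cap_ereal tail_sets[OF assms] e2ennreal_ereal)

lemma Choquet_nonneg_eq:
  assumes Y: "Y \<in> borel_measurable M" "\<And>\<omega>. \<omega> \<in> space M \<Longrightarrow> 0 \<le> Y \<omega>"
  shows "Choquet M E Y = enn2ereal (\<integral>\<^sup>+x. ennreal (cap E {\<omega>\<in>space M. x < Y \<omega>}) * indicator {0<..} x \<partial>lborel)"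
proof -
  have "(\<integral>\<^sup>+x\<in>{..<0}. e2ennreal (1 - capacity E {\<omega>\<in>space M. Y \<omega> > x}) \<partial>lborel) = (\<integral>\<^sup>+(x::real). 0 \<partial>lborel)"
  proof (rule nn_integral_cong)
    fix x :: real
    show "e2ennreal (1 - capacity E {\<omega>\<in>space M. Y \<omega> > x}) * indicator {..<0} x = 0"
    proof (cases "x < 0")
      case True
      then have "{\<omega>\<in>space M. Y \<omega> > x} = space M" using Y(2) by force
      then have "capacity E {\<omega>\<in>space M. Y \<omega> > x} = 1"
        using cap_ereal[of "space M"] cap_space by (simp add: one_ereal_def)
      then show ?thesis by (simp add: zero_ennreal.abs_eq[symmetric])
    qed simp
  qed
  then show ?thesis unfolding Choquet_def Choquet_positive_part[OF Y(1)] by (simp add: zero_ennreal.rep_eq)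
qed

text \<open>For a random variable that is bounded below, the integral over the negative half-line is
  finite and only the upper tail matters.\<close>

lemma Choquet_finite_iff:
  assumes Y: "Y \<in> borel_measurable M" "\<And>\<omega>. \<omega> \<in> space M \<Longrightarrow> - B \<le> Y \<omega>"
  shows "Choquet M E Y < \<infinity>
    \<longleftrightarrow> (\<integral>\<^sup>+x. ennreal (cap E {\<omega>\<in>space M. x < Y \<omega>}) * indicator {0<..} x \<partial>lborel) < \<infinity>"
proof -
  define N where "N = (\<integral>\<^sup>+x\<in>{..<0}. e2ennreal (1 - capacity E {\<omega>\<in>space M. Y \<omega> > x}) \<partial>lborel)"
  have "N \<le> (\<integral>\<^sup>+x. indicator {- \<bar>B\<bar>..0} x \<partial>lborel)"
    unfolding N_def
  proof (rule nn_integral_mono)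
    fix x :: real
    have eq: "1 - capacity E {\<omega>\<in>space M. Y \<omega> > x} = ereal (1 - cap E {\<omega>\<in>space M. x < Y \<omega>})"
      by (simp add: cap_ereal tail_sets[OF Y(1)] one_ereal_def)
    show "e2ennreal (1 - capacity E {\<omega>\<in>space M. Y \<omega> > x}) * indicator {..<0} x \<le> indicator {- \<bar>B\<bar>..0} x"
    proof (cases "x < - \<bar>B\<bar>")
      case True
      then have "{\<omega>\<in>space M. x < Y \<omega>} = space M" using Y(2) by force
      then show ?thesis unfolding eq by (simp add: cap_space e2ennreal_ereal)
    next
      case False
      have "ennreal (1 - cap E {\<omega>\<in>space M. x < Y \<omega>}) \<le> 1"
        using tail_nonneg[OF Y(1), of x] by (metis diff_ge_0_iff_ge ennreal_1 ennreal_leI diff_le_eq le_add_same_cancel1)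
      with False show ?thesis unfolding eq by (auto simp: indicator_def e2ennreal_ereal)
    qed
  qed
  also have "\<dots> < \<infinity>" by simp
  finally have "N < \<infinity>" .
  then obtain n where n: "N = ennreal n" "0 \<le> n" by (cases N) auto
  show ?thesis
    unfolding Choquet_def Choquet_positive_part[OF Y(1)] N_def[symmetric] n(1)
    using n(2) by (cases "\<integral>\<^sup>+x. ennreal (cap E {\<omega>\<in>space M. x < Y \<omega>}) * indicator {0<..} x \<partial>lborel")
      (auto simp: enn2ereal_ennreal top_ennreal.rep_eq)
qed

text \<open>Substituting \<open>x = \<phi> u\<close> in the tail integral of \<open>\<phi> Z\<close> replaces its tail by that of \<open>Z\<close> and
  produces the weight \<open>\<phi>'\<close>. The hypothesis \<open>order\<close> says that beyond \<open>a\<close> the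
  function \<open>\<phi>\<close> increases strictly and that its values there are not exceeded at earlier points.\<close>

lemma Choquet_transform_finite_iff:
  fixes \<phi> \<phi>' W :: "real \<Rightarrow> real" and Z :: "'a \<Rightarrow> real"
  assumes Z: "Z \<in> borel_measurable M" "\<And>\<omega>. \<omega> \<in> space M \<Longrightarrow> 0 \<le> Z \<omega>"
    and \<phi>m: "\<phi> \<in> borel_measurable borel" and \<phi>'m: "\<phi>' \<in> borel_measurable borel"
    and Wm: "W \<in> borel_measurable borel"
    and lower: "\<And>z. 0 \<le> z \<Longrightarrow> - B \<le> \<phi> z"
    and order: "\<And>u z. a \<le> u \<Longrightarrow> 0 \<le> z \<Longrightarrow> \<phi> u < \<phi> z \<longleftrightarrow> u < z"
    and deriv: "\<And>u. a \<le> u \<Longrightarrow> (\<phi> has_real_derivative \<phi>' u) (at u)"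
    and cont: "continuous_on {a..} \<phi>'" and top: "filterlim \<phi> at_top at_top"
    and W: "\<And>u. a \<le> u \<Longrightarrow> 0 \<le> W u" "\<And>u. a \<le> u \<Longrightarrow> c1 * W u \<le> \<phi>' u" "\<And>u. a \<le> u \<Longrightarrow> \<phi>' u \<le> c2 * W u"
    and c: "0 < c1" "0 \<le> c2" and pos: "0 < \<phi> a"
  shows "Choquet M E (\<lambda>\<omega>. \<phi> (Z \<omega>)) < \<infinity>
    \<longleftrightarrow> (\<integral>\<^sup>+u. ennreal (cap E {\<omega>\<in>space M. u < Z \<omega>} * W u) * indicator {a..} u \<partial>lborel) < \<infinity>"
proof -
  define h where "h = (\<lambda>u. cap E {\<omega>\<in>space M. u < Z \<omega>})"
  define g where "g = (\<lambda>x. cap E {\<omega>\<in>space M. x < \<phi> (Z \<omega>)})"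
  have \<phi>Z: "(\<lambda>\<omega>. \<phi> (Z \<omega>)) \<in> borel_measurable M" using \<phi>m Z by measurable
  have hm [measurable]: "h \<in> borel_measurable borel" unfolding h_def by (rule tail_borel[OF Z(1)])
  note [measurable] = Wm \<phi>'m
  have h0: "0 \<le> h u" for u unfolding h_def by (rule tail_nonneg[OF Z(1)])
  have gm: "g \<in> borel_measurable borel" unfolding g_def by (rule tail_borel[OF \<phi>Z])
  have g0: "0 \<le> g u" "g u \<le> 1" for u unfolding g_def using tail_nonneg[OF \<phi>Z] tail_le1[OF \<phi>Z] by auto
  have gh: "g (\<phi> u) = h u" if "a \<le> u" for u
    unfolding g_def h_def using order[OF that] Z(2) by (intro arg_cong[of _ _ "cap E"]) auto
  have \<phi>'0: "0 \<le> \<phi>' u" if "a \<le> u" for u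
    using W(1,2)[OF that] c by (meson mult_nonneg_nonneg less_imp_le order_trans)
  have "Choquet M E (\<lambda>\<omega>. \<phi> (Z \<omega>)) < \<infinity> \<longleftrightarrow> (\<integral>\<^sup>+x. ennreal (g x) * indicator {0<..} x \<partial>lborel) < \<infinity>"
    unfolding g_def using lower Z(2) by (intro Choquet_finite_iff[OF \<phi>Z]) auto
  also have "\<dots> \<longleftrightarrow> (\<integral>\<^sup>+x. ennreal (g x) * indicator {\<phi> a..} x \<partial>lborel) < \<infinity>"
    by (rule tail_integral_finite_cong[OF gm g0(2) pos])
  also have "(\<integral>\<^sup>+x. ennreal (g x) * indicator {\<phi> a..} x \<partial>lborel)
      = (\<integral>\<^sup>+u. ennreal (g (\<phi> u) * \<phi>' u) * indicator {a..} u \<partial>lborel)"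
    by (rule nn_integral_tail_substitution[OF gm deriv cont \<phi>'0 top g0(1) \<phi>'m \<phi>m])
  also have "\<dots> = (\<integral>\<^sup>+u. ennreal (h u * \<phi>' u) * indicator {a..} u \<partial>lborel)"
    by (intro nn_integral_cong) (auto simp: indicator_def gh)
  also have "\<dots> < \<infinity> \<longleftrightarrow> (\<integral>\<^sup>+u. ennreal (h u * W u) * indicator {a..} u \<partial>lborel) < \<infinity>"
  proof
    assume fin: "(\<integral>\<^sup>+u. ennreal (h u * \<phi>' u) * indicator {a..} u \<partial>lborel) < \<infinity>"
    have "(\<integral>\<^sup>+u. ennreal (h u * W u) * indicator {a..} u \<partial>lborel)
      \<le> (\<integral>\<^sup>+u. ennreal (1 / c1) * (ennreal (h u * \<phi>' u) * indicator {a..} u) \<partial>lborel)"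
    proof (rule nn_integral_mono)
      fix u
      show "ennreal (h u * W u) * indicator {a..} u \<le> ennreal (1 / c1) * (ennreal (h u * \<phi>' u) * indicator {a..} u)"
      proof (cases "a \<le> u")
        case True
        have "h u * (c1 * W u) \<le> h u * \<phi>' u" using W(2)[OF True] h0 by (intro mult_left_mono) auto
        then have "h u * W u \<le> 1 / c1 * (h u * \<phi>' u)" using c by (simp add: field_simps)
        then have "ennreal (h u * W u) \<le> ennreal (1 / c1) * ennreal (h u * \<phi>' u)"
          using c h0 \<phi>'0[OF True] by (simp add: ennreal_mult[symmetric] ennreal_leI)
        with True show ?thesis by simp
      qed simp
    qed
    also have "\<dots> = ennreal (1 / c1) * (\<integral>\<^sup>+u. ennreal (h u * \<phi>' u) * indicator {a..} u \<partial>lborel)"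
      by (intro nn_integral_cmult) measurable
    also have "\<dots> < \<infinity>" using fin by (simp add: ennreal_mult_less_top)
    finally show "(\<integral>\<^sup>+u. ennreal (h u * W u) * indicator {a..} u \<partial>lborel) < \<infinity>" .
  next
    assume fin: "(\<integral>\<^sup>+u. ennreal (h u * W u) * indicator {a..} u \<partial>lborel) < \<infinity>"
    have "(\<integral>\<^sup>+u. ennreal (h u * \<phi>' u) * indicator {a..} u \<partial>lborel)
      \<le> (\<integral>\<^sup>+u. ennreal c2 * (ennreal (h u * W u) * indicator {a..} u) \<partial>lborel)"
    proof (rule nn_integral_mono)
      fix u
      show "ennreal (h u * \<phi>' u) * indicator {a..} u \<le> ennreal c2 * (ennreal (h u * W u) * indicator {a..} u)"
      proof (cases "a \<le> u")
        case True
        have "h u * \<phi>' u \<le> h u * (c2 * W u)" using W(3)[OF True] h0 by (intro mult_left_mono) auto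
        then have "ennreal (h u * \<phi>' u) \<le> ennreal c2 * ennreal (h u * W u)"
          using c h0 W(1)[OF True] by (simp add: ennreal_mult[symmetric] ennreal_leI mult_ac)
        with True show ?thesis by simp
      qed simp
    qed
    also have "\<dots> = ennreal c2 * (\<integral>\<^sup>+u. ennreal (h u * W u) * indicator {a..} u \<partial>lborel)"
      by (intro nn_integral_cmult) measurable
    also have "\<dots> < \<infinity>" using fin by (simp add: ennreal_mult_less_top)
    finally show "(\<integral>\<^sup>+u. ennreal (h u * \<phi>' u) * indicator {a..} u \<partial>lborel) < \<infinity>" .
  qed
  finally show ?thesis by (simp add: h_def)
qed

text \<open>The function \<open>z (ln z)\<^sup>2\<close> is not monotone on the unit interval, but is bounded by one there,
  hence does not exceed its values beyond \<open>exp 1\<close>.\<close>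

lemma Choquet_square_log_finite_iff:
  assumes Z: "Z \<in> borel_measurable M" "\<And>\<omega>. \<omega> \<in> space M \<Longrightarrow> 0 \<le> Z \<omega>" and p: "0 < p"
  shows "Choquet M E (\<lambda>\<omega>. Z \<omega> * (ln (Z \<omega>) / p)\<^sup>2) < \<infinity>
    \<longleftrightarrow> (\<integral>\<^sup>+u. ennreal (cap E {\<omega>\<in>space M. u < Z \<omega>} * (ln u)\<^sup>2) * indicator {exp 1..} u \<partial>lborel) < \<infinity>"
proof (rule Choquet_transform_finite_iff[where \<phi>' = "\<lambda>u. ((ln u)\<^sup>2 + 2 * ln u) / p\<^sup>2" and B = 0
      and ?c1.0 = "1 / p\<^sup>2" and ?c2.0 = "3 / p\<^sup>2"])
  have e: "0 < u" "1 \<le> ln u" "1 < u" if "exp 1 \<le> u" for u :: real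
    using that exp_gt_zero[of "1::real"] exp_ge_add_one_self[of "1::real"] one_le_ln[OF that] by linarith+
  show "z * (ln z / p)\<^sup>2 \<ge> - 0" if "0 \<le> z" for z using that by simp
  show "u * (ln u / p)\<^sup>2 < z * (ln z / p)\<^sup>2 \<longleftrightarrow> u < z" if u: "exp 1 \<le> u" and z: "0 \<le> z" for u z
  proof -
    have mono: "x * (ln x)\<^sup>2 < y * (ln y)\<^sup>2" if "1 \<le> x" "x < y" for x y :: real
    proof -
      have "x * (ln x)\<^sup>2 \<le> x * (ln y)\<^sup>2" using that by (intro mult_left_mono power_mono) auto
      also have "\<dots> < y * (ln y)\<^sup>2" using that by (intro mult_strict_right_mono) auto
      finally show ?thesis .
    qed
    have small: "z * (ln z)\<^sup>2 \<le> u * (ln u)\<^sup>2" if "z < 1"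
    proof (cases "z = 0")
      case False
      with z have z0: "0 < z" by simp
      define t where "t = 1 / sqrt z"
      have t: "0 < t" using z0 by (simp add: t_def)
      have "ln t \<le> t / exp 1"
        using exp_ge_add_one_self[of "ln t - 1"] t by (simp add: exp_diff)
      moreover have "2 \<le> exp (1::real)" using exp_ge_add_one_self[of "1::real"] by simp
      then have "t / exp 1 \<le> t / 2" using t by (intro divide_left_mono) auto
      ultimately have "2 * ln t \<le> t" by linarith
      moreover have lt: "2 * ln t = - ln z" using z0 by (simp add: t_def ln_div ln_sqrt)
      moreover have "0 \<le> - ln z" using that z0 by simp
      ultimately have "(- ln z)\<^sup>2 \<le> t\<^sup>2" by (intro power_mono) auto
      also have "t\<^sup>2 = 1 / z" using z0 by (simp add: t_def power_divide)
      finally have "z * (ln z)\<^sup>2 \<le> z * (1 / z)" using z0 by (intro mult_left_mono) auto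
      also have "\<dots> = 1" using z0 by simp
      also have "1 \<le> u * (ln u)\<^sup>2"
        using mult_mono[of 1 u 1 "(ln u)\<^sup>2"] e[OF u] one_le_power[of "ln u" 2] by simp
      finally show ?thesis .
    qed (use e[OF u] in simp)
    have "u * (ln u)\<^sup>2 < z * (ln z)\<^sup>2 \<longleftrightarrow> u < z"
    proof (cases "z < 1")
      case True
      then show ?thesis using small e[OF u] by auto
    next
      case False
      then show ?thesis using mono[of u z] mono[of z u] e[OF u] by (cases u z rule: linorder_cases) auto
    qed
    then show ?thesis using p by (simp add: power_divide divide_less_cancel)
  qed
  show "((\<lambda>u. u * (ln u / p)\<^sup>2) has_real_derivative ((ln u)\<^sup>2 + 2 * ln u) / p\<^sup>2) (at u)" if "exp 1 \<le> u" for u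
    using e[OF that] p by (auto intro!: derivative_eq_intros simp: power2_eq_square field_simps)
  show "continuous_on {exp 1..} (\<lambda>u. ((ln u)\<^sup>2 + 2 * ln u) / p\<^sup>2)"
    using e p by (intro continuous_intros) force+
  show "filterlim (\<lambda>u. u * (ln u / p)\<^sup>2) at_top at_top" using p by real_asymp
  show "1 / p\<^sup>2 * (ln u)\<^sup>2 \<le> ((ln u)\<^sup>2 + 2 * ln u) / p\<^sup>2" if "exp 1 \<le> u" for u
    using e[OF that] by (simp add: divide_right_mono)
  show "((ln u)\<^sup>2 + 2 * ln u) / p\<^sup>2 \<le> 3 / p\<^sup>2 * (ln u)\<^sup>2" if "exp 1 \<le> u" for u
  proof -
    have "ln u * 1 \<le> ln u * ln u" using e[OF that] by (intro mult_left_mono) auto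
    then have "(ln u)\<^sup>2 + 2 * ln u \<le> 3 * (ln u)\<^sup>2" by (simp add: power2_eq_square)
    then have "((ln u)\<^sup>2 + 2 * ln u) / p\<^sup>2 \<le> 3 * (ln u)\<^sup>2 / p\<^sup>2" by (intro divide_right_mono) auto
    then show ?thesis by simp
  qed
  show "0 < exp 1 * (ln (exp 1) / p)\<^sup>2" using p by simp
qed (use Z p in auto)

text \<open>On the unit interval \<open>z powr \<kappa> * ln z\<close> lies between \<open>-1\<close> and \<open>0\<close>; this bounds the random
  variable from below and keeps small values of \<open>Z\<close> out of the upper tail.\<close>

lemma Choquet_powr_log_finite_iff:
  assumes Z: "Z \<in> borel_measurable M" "\<And>\<omega>. \<omega> \<in> space M \<Longrightarrow> 0 \<le> Z \<omega>" and p: "0 < p" and k: "1 \<le> \<kappa>"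
  shows "Choquet M E (\<lambda>\<omega>. Z \<omega> powr \<kappa> * (ln (Z \<omega>) / p)) < \<infinity>
    \<longleftrightarrow> (\<integral>\<^sup>+u. ennreal (cap E {\<omega>\<in>space M. u < Z \<omega>} * (u powr (\<kappa> - 1) * ln u)) * indicator {exp 1..} u \<partial>lborel) < \<infinity>"
proof (rule Choquet_transform_finite_iff[where \<phi>' = "\<lambda>u. (\<kappa> * (u powr (\<kappa> - 1) * ln u) + u powr (\<kappa> - 1)) / p" and B = "1 / p"
      and ?c1.0 = "\<kappa> / p" and ?c2.0 = "(\<kappa> + 1) / p"])
  have e: "0 < u" "1 \<le> ln u" "1 < u" if "exp 1 \<le> u" for u :: real
    using that exp_gt_zero[of "1::real"] exp_ge_add_one_self[of "1::real"] one_le_ln[OF that] by linarith+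
  show "- (1 / p) \<le> z powr \<kappa> * (ln z / p)" if z: "0 \<le> z" for z
  proof -
    have "- 1 \<le> z powr \<kappa> * ln z"
    proof (cases "z = 0 \<or> 1 \<le> z")
      case False
      with z have z0: "0 < z" "z < 1" by auto
      have l: "- ln z \<le> 1 / z" using ln_le_minus_one[of "1 / z"] z0 by (simp add: ln_div)
      have "z powr \<kappa> \<le> z powr 1" using z0 k by (intro powr_mono') auto
      then have "z powr \<kappa> * (- ln z) \<le> z * (1 / z)" using l z0 by (intro mult_mono) auto
      then show ?thesis using z0 by simp
    next
      case True
      then have "0 \<le> z powr \<kappa> * ln z" by auto
      then show ?thesis by linarith
    qed
    then have "- 1 / p \<le> z powr \<kappa> * ln z / p" using p by (intro divide_right_mono) auto
    then show ?thesis by simp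
  qed
  show "u powr \<kappa> * (ln u / p) < z powr \<kappa> * (ln z / p) \<longleftrightarrow> u < z" if u: "exp 1 \<le> u" and z: "0 \<le> z" for u z
  proof -
    have mono: "x powr \<kappa> * ln x < y powr \<kappa> * ln y" if "1 \<le> x" "x < y" for x y :: real
    proof -
      have "x powr \<kappa> * ln x \<le> x powr \<kappa> * ln y" using that by (intro mult_left_mono) auto
      also have "\<dots> < y powr \<kappa> * ln y" using that k by (intro mult_strict_right_mono powr_less_mono2) auto
      finally show ?thesis .
    qed
    have "u powr \<kappa> * ln u < z powr \<kappa> * ln z \<longleftrightarrow> u < z"
    proof (cases "z < 1")
      case True
      then have "z powr \<kappa> * ln z \<le> 0" using z by (cases "z = 0") (auto simp: mult_le_0_iff)
      moreover have "0 < u powr \<kappa> * ln u" using e[OF u] by simp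
      ultimately have "\<not> u powr \<kappa> * ln u < z powr \<kappa> * ln z" by linarith
      moreover have "\<not> u < z" using True e[OF u] by linarith
      ultimately show ?thesis by simp
    next
      case False
      then show ?thesis using mono[of u z] mono[of z u] e[OF u] by (cases u z rule: linorder_cases) auto
    qed
    then show ?thesis using p by (simp add: divide_less_cancel)
  qed
  show "((\<lambda>u. u powr \<kappa> * (ln u / p)) has_real_derivative (\<kappa> * (u powr (\<kappa> - 1) * ln u) + u powr (\<kappa> - 1)) / p) (at u)"
    if "exp 1 \<le> u" for u
    using e[OF that] p by (auto intro!: derivative_eq_intros simp: powr_diff field_simps)
  show "continuous_on {exp 1..} (\<lambda>u. (\<kappa> * (u powr (\<kappa> - 1) * ln u) + u powr (\<kappa> - 1)) / p)"
    using e p by (intro continuous_intros) force+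
  show "filterlim (\<lambda>u. u powr \<kappa> * (ln u / p)) at_top at_top" using p k by real_asymp
  show "\<kappa> / p * (u powr (\<kappa> - 1) * ln u) \<le> (\<kappa> * (u powr (\<kappa> - 1) * ln u) + u powr (\<kappa> - 1)) / p" if "exp 1 \<le> u" for u
    using p by (simp add: divide_right_mono)
  show "(\<kappa> * (u powr (\<kappa> - 1) * ln u) + u powr (\<kappa> - 1)) / p \<le> (\<kappa> + 1) / p * (u powr (\<kappa> - 1) * ln u)" if "exp 1 \<le> u" for u
  proof -
    have "u powr (\<kappa> - 1) * 1 \<le> u powr (\<kappa> - 1) * ln u" using e[OF that] by (intro mult_left_mono) auto
    then have "\<kappa> * (u powr (\<kappa> - 1) * ln u) + u powr (\<kappa> - 1) \<le> (\<kappa> + 1) * (u powr (\<kappa> - 1) * ln u)"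
      by (simp add: algebra_simps)
    then have "(\<kappa> * (u powr (\<kappa> - 1) * ln u) + u powr (\<kappa> - 1)) / p \<le> (\<kappa> + 1) * (u powr (\<kappa> - 1) * ln u) / p"
      using p by (intro divide_right_mono) auto
    then show ?thesis by simp
  qed
  show "0 < exp 1 powr \<kappa> * (ln (exp 1) / p)" using p by simp
  show "0 \<le> u powr (\<kappa> - 1) * ln u" if "exp 1 \<le> u" for u using e[OF that] by simp
qed (use Z p k in auto)

lemma Choquet_power_finite_iff:
  assumes Z: "Z \<in> borel_measurable M" "\<And>\<omega>. \<omega> \<in> space M \<Longrightarrow> 0 \<le> Z \<omega>"
  shows "Choquet M E Z < \<infinity>
    \<longleftrightarrow> (\<integral>\<^sup>+u. ennreal (cap E {\<omega>\<in>space M. u < Z \<omega>}) * indicator {exp 1..} u \<partial>lborel) < \<infinity>"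
  using Choquet_finite_iff[OF Z(1), of 0] Z(2)
    tail_integral_finite_cong[OF tail_borel[OF Z(1)] tail_le1[OF Z(1)], of "exp 1"] by simp

lemma moment_condition_iff:
  assumes X: "X \<in> borel_measurable M" and p: "0 < p" and s: "0 < s"
  shows "(p > s \<longrightarrow> Choquet M E (\<lambda>\<omega>. \<bar>X \<omega>\<bar> powr p) < \<infinity>) \<and>
         (p = s \<longrightarrow> Choquet M E (\<lambda>\<omega>. \<bar>X \<omega>\<bar> powr s * (ln \<bar>X \<omega>\<bar>)\<^sup>2) < \<infinity>) \<and>
         (p < s \<longrightarrow> Choquet M E (\<lambda>\<omega>. \<bar>X \<omega>\<bar> powr s * ln \<bar>X \<omega>\<bar>) < \<infinity>)
    \<longleftrightarrow> (\<integral>\<^sup>+u. ennreal (cap E {\<omega>\<in>space M. u < \<bar>X \<omega>\<bar> powr p} * tail_weight (p / s) u)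
          * indicator {exp 1..} u \<partial>lborel) < \<infinity>"
proof -
  define Z where "Z = (\<lambda>\<omega>. \<bar>X \<omega>\<bar> powr p)"
  have Z: "Z \<in> borel_measurable M" "\<And>\<omega>. \<omega> \<in> space M \<Longrightarrow> 0 \<le> Z \<omega>"
    using X by (auto simp: Z_def)
  have lnZ: "ln (Z \<omega>) / p = ln \<bar>X \<omega>\<bar>" for \<omega>
    using p by (cases "X \<omega> = 0") (auto simp: Z_def ln_powr)
  consider "p > s" | "p = s" | "p < s" by linarith
  then show ?thesis
  proof cases
    case 1
    then have "1 < p / s" using s by simp
    with 1 show ?thesis using Choquet_power_finite_iff[OF Z] by (simp add: tail_weight_def Z_def)
  next
    case 2
    have "(\<lambda>\<omega>. Z \<omega> * (ln (Z \<omega>) / p)\<^sup>2) = (\<lambda>\<omega>. \<bar>X \<omega>\<bar> powr s * (ln \<bar>X \<omega>\<bar>)\<^sup>2)"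
      unfolding lnZ using 2 by (simp add: Z_def)
    moreover have "tail_weight (p / s) u = (ln u)\<^sup>2" for u using 2 s by (simp add: tail_weight_def)
    ultimately show ?thesis using 2 Choquet_square_log_finite_iff[OF Z p] by (simp add: Z_def)
  next
    case 3
    have "(\<lambda>\<omega>. Z \<omega> powr (s / p) * (ln (Z \<omega>) / p)) = (\<lambda>\<omega>. \<bar>X \<omega>\<bar> powr s * ln \<bar>X \<omega>\<bar>)"
      unfolding lnZ using p by (simp add: Z_def powr_powr)
    moreover have "tail_weight (p / s) u = u powr (s / p - 1) * ln u" for u
      using 3 p s by (simp add: tail_weight_def)
    moreover have "1 \<le> s / p" using 3 p by simp
    ultimately show ?thesis using 3 Choquet_powr_log_finite_iff[OF Z p, of "s / p"] by (simp add: Z_def)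
  qed
qed

end

section \<open>The tail of the maximal weighted sum\<close>

lemma less_powr_iff: "0 < p \<Longrightarrow> 0 \<le> x \<Longrightarrow> 0 \<le> z \<Longrightarrow> x < z powr p \<longleftrightarrow> x powr (1 / p) < z" for x z p :: real
proof -
  assume a: "0 < p" "0 \<le> x" "0 \<le> z"
  have "x < z powr p \<longleftrightarrow> (x powr (1 / p)) powr p < z powr p" using a by (simp add: powr_powr)
  also have "\<dots> \<longleftrightarrow> x powr (1 / p) < z"
    using a powr_less_mono2[of p "x powr (1 / p)" z] powr_mono2[of p z "x powr (1 / p)"] by (auto simp: not_less[symmetric])
  finally show ?thesis .
qed

definition model_weight :: "real \<Rightarrow> real \<Rightarrow> nat \<Rightarrow> nat \<Rightarrow> real" where
  "model_weight q r n i = (real i / real n) powr (- q / r) * (1 / real n powr q)"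

lemma model_weight_eq:
  assumes "1 \<le> i" "i \<le> n"
  shows "model_weight q r n i = real i powr (- q / r) * real n powr (q / r - q)"
  using assms by (simp add: model_weight_def powr_divide powr_diff powr_minus_divide)

lemma model_weight_pos: "1 \<le> i \<Longrightarrow> i \<le> n \<Longrightarrow> 0 < model_weight q r n i"
  by (simp add: model_weight_def)

text \<open>The exponents of the array are tuned such that \<open>\<bar>b\<^sub>n\<^sub>i X\<bar>\<^sup>p > x\<close> becomes a condition on the product
  \<open>i n powr (r - 1)\<close>.\<close>

lemma model_weight_powr:
  assumes "1 \<le> i" "i \<le> n" "0 < r"
  shows "model_weight q r n i powr (- p) = threshold r (p * q / r) i n"
proof -
  have "model_weight q r n i powr (- p) = real i powr (p * q / r) * real n powr ((q / r - q) * (- p))"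
    using assms by (simp add: model_weight_eq powr_mult powr_powr mult.commute)
  also have "(q / r - q) * (- p) = (r - 1) * (p * q / r)" using assms by (simp add: field_simps)
  finally show ?thesis using assms by (simp add: threshold_def powr_mult powr_powr)
qed

text \<open>Here \<open>\<tau> < r/q\<close> makes the exponent of \<open>i\<close> larger than \<open>-1\<close>. The total exponent of \<open>n\<close> is
  negative precisely when \<open>\<tau> > 1/q\<close>.\<close>

lemma model_weight_sum:
  assumes "0 < q" "0 < r" "0 < \<tau>" "\<tau> < r / q"
  shows "\<exists>C>0. \<forall>n. (\<Sum>i=1..n. model_weight q r n i powr \<tau>) \<le> C * real n powr (1 - q * \<tau>)"
proof -
  define \<alpha> where "\<alpha> = 1 - q * \<tau> / r"
  have "q * \<tau> < r" using assms by (simp add: field_simps)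
  then have "0 < \<alpha>" using assms by (simp add: \<alpha>_def)
  then obtain C where C: "0 < C" "\<And>x. 0 \<le> x \<Longrightarrow> (\<Sum>i=1..nat \<lfloor>x\<rfloor>. real i powr (\<alpha> - 1)) \<le> C * x powr \<alpha>"
    using powr_sum_upper by blast
  have "(\<Sum>i=1..n. model_weight q r n i powr \<tau>) \<le> C * real n powr (1 - q * \<tau>)" for n
  proof -
    have "(\<Sum>i=1..n. model_weight q r n i powr \<tau>) = (\<Sum>i=1..n. real n powr ((q / r - q) * \<tau>) * real i powr (\<alpha> - 1))"
      by (rule sum.cong) (auto simp: model_weight_eq powr_mult powr_powr \<alpha>_def mult.commute)
    also have "\<dots> = real n powr ((q / r - q) * \<tau>) * (\<Sum>i=1..n. real i powr (\<alpha> - 1))"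
      by (simp only: sum_distrib_left)
    also have "\<dots> \<le> real n powr ((q / r - q) * \<tau>) * (C * real n powr \<alpha>)"
      using C(2)[of "real n"] by (intro mult_left_mono) auto
    also have "\<dots> = C * (real n powr ((q / r - q) * \<tau>) * real n powr \<alpha>)" by simp
    also have "real n powr ((q / r - q) * \<tau>) * real n powr \<alpha> = real n powr (1 - q * \<tau>)"
      by (simp add: powr_add[symmetric] \<alpha>_def algebra_simps)
    finally show ?thesis .
  qed
  with C(1) show ?thesis by blast
qed

context sublinear_expectation_space begin

definition max_sum_tail :: "(nat \<Rightarrow> 'a \<Rightarrow> real) \<Rightarrow> (nat \<Rightarrow> real) \<Rightarrow> real \<Rightarrow> nat \<Rightarrow> real \<Rightarrow> real" where
  "max_sum_tail Xs a p n x = cap E {\<omega>\<in>space M. \<exists>k\<in>{1..n}. x < \<bar>\<Sum>i=1..k. a i * Xs i \<omega>\<bar> powr p}"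

lemma max_sum_event_sets:
  fixes Xs :: "nat \<Rightarrow> 'a \<Rightarrow> real"
  assumes "\<And>i. i \<ge> 1 \<Longrightarrow> Xs i \<in> H"
  shows "{\<omega>\<in>space M. \<exists>k\<in>{1..n}. x < \<bar>\<Sum>i=1..k. a i * Xs i \<omega>\<bar> powr p} \<in> sets M"
proof -
  have Xm: "Xs i \<in> borel_measurable M" if "i \<ge> 1" for i using assms(1)[OF that] H_measurable by auto
  have [measurable]: "(\<lambda>\<omega>. \<Sum>i=1..k. a i * Xs i \<omega>) \<in> borel_measurable M" for k
    using Xm by (intro borel_measurable_sum borel_measurable_times) auto
  show ?thesis by measurable
qed

lemma max_sum_measurable:
  fixes Xs :: "nat \<Rightarrow> 'a \<Rightarrow> real"
  assumes "\<And>i. i \<ge> 1 \<Longrightarrow> Xs i \<in> H" "1 \<le> n"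
  shows "(\<lambda>\<omega>. MAX k\<in>{1..n}. \<bar>\<Sum>i=1..k. a i * Xs i \<omega>\<bar> powr p) \<in> borel_measurable M"
proof -
  have Xm: "Xs i \<in> borel_measurable M" if "i \<ge> 1" for i using assms(1)[OF that] H_measurable by auto
  have "(\<lambda>\<omega>. \<Sum>i=1..k. a i * Xs i \<omega>) \<in> borel_measurable M" for k
    using Xm by (intro borel_measurable_sum borel_measurable_times) auto
  then have "(\<lambda>\<omega>. \<bar>\<Sum>i=1..k. a i * Xs i \<omega>\<bar> powr p) \<in> borel_measurable M" for k
    by (intro borel_measurable_abs powr_real_measurable) auto
  then show ?thesis by (intro borel_measurable_Max) simp_all
qed

lemma max_sum_tail_eq:
  assumes "1 \<le> n"
  shows "max_sum_tail Xs a p n x = cap E {\<omega>\<in>space M. x < (MAX k\<in>{1..n}. \<bar>\<Sum>i=1..k. a i * Xs i \<omega>\<bar> powr p)}"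
  unfolding max_sum_tail_def using assms by (subst Max_gr_iff) auto

lemma max_sum_tail_borel:
  assumes "\<And>i. i \<ge> 1 \<Longrightarrow> Xs i \<in> H" "1 \<le> n"
  shows "max_sum_tail Xs a p n \<in> borel_measurable borel"
proof -
  have "(\<lambda>x. max_sum_tail Xs a p n x) \<in> borel_measurable borel"
    unfolding max_sum_tail_eq[OF assms(2)] by (intro tail_borel max_sum_measurable assms)
  then show ?thesis .
qed

lemma Choquet_excess_eq:
  assumes "\<And>i. i \<ge> 1 \<Longrightarrow> Xs i \<in> H" "1 \<le> n"
  shows "Choquet M E (\<lambda>\<omega>. max ((MAX k\<in>{1..n}. \<bar>\<Sum>i=1..k. a i * Xs i \<omega>\<bar> powr p) - \<epsilon>) 0)
    = enn2ereal (\<integral>\<^sup>+x. ennreal (max_sum_tail Xs a p n x) * indicator {\<epsilon><..} x \<partial>lborel)"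
proof -
  define Y where "Y = (\<lambda>\<omega>. MAX k\<in>{1..n}. \<bar>\<Sum>i=1..k. a i * Xs i \<omega>\<bar> powr p)"
  have Ym: "Y \<in> borel_measurable M" unfolding Y_def by (rule max_sum_measurable[OF assms])
  define Q where "Q = max_sum_tail Xs a p n"
  have Qm [measurable]: "Q \<in> borel_measurable borel" unfolding Q_def by (rule max_sum_tail_borel[OF assms])
  have QY: "Q x = cap E {\<omega>\<in>space M. x < Y \<omega>}" for x
    unfolding Q_def max_sum_tail_eq[OF assms(2)] by (simp add: Y_def)
  have "Choquet M E (\<lambda>\<omega>. max (Y \<omega> - \<epsilon>) 0)
    = enn2ereal (\<integral>\<^sup>+x. ennreal (cap E {\<omega>\<in>space M. x < max (Y \<omega> - \<epsilon>) 0}) * indicator {0<..} x \<partial>lborel)"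
    using Ym by (intro Choquet_nonneg_eq borel_measurable_max borel_measurable_diff) auto
  also have "(\<integral>\<^sup>+x. ennreal (cap E {\<omega>\<in>space M. x < max (Y \<omega> - \<epsilon>) 0}) * indicator {0<..} x \<partial>lborel)
    = (\<integral>\<^sup>+x. ennreal (Q (\<epsilon> + 1 * x)) * indicator {\<epsilon><..} (\<epsilon> + 1 * x) \<partial>lborel)"
  proof (rule nn_integral_cong)
    fix x :: real
    have "cap E {\<omega>\<in>space M. x < max (Y \<omega> - \<epsilon>) 0} = Q (\<epsilon> + x)" if "0 < x"
      unfolding QY
      using that by (intro arg_cong[of _ _ "cap E"]) auto
    then show "ennreal (cap E {\<omega>\<in>space M. x < max (Y \<omega> - \<epsilon>) 0}) * indicator {0<..} x
      = ennreal (Q (\<epsilon> + 1 * x)) * indicator {\<epsilon><..} (\<epsilon> + 1 * x)"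
      by (auto simp: indicator_def)
  qed
  also have "\<dots> = (\<integral>\<^sup>+x. ennreal (Q x) * indicator {\<epsilon><..} x \<partial>lborel)"
    using nn_integral_real_affine[of "\<lambda>x. ennreal (Q x) * indicator {\<epsilon><..} x" 1 \<epsilon>] by simp
  finally show ?thesis unfolding Y_def Q_def .
qed

lemma Choquet_series_finite_iff:
  assumes "\<And>i. i \<ge> 1 \<Longrightarrow> Xs i \<in> H"
  shows "(\<Sum>j. let n = Suc j in ereal (real n powr (r - 2)) *
              Choquet M E (\<lambda>\<omega>. max ((MAX k\<in>{1..n}. \<bar>\<Sum>i=1..k. a n i * Xs i \<omega>\<bar> powr p) - \<epsilon>) 0)) < \<infinity>
    \<longleftrightarrow> (\<Sum>j. ennreal (real (Suc j) powr (r - 2)) *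
          (\<integral>\<^sup>+x. ennreal (max_sum_tail Xs (a (Suc j)) p (Suc j) x) * indicator {\<epsilon><..} x \<partial>lborel)) < \<infinity>"
proof -
  have "(let n = Suc j in ereal (real n powr (r - 2)) *
              Choquet M E (\<lambda>\<omega>. max ((MAX k\<in>{1..n}. \<bar>\<Sum>i=1..k. a n i * Xs i \<omega>\<bar> powr p) - \<epsilon>) 0))
    = enn2ereal (ennreal (real (Suc j) powr (r - 2)) *
          (\<integral>\<^sup>+x. ennreal (max_sum_tail Xs (a (Suc j)) p (Suc j) x) * indicator {\<epsilon><..} x \<partial>lborel))" for j
    unfolding Let_def by (subst Choquet_excess_eq[OF assms]) (auto simp: times_ennreal.rep_eq enn2ereal_ennreal)
  then show ?thesis
    by (simp only: suminf_enn2ereal) (simp add: less_ennreal.rep_eq top_ennreal.rep_eq del: suminf_enn2ereal)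
qed

lemma ident_distrib_tail:
  assumes "ident_distrib H E Y X" "Y \<in> H" "X \<in> H"
  shows "cap E {\<omega>\<in>space M. x < \<bar>Y \<omega>\<bar>} = cap E {\<omega>\<in>space M. x < \<bar>X \<omega>\<bar>}"
proof -
  have m: "Measurable.pred M (\<lambda>\<omega>. x < \<bar>Z \<omega>\<bar>)" if "Z \<in> H" for Z :: "'a \<Rightarrow> real"
  proof -
    have "Z \<in> borel_measurable M" using that H_measurable by auto
    then show ?thesis by measurable
  qed
  define \<psi> :: "real \<Rightarrow> real" where "\<psi> = (\<lambda>y. if x < \<bar>y\<bar> then 1 else 0)"
  have "\<psi> \<in> borel_measurable borel" unfolding \<psi>_def by measurable
  moreover have "(\<lambda>\<omega>. \<psi> (Y \<omega>)) \<in> H" "(\<lambda>\<omega>. \<psi> (X \<omega>)) \<in> H"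
    unfolding \<psi>_def by (intro H_indicator_pred m assms)+
  moreover have e: "E (\<lambda>\<omega>. \<psi> (Y \<omega>)) = ereal (cap E {\<omega>\<in>space M. x < \<bar>Y \<omega>\<bar>})"
    "E (\<lambda>\<omega>. \<psi> (X \<omega>)) = ereal (cap E {\<omega>\<in>space M. x < \<bar>X \<omega>\<bar>})"
    unfolding \<psi>_def by (intro E_indicator_pred m assms)+
  ultimately have "E (\<lambda>\<omega>. \<psi> (Y \<omega>)) = E (\<lambda>\<omega>. \<psi> (X \<omega>))"
    using assms(1) unfolding ident_distrib_def by auto
  then show ?thesis by (simp add: e)
qed

text \<open>Identical distribution yields equality of expectations only where both are known to be
  finite; this supplies the finiteness.\<close>

lemma E_finite_of_dominated:
  assumes "Y \<in> H" "T \<in> H" "\<And>\<omega>. \<bar>Y \<omega>\<bar> \<le> T \<omega>" "E T \<le> ereal L"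
  shows "\<bar>E Y\<bar> < \<infinity>"
proof -
  have "E Y \<le> ereal L"
    using E_mono[OF assms(2,1)] assms(3,4) by (meson abs_le_D1 order_trans)
  have "0 \<le> E T" using assms(2,3) by (intro E_nonneg) (auto intro: order_trans[OF abs_ge_zero])
  then obtain t where t: "E T = ereal t" using assms(4) by (cases "E T") auto
  have "E (\<lambda>\<omega>. T \<omega> + - T \<omega>) \<le> E T + E (\<lambda>\<omega>. - T \<omega>)"
    using t assms(2) by (intro E_subadditive H_minus) auto
  then have "0 \<le> E T + E (\<lambda>\<omega>. - T \<omega>)" using E_const[of 0] by (simp add: zero_ereal_def)
  then have "ereal (- t) \<le> E (\<lambda>\<omega>. - T \<omega>)" using t by (cases "E (\<lambda>\<omega>. - T \<omega>)") auto
  also have "\<dots> \<le> E Y"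
    using assms(3) by (intro E_mono H_minus assms(1,2)) (metis abs_le_iff minus_le_iff)
  finally show ?thesis using \<open>E Y \<le> ereal L\<close> by (cases "E Y") auto
qed

lemma ident_distrib_mean:
  assumes id: "ident_distrib H E Y X" and H: "Y \<in> H" "X \<in> H" and mean: "E X = 0" "E (\<lambda>\<omega>. - X \<omega>) = 0"
    and \<tau>: "1 \<le> \<tau>" "\<tau> \<le> 2" and L: "E (\<lambda>\<omega>. trunc_powr \<tau> (Y \<omega>)) \<le> ereal L"
  shows "E Y = 0" "E (\<lambda>\<omega>. - Y \<omega>) = 0"
proof -
  have dom: "\<bar>Y \<omega>\<bar> \<le> trunc_powr \<tau> (Y \<omega>)" for \<omega>
  proof -
    have "\<bar>Y \<omega>\<bar> \<le> max 1 \<bar>Y \<omega>\<bar> powr 1" by simp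
    also have "\<dots> \<le> trunc_powr \<tau> (Y \<omega>)" unfolding trunc_powr_def using \<tau> by (intro powr_mono) auto
    finally show ?thesis .
  qed
  have TH: "(\<lambda>\<omega>. trunc_powr \<tau> (Y \<omega>)) \<in> H" using H \<tau> by (intro trunc_powr_H) auto
  have f1: "\<bar>E Y\<bar> < \<infinity>" by (rule E_finite_of_dominated[OF H(1) TH dom L])
  have f2: "\<bar>E (\<lambda>\<omega>. - Y \<omega>)\<bar> < \<infinity>"
    using dom by (intro E_finite_of_dominated[OF H_minus[OF H(1)] TH _ L]) auto
  show "E Y = 0"
    using id[unfolded ident_distrib_def, rule_format, of "\<lambda>x. x"] H f1 mean by simp
  show "E (\<lambda>\<omega>. - Y \<omega>) = 0"
    using id[unfolded ident_distrib_def, rule_format, of "\<lambda>x. - x"] H H_minus f2 mean by simp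
qed

lemma scaled_tail_eq:
  assumes id: "ident_distrib H E Y X" and H: "Y \<in> H" "X \<in> H" and "0 \<le> y" "0 < t" "0 < p"
  shows "cap E {\<omega>\<in>space M. y < \<bar>t * Y \<omega>\<bar>} = cap E {\<omega>\<in>space M. (y / t) powr p < \<bar>X \<omega>\<bar> powr p}"
proof -
  have "y < \<bar>t * Y \<omega>\<bar> \<longleftrightarrow> y / t < \<bar>Y \<omega>\<bar>" for \<omega> using assms by (simp add: abs_mult field_simps)
  then have "cap E {\<omega>\<in>space M. y < \<bar>t * Y \<omega>\<bar>} = cap E {\<omega>\<in>space M. y / t < \<bar>Y \<omega>\<bar>}" by simp
  also have "\<dots> = cap E {\<omega>\<in>space M. y / t < \<bar>X \<omega>\<bar>}" by (rule ident_distrib_tail[OF id H])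
  also have "\<dots> = cap E {\<omega>\<in>space M. (y / t) powr p < \<bar>X \<omega>\<bar> powr p}"
    using assms by (simp add: less_powr_iff powr_powr)
  finally show ?thesis .
qed

text \<open>From row \<open>n0\<close> on, the array lies between constant multiples of the model weights.\<close>

context
  fixes Xs :: "nat \<Rightarrow> 'a \<Rightarrow> real" and X :: "'a \<Rightarrow> real" and p q r :: real
    and a :: "nat \<Rightarrow> nat \<Rightarrow> real" and Ca :: real and n0 :: nat
  assumes ind: "indep_seq H E Xs" and XsH: "\<And>i. i \<ge> 1 \<Longrightarrow> Xs i \<in> H" and XH: "X \<in> H"
    and id: "\<And>i. i \<ge> 1 \<Longrightarrow> ident_distrib H E (Xs i) X"
    and p: "0 < p" and q: "1/2 < q" and r: "1 < r"
    and Ca: "1 \<le> Ca" and n0: "1 \<le> n0"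
    and a: "\<And>n i. n0 \<le> n \<Longrightarrow> i \<in> {1..n} \<Longrightarrow> model_weight q r n i / Ca \<le> a n i \<and> a n i \<le> Ca * model_weight q r n i"
begin

abbreviation "hX u \<equiv> cap E {\<omega>\<in>space M. u < \<bar>X \<omega>\<bar> powr p}"

lemma Xp_measurable: "(\<lambda>\<omega>. \<bar>X \<omega>\<bar> powr p) \<in> borel_measurable M"
proof -
  have "X \<in> borel_measurable M" using XH H_measurable by auto
  then show ?thesis by measurable
qed

lemma hX_props: "antimono (\<lambda>u. hX u)" "0 \<le> hX u" "hX u \<le> 1"
  by (intro tail_antimono tail_nonneg tail_le1 Xp_measurable)+

lemma aX_measurable: "i \<ge> 1 \<Longrightarrow> (\<lambda>\<omega>. c * Xs i \<omega>) \<in> borel_measurable M"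
  using H_cmult[OF XsH] H_measurable by auto

lemma weight_pos:
  assumes "n0 \<le> n" "i \<in> {1..n}" shows "0 < a n i"
proof -
  have "0 < model_weight q r n i / Ca" using assms Ca by (intro divide_pos_pos model_weight_pos) auto
  with a[OF assms] show ?thesis by linarith
qed

text \<open>A large summand \<open>a\<^sub>i X\<^sub>i = S\<^sub>i - S\<^sub>i\<^sub>-\<^sub>1\<close> forces one of two consecutive partial sums to be large,
  at the cost of a factor two.\<close>

lemma max_sum_tail_lower:
  assumes n: "n0 \<le> n" and x: "0 < x"
  shows "(1 - exp (-1)) * min 1 (\<Sum>i=1..n. hX ((2 * Ca) powr p * x * threshold r (p * q / r) i n))
    \<le> max_sum_tail Xs (a n) p n x"
proof -
  have n1: "1 \<le> n" using n n0 by simp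
  define y where "y = x powr (1 / p)"
  have y: "0 < y" "y powr p = x" using x p by (auto simp: y_def powr_powr)
  have t: "hX ((2 * Ca) powr p * x * threshold r (p * q / r) i n)
    \<le> cap E {\<omega>\<in>space M. 2 * y / a n i < \<bar>Xs i \<omega>\<bar>}" if i: "i \<in> {1..n}" for i
  proof -
    define b where "b = model_weight q r n i"
    have b: "0 < b" "b powr (- p) = threshold r (p * q / r) i n"
      unfolding b_def using i r by (auto intro!: model_weight_pos model_weight_powr)
    have ab: "b / Ca \<le> a n i" "0 < a n i" using a[OF n i] weight_pos[OF n i] by (auto simp: b_def)
    have "2 * y / a n i \<le> 2 * y / (b / Ca)" using ab b Ca y by (intro divide_left_mono) auto
    then have "(2 * y / a n i) powr p \<le> (2 * y / (b / Ca)) powr p" using y ab p by (intro powr_mono2) auto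
    also have "\<dots> = (2 * Ca * y / b) powr p" by (simp add: mult_ac)
    also have "\<dots> = (2 * Ca) powr p * x * b powr (- p)"
      using y b(1) Ca by (simp add: powr_mult powr_divide powr_minus_divide)
    finally have "hX ((2 * Ca) powr p * x * threshold r (p * q / r) i n) \<le> hX ((2 * y / a n i) powr p)"
      unfolding b(2) using hX_props(1) by (rule antimonoD[rotated])
    also have "\<dots> = cap E {\<omega>\<in>space M. 2 * y / a n i < \<bar>1 * Xs i \<omega>\<bar>}"
      using scaled_tail_eq[OF id XsH XH, of i "2 * y / a n i" 1 p] i y ab p by simp
    finally show ?thesis by simp
  qed
  have "(1 - exp (-1)) * min 1 (\<Sum>i=1..n. hX ((2 * Ca) powr p * x * threshold r (p * q / r) i n))
    \<le> (1 - exp (-1)) * min 1 (\<Sum>i=1..n. cap E {\<omega>\<in>space M. 2 * y / a n i < \<bar>Xs i \<omega>\<bar>})"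
    using t by (intro mult_left_mono min.mono sum_mono) auto
  also have "\<dots> \<le> cap E {\<omega>\<in>space M. \<exists>i\<in>{1..n}. 2 * y / a n i < \<bar>Xs i \<omega>\<bar>}"
    by (rule cap_union_lower[OF ind XsH n1])
  also have "\<dots> \<le> max_sum_tail Xs (a n) p n x"
    unfolding max_sum_tail_def
  proof (rule cap_mono)
    have Xm: "Xs i \<in> borel_measurable M" if "i \<ge> 1" for i using XsH[OF that] H_measurable by auto
    have "Measurable.pred M (\<lambda>\<omega>. \<exists>i\<in>{1..n}. 2 * y / a n i < \<bar>Xs i \<omega>\<bar>)"
      using Xm by (intro pred_intros_finite) (auto intro!: borel_measurable_less borel_measurable_abs)
    then show "{\<omega>\<in>space M. \<exists>i\<in>{1..n}. 2 * y / a n i < \<bar>Xs i \<omega>\<bar>} \<in> sets M" by simp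
    show "{\<omega>\<in>space M. \<exists>k\<in>{1..n}. x < \<bar>\<Sum>i=1..k. a n i * Xs i \<omega>\<bar> powr p} \<in> sets M"
      by (rule max_sum_event_sets[OF XsH])
    show "{\<omega>\<in>space M. \<exists>i\<in>{1..n}. 2 * y / a n i < \<bar>Xs i \<omega>\<bar>}
      \<subseteq> {\<omega>\<in>space M. \<exists>k\<in>{1..n}. x < \<bar>\<Sum>i=1..k. a n i * Xs i \<omega>\<bar> powr p}"
    proof safe
      fix \<omega> i assume i: "i \<in> {1..n}" "2 * y / a n i < \<bar>Xs i \<omega>\<bar>"
      define S where "S = (\<lambda>k. \<Sum>i=1..k. a n i * Xs i \<omega>)"
      obtain i' where i': "i = Suc i'" using i by (cases i) auto
      have "2 * y < \<bar>a n i * Xs i \<omega>\<bar>"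
        using i(2) weight_pos[OF n i(1)] by (simp add: abs_mult field_simps)
      also have "a n i * Xs i \<omega> = S i - S i'" by (simp add: S_def i')
      finally have "y < \<bar>S i\<bar> \<or> y < \<bar>S i'\<bar>" by linarith
      moreover have "\<not> y < \<bar>S i'\<bar>" if "i' = 0" using that y by (simp add: S_def)
      ultimately have "\<exists>k\<in>{1..n}. y < \<bar>S k\<bar>"
        using i(1) i' by (metis One_nat_def Suc_leD Suc_leI atLeastAtMost_iff neq0_conv)
      then show "\<exists>k\<in>{1..n}. x < \<bar>\<Sum>i=1..k. a n i * Xs i \<omega>\<bar> powr p"
        using less_powr_iff[OF p, of x] x by (auto simp: S_def y_def)
    qed
  qed
  finally show ?thesis .
qed

text \<open>Truncation at \<open>y / (2 N)\<close> turns the exponent \<open>y / (2 b)\<close> of the error term into \<open>N\<close>.\<close>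

lemma max_sum_tail_upper:
  assumes \<tau>: "0 < \<tau>" "\<tau> \<le> 2" "\<tau> < r / q" and N: "0 < N"
    and L: "\<And>i. i \<ge> 1 \<Longrightarrow> E (\<lambda>\<omega>. trunc_powr \<tau> (Xs i \<omega>)) \<le> ereal L" "0 \<le> L"
    and mean: "\<And>i. i \<ge> 1 \<Longrightarrow> \<tau> \<le> 1 \<or> E (Xs i) = 0 \<and> E (\<lambda>\<omega>. - Xs i \<omega>) = 0"
  shows "\<exists>c>0. \<exists>K\<ge>0. \<forall>n\<ge>n0. \<forall>x>0. max_sum_tail Xs (a n) p n x
    \<le> (\<Sum>i=1..n. hX (c * x * threshold r (p * q / r) i n))
      + K * real n powr (- ((q * \<tau> - 1) * N)) * x powr (- (\<tau> * N / p))"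
proof -
  obtain C1 where C1: "0 < C1" "\<And>n. (\<Sum>i=1..n. model_weight q r n i powr \<tau>) \<le> C1 * real n powr (1 - q * \<tau>)"
    using model_weight_sum[of q r \<tau>] q r \<tau> by auto
  \<comment> \<open>\<open>L + 1\<close> instead of \<open>L\<close> makes the bound on the moments strictly positive\<close>
  define D where "D = (L + 1) * Ca powr \<tau> * C1"
  have D: "0 < D" unfolding D_def using L C1 Ca by (intro mult_pos_pos) auto
  define c where "c = (1 / (2 * N) / Ca) powr p"
  have c: "0 < c" using N Ca by (simp add: c_def)
  define K where "K = 2 * exp 3 * (D * (2 * N) powr \<tau>) powr N"
  have "max_sum_tail Xs (a n) p n x \<le> (\<Sum>i=1..n. hX (c * x * threshold r (p * q / r) i n))
      + K * real n powr (- ((q * \<tau> - 1) * N)) * x powr (- (\<tau> * N / p))"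
    if n: "n0 \<le> n" and x: "0 < x" for n x
  proof -
    have n1: "1 \<le> n" using n n0 by simp
    define y where "y = x powr (1 / p)"
    have y: "0 < y" "y powr p = x" using x p by (auto simp: y_def powr_powr)
    define b where "b = y / (2 * N)"
    have b: "0 < b" using y N by (simp add: b_def)
    define B where "B = D * real n powr (1 - q * \<tau>)"
    have apos: "0 < a n i" if "i \<in> {1..n}" for i by (rule weight_pos[OF n that])
    have Bsum: "L * (\<Sum>i=1..n. \<bar>a n i\<bar> powr \<tau>) \<le> B"
    proof -
      have "(\<Sum>i=1..n. \<bar>a n i\<bar> powr \<tau>) \<le> (\<Sum>i=1..n. Ca powr \<tau> * model_weight q r n i powr \<tau>)"
      proof (rule sum_mono)
        fix i assume i: "i \<in> {1..n}"
        have "\<bar>a n i\<bar> powr \<tau> \<le> (Ca * model_weight q r n i) powr \<tau>"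
          using a[OF n i] apos[OF i] \<tau> by (intro powr_mono2) auto
        also have "\<dots> = Ca powr \<tau> * model_weight q r n i powr \<tau>"
          using Ca i model_weight_pos[of i n q r] by (simp add: powr_mult)
        finally show "\<bar>a n i\<bar> powr \<tau> \<le> Ca powr \<tau> * model_weight q r n i powr \<tau>" .
      qed
      also have "\<dots> = Ca powr \<tau> * (\<Sum>i=1..n. model_weight q r n i powr \<tau>)" by (simp only: sum_distrib_left)
      also have "\<dots> \<le> Ca powr \<tau> * (C1 * real n powr (1 - q * \<tau>))" using C1 by (intro mult_left_mono) auto
      finally have "L * (\<Sum>i=1..n. \<bar>a n i\<bar> powr \<tau>) \<le> (L + 1) * (Ca powr \<tau> * (C1 * real n powr (1 - q * \<tau>)))"
        using L by (intro mult_mono sum_nonneg) auto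
      then show ?thesis by (simp add: B_def D_def mult_ac)
    qed
    have B0: "0 < B" using D n1 by (simp add: B_def)
    have mean': "\<tau> \<le> 1 \<or> E (\<lambda>\<omega>. a n i * Xs i \<omega>) \<le> 0 \<and> E (\<lambda>\<omega>. - a n i * Xs i \<omega>) \<le> 0" if i: "i \<in> {1..n}" for i
    proof (cases "\<tau> \<le> 1")
      case False
      then have m: "E (Xs i) = 0" "E (\<lambda>\<omega>. - Xs i \<omega>) = 0" using mean[of i] i by auto
      have "E (\<lambda>\<omega>. a n i * Xs i \<omega>) = ereal (a n i) * E (Xs i)"
        using apos[OF i] i by (intro E_pos_homogeneous XsH) auto
      moreover have "E (\<lambda>\<omega>. a n i * - Xs i \<omega>) = ereal (a n i) * E (\<lambda>\<omega>. - Xs i \<omega>)"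
        using apos[OF i] i by (intro E_pos_homogeneous H_minus XsH) auto
      ultimately show ?thesis using m by simp
    qed simp
    have t: "cap E {\<omega>\<in>space M. b < \<bar>a n i * Xs i \<omega>\<bar>} \<le> hX (c * x * threshold r (p * q / r) i n)"
      if i: "i \<in> {1..n}" for i
    proof -
      define w where "w = model_weight q r n i"
      have w: "0 < w" "w powr (- p) = threshold r (p * q / r) i n"
        unfolding w_def using i r by (auto intro!: model_weight_pos model_weight_powr)
      have aw: "a n i \<le> Ca * w" using a[OF n i] by (simp add: w_def)
      have "c * x * threshold r (p * q / r) i n = (1 / (2 * N) / Ca) powr p * y powr p * w powr (- p)"
        by (simp add: c_def y(2) w(2))
      also have "\<dots> = (1 / (2 * N) / Ca * y / w) powr p"
        using N Ca y w(1) by (simp add: powr_mult powr_divide powr_minus_divide)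
      also have "1 / (2 * N) / Ca * y / w = b / (Ca * w)" by (simp add: b_def)
      also have "(b / (Ca * w)) powr p \<le> (b / a n i) powr p"
        using b aw apos[OF i] w Ca p by (intro powr_mono2 divide_left_mono) auto
      finally have "hX ((b / a n i) powr p) \<le> hX (c * x * threshold r (p * q / r) i n)"
        using hX_props(1) by (rule antimonoD[rotated])
      moreover have "cap E {\<omega>\<in>space M. b < \<bar>a n i * Xs i \<omega>\<bar>} = hX ((b / a n i) powr p)"
        using i b apos[OF i] p by (intro scaled_tail_eq[OF id XsH XH]) auto
      ultimately show ?thesis by simp
    qed
    have "max_sum_tail Xs (a n) p n x = cap E {\<omega>\<in>space M. \<exists>k\<in>{1..n}. y < \<bar>\<Sum>i=1..k. a n i * Xs i \<omega>\<bar>}"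
      unfolding max_sum_tail_def y_def using x p by (simp add: less_powr_iff)
    also have "\<dots> \<le> (\<Sum>i=1..n. cap E {\<omega>\<in>space M. b < \<bar>a n i * Xs i \<omega>\<bar>})
      + 2 * exp 3 * (B / b powr \<tau>) powr (y / (2 * b))"
      using L by (intro cap_max_sum[OF ind XsH n1 b y(1) \<tau>(1,2) _ L(2) mean' Bsum B0]) auto
    also have "(\<Sum>i=1..n. cap E {\<omega>\<in>space M. b < \<bar>a n i * Xs i \<omega>\<bar>})
      \<le> (\<Sum>i=1..n. hX (c * x * threshold r (p * q / r) i n))"
      by (rule sum_mono) (rule t)
    also have "y / (2 * b) = N" using y N by (simp add: b_def)
    also have "B / b powr \<tau> = D * (2 * N) powr \<tau> * real n powr (1 - q * \<tau>) * x powr (- (\<tau> / p))"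
      using N x by (simp add: B_def b_def y_def powr_divide powr_powr powr_minus_divide)
    also have "2 * exp 3 * (D * (2 * N) powr \<tau> * real n powr (1 - q * \<tau>) * x powr (- (\<tau> / p))) powr N
      = K * real n powr ((1 - q * \<tau>) * N) * x powr (- (\<tau> / p) * N)"
      using D N by (simp add: K_def powr_mult powr_powr)
    also have "(1 - q * \<tau>) * N = - ((q * \<tau> - 1) * N)" by (simp add: algebra_simps)
    also have "- (\<tau> / p) * N = - (\<tau> * N / p)" by simp
    finally show ?thesis by simp
  qed
  moreover have "0 \<le> K" by (simp add: K_def)
  ultimately show ?thesis using c by blast
qed

text \<open>The finitely many rows in which the weights are not controlled: one of the \<open>n\<close> summands exceeds
  the fraction \<open>1/n\<close> of the level.\<close>

lemma max_sum_tail_row_finite: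
  assumes n: "1 \<le> n" and \<epsilon>: "0 < \<epsilon>"
    and fin: "(\<integral>\<^sup>+u. ennreal (hX u) * indicator {0<..} u \<partial>lborel) < \<infinity>"
  shows "(\<integral>\<^sup>+x. ennreal (max_sum_tail Xs w p n x) * indicator {\<epsilon><..} x \<partial>lborel) < \<infinity>"
proof -
  have hm: "(\<lambda>u. hX u) \<in> borel_measurable borel" by (rule tail_borel[OF Xp_measurable])
  \<comment> \<open>the summand \<open>1\<close> keeps \<open>A\<close> positive if all weights vanish\<close>
  define A where "A = 1 + Max ((\<lambda>i. \<bar>w i\<bar>) ` {1..n})"
  have A: "\<bar>w i\<bar> \<le> A" if "i \<in> {1..n}" for i
  proof -
    have "\<bar>w i\<bar> \<le> Max ((\<lambda>i. \<bar>w i\<bar>) ` {1..n})" using that by (intro Max_ge) auto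
    then show ?thesis unfolding A_def by linarith
  qed
  have A0: "0 < A"
  proof -
    have "\<bar>w 1\<bar> \<le> Max ((\<lambda>i. \<bar>w i\<bar>) ` {1..n})" using n by (intro Max_ge) auto
    then show ?thesis unfolding A_def using abs_ge_zero[of "w 1"] by linarith
  qed
  define c where "c = (1 / (real n * A)) powr p"
  have c: "0 < c" using n A0 by (simp add: c_def)
  have bound: "max_sum_tail Xs w p n x \<le> real n * hX (c * x)" if x: "0 < x" for x
  proof -
    define y where "y = x powr (1 / p)"
    have y: "0 < y" "y powr p = x" using x p by (auto simp: y_def powr_powr)
    have sets1: "{\<omega>\<in>space M. y / real n < \<bar>A * Xs i \<omega>\<bar>} \<in> sets M" if "i \<in> {1..n}" for i
    proof -
      have [measurable]: "(\<lambda>\<omega>. A * Xs i \<omega>) \<in> borel_measurable M" using that by (intro aX_measurable) auto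
      show ?thesis by measurable
    qed
    have "max_sum_tail Xs w p n x \<le> cap E (\<Union>i\<in>{1..n}. {\<omega>\<in>space M. y / real n < \<bar>A * Xs i \<omega>\<bar>})"
      unfolding max_sum_tail_def
    proof (rule cap_mono)
      show "{\<omega>\<in>space M. \<exists>k\<in>{1..n}. x < \<bar>\<Sum>i=1..k. w i * Xs i \<omega>\<bar> powr p} \<in> sets M"
        by (rule max_sum_event_sets[OF XsH])
      show "(\<Union>i\<in>{1..n}. {\<omega>\<in>space M. y / real n < \<bar>A * Xs i \<omega>\<bar>}) \<in> sets M" using sets1 by auto
      show "{\<omega>\<in>space M. \<exists>k\<in>{1..n}. x < \<bar>\<Sum>i=1..k. w i * Xs i \<omega>\<bar> powr p}
        \<subseteq> (\<Union>i\<in>{1..n}. {\<omega>\<in>space M. y / real n < \<bar>A * Xs i \<omega>\<bar>})"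
      proof (rule subsetI, rule ccontr)
        fix \<omega> assume \<omega>: "\<omega> \<in> {\<omega>\<in>space M. \<exists>k\<in>{1..n}. x < \<bar>\<Sum>i=1..k. w i * Xs i \<omega>\<bar> powr p}"
          and no: "\<omega> \<notin> (\<Union>i\<in>{1..n}. {\<omega>\<in>space M. y / real n < \<bar>A * Xs i \<omega>\<bar>})"
        then obtain k where k: "k \<in> {1..n}" "x < \<bar>\<Sum>i=1..k. w i * Xs i \<omega>\<bar> powr p" by auto
        then have big: "y < \<bar>\<Sum>i=1..k. w i * Xs i \<omega>\<bar>" using x p by (simp add: less_powr_iff y_def)
        have small: "\<bar>w i * Xs i \<omega>\<bar> \<le> y / real n" if "i \<in> {1..k}" for i
        proof -
          have i: "i \<in> {1..n}" using that k(1) by auto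
          then have "\<bar>A * Xs i \<omega>\<bar> \<le> y / real n" using no \<omega> by (auto simp: not_less)
          moreover have "\<bar>w i * Xs i \<omega>\<bar> \<le> \<bar>A * Xs i \<omega>\<bar>"
            using A[OF i] A0 by (simp add: abs_mult mult_right_mono)
          ultimately show ?thesis by linarith
        qed
        have "\<bar>\<Sum>i=1..k. w i * Xs i \<omega>\<bar> \<le> (\<Sum>i=1..k. \<bar>w i * Xs i \<omega>\<bar>)" by (rule sum_abs)
        also have "\<dots> \<le> real k * (y / real n)" using sum_bounded_above[of "{1..k}", OF small] by simp
        also have "\<dots> \<le> real n * (y / real n)" using k(1) y by (intro mult_right_mono) auto
        also have "\<dots> = y" using n by simp
        finally show False using big by simp
      qed
    qed
    also have "\<dots> \<le> (\<Sum>i=1..n. cap E {\<omega>\<in>space M. y / real n < \<bar>A * Xs i \<omega>\<bar>})"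
      using sets1 by (intro cap_UN) auto
    also have "\<dots> = (\<Sum>i=1..n. hX (c * x))"
    proof (rule sum.cong[OF refl])
      fix i assume i: "i \<in> {1..n}"
      have "(y / real n / A) powr p = c * x"
        using y n A0 by (simp add: c_def powr_divide powr_mult)
      then show "cap E {\<omega>\<in>space M. y / real n < \<bar>A * Xs i \<omega>\<bar>} = hX (c * x)"
        using scaled_tail_eq[OF id XsH XH, of i "y / real n" A p] i y A0 p by simp
    qed
    finally show ?thesis by simp
  qed
  have "(\<integral>\<^sup>+x. ennreal (max_sum_tail Xs w p n x) * indicator {\<epsilon><..} x \<partial>lborel)
    \<le> (\<integral>\<^sup>+x. ennreal (real n) * (ennreal (hX (c * x * 1)) * indicator {0<..} x) \<partial>lborel)"
  proof (rule nn_integral_mono)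
    fix x
    show "ennreal (max_sum_tail Xs w p n x) * indicator {\<epsilon><..} x
      \<le> ennreal (real n) * (ennreal (hX (c * x * 1)) * indicator {0<..} x)"
    proof (cases "\<epsilon> < x")
      case True
      then have "ennreal (max_sum_tail Xs w p n x) \<le> ennreal (real n * hX (c * x))"
        using \<epsilon> by (intro ennreal_leI bound) auto
      with True \<epsilon> show ?thesis using hX_props(2) by (simp add: ennreal_mult)
    qed simp
  qed
  also have "\<dots> = ennreal (real n) * (\<integral>\<^sup>+x. ennreal (hX (c * x * 1)) * indicator {0<..} x \<partial>lborel)"
    using measurable_compose[OF _ hm, of "\<lambda>x. c * x * 1" lborel] by (intro nn_integral_cmult) simp
  also have "\<dots> = ennreal (real n) * (ennreal (1 / c) * (\<integral>\<^sup>+x. ennreal (hX (x * 1)) * indicator {c * 0<..} x \<partial>lborel))"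
    unfolding tail_integral_rescale[OF hm c] ..
  also have "\<dots> < \<infinity>" using fin by (simp add: ennreal_mult_less_top)
  finally show ?thesis .
qed

lemma necessity:
  assumes fin: "(\<Sum>j. ennreal (real (Suc j) powr (r - 2)) *
          (\<integral>\<^sup>+x. ennreal (max_sum_tail Xs (a (Suc j)) p (Suc j) x) * indicator {1<..} x \<partial>lborel)) < \<infinity>"
  shows "(\<integral>\<^sup>+u. ennreal (hX u * tail_weight (p * q / r) u) * indicator {exp 1..} u \<partial>lborel) < \<infinity>"
proof -
  define \<kappa> where "\<kappa> = 1 - exp (- 1 :: real)"
  have k: "0 < \<kappa>" by (simp add: \<kappa>_def)
  define c where "c = (2 * Ca) powr p"
  have c: "0 < c" using Ca by (simp add: c_def)
  have th: "0 < p * q / r" using p q r by simp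
  define m where "m = (\<lambda>n x. min 1 (\<Sum>i=1..n. hX (c * x * threshold r (p * q / r) i n)))"
  have m0: "0 \<le> m n x" for n x unfolding m_def using hX_props(2) by (auto intro!: sum_nonneg)
  have hm: "(\<lambda>u. hX u) \<in> borel_measurable borel" by (rule tail_borel[OF Xp_measurable])
  have mm: "m n \<in> borel_measurable borel" for n
  proof -
    have "(\<lambda>x. m n x) \<in> borel_measurable borel"
      unfolding m_def by (intro borel_measurable_min borel_measurable_sum measurable_compose[OF _ hm]) auto
    then show ?thesis .
  qed
  define T where "T = (\<lambda>n. \<integral>\<^sup>+x. ennreal (max_sum_tail Xs (a n) p n x) * indicator {1<..} x \<partial>lborel)"
  have le: "(\<integral>\<^sup>+x. ennreal (m n x) * indicator {1<..} x \<partial>lborel) \<le> ennreal (1 / \<kappa>) * T n" if n: "n0 \<le> n" for n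
  proof -
    have "(\<integral>\<^sup>+x. ennreal (m n x) * indicator {1<..} x \<partial>lborel)
      \<le> (\<integral>\<^sup>+x. ennreal (1 / \<kappa>) * (ennreal (max_sum_tail Xs (a n) p n x) * indicator {1<..} x) \<partial>lborel)"
    proof (rule nn_integral_mono)
      fix x :: real
      show "ennreal (m n x) * indicator {1<..} x
        \<le> ennreal (1 / \<kappa>) * (ennreal (max_sum_tail Xs (a n) p n x) * indicator {1<..} x)"
      proof (cases "1 < x")
        case True
        then have l: "\<kappa> * m n x \<le> max_sum_tail Xs (a n) p n x"
          unfolding \<kappa>_def m_def c_def using n by (intro max_sum_tail_lower) auto
        then have "m n x \<le> 1 / \<kappa> * max_sum_tail Xs (a n) p n x" using k by (simp add: field_simps)
        moreover have "0 \<le> max_sum_tail Xs (a n) p n x" using l k m0[of n x] by (meson mult_nonneg_nonneg less_imp_le order_trans)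
        ultimately have "ennreal (m n x) \<le> ennreal (1 / \<kappa>) * ennreal (max_sum_tail Xs (a n) p n x)"
          using k by (simp add: ennreal_mult[symmetric] ennreal_leI)
        with True show ?thesis by simp
      qed simp
    qed
    also have "\<dots> = ennreal (1 / \<kappa>) * T n"
    proof -
      have [measurable]: "max_sum_tail Xs (a n) p n \<in> borel_measurable borel"
        using n n0 by (intro max_sum_tail_borel XsH) auto
      show ?thesis unfolding T_def by (intro nn_integral_cmult) measurable
    qed
    finally show ?thesis .
  qed
  have "(\<Sum>j. if n0 \<le> Suc j then ennreal (real (Suc j) powr (r - 2)) *
        (\<integral>\<^sup>+x. ennreal (m (Suc j) x) * indicator {1<..} x \<partial>lborel) else 0)
    \<le> (\<Sum>j. ennreal (1 / \<kappa>) * (ennreal (real (Suc j) powr (r - 2)) * T (Suc j)))"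
  proof (rule suminf_le)
    fix j
    show "(if n0 \<le> Suc j then ennreal (real (Suc j) powr (r - 2)) *
        (\<integral>\<^sup>+x. ennreal (m (Suc j) x) * indicator {1<..} x \<partial>lborel) else 0)
      \<le> ennreal (1 / \<kappa>) * (ennreal (real (Suc j) powr (r - 2)) * T (Suc j))"
    proof (cases "n0 \<le> Suc j")
      case True
      have "ennreal (real (Suc j) powr (r - 2)) * (\<integral>\<^sup>+x. ennreal (m (Suc j) x) * indicator {1<..} x \<partial>lborel)
        \<le> ennreal (real (Suc j) powr (r - 2)) * (ennreal (1 / \<kappa>) * T (Suc j))"
        by (intro mult_left_mono le True) auto
      with True show ?thesis by (simp add: mult_ac del: of_nat_Suc)
    qed simp
  qed auto
  also have "\<dots> = ennreal (1 / \<kappa>) * (\<Sum>j. ennreal (real (Suc j) powr (r - 2)) * T (Suc j))"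
    by (rule ennreal_suminf_cmult)
  also have "\<dots> < \<infinity>" using fin unfolding T_def by (simp add: ennreal_mult_less_top)
  finally show ?thesis
    unfolding m_def by (intro tail_weight_integral_finite_of_capped_sums[OF hX_props r th c n0])
qed

text \<open>The bound for the rows is the sum of three parts: the uncontrolled initial rows, the tails
  of the single summands, and the error of the truncation, where \<open>N\<close> is so large that the powers
  of \<open>n\<close> and of \<open>x\<close> are both summable.\<close>

lemma sufficiency:
  assumes csub: "countably_subadditive_expectation M H E"
    and mean0: "q \<le> 1 \<Longrightarrow> E X = 0 \<and> E (\<lambda>\<omega>. - X \<omega>) = 0"
    and fin: "(\<integral>\<^sup>+u. ennreal (hX u * tail_weight (p * q / r) u) * indicator {exp 1..} u \<partial>lborel) < \<infinity>"
    and \<epsilon>: "0 < \<epsilon>"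
  shows "(\<Sum>j. ennreal (real (Suc j) powr (r - 2)) *
          (\<integral>\<^sup>+x. ennreal (max_sum_tail Xs (a (Suc j)) p (Suc j) x) * indicator {\<epsilon><..} x \<partial>lborel)) < \<infinity>"
proof -
  define \<theta> where "\<theta> = p * q / r"
  have th: "0 < \<theta>" using p q r by (simp add: \<theta>_def)
  have pth: "p / \<theta> = r / q" using p q r by (simp add: \<theta>_def)
  have hm: "(\<lambda>u. hX u) \<in> borel_measurable borel" by (rule tail_borel[OF Xp_measurable])
  \<comment> \<open>an exponent below the moments of \<open>X\<close>, above \<open>1/q\<close>, and on the correct side of one\<close>
  define m :: real where "m = (if q \<le> 1 then 2 else 1)"
  define \<tau> where "\<tau> = (1 / q + min m (r / q)) / 2"
  have "1 / q < m" using q by (auto simp: m_def field_simps)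
  moreover have "1 / q < r / q" using q r by (intro divide_strict_right_mono) auto
  ultimately have "1 / q < min m (r / q)" by simp
  moreover have "x < (x + y) / 2 \<and> (x + y) / 2 < y" if "x < y" for x y :: real using that by simp
  ultimately have "1 / q < \<tau> \<and> \<tau> < min m (r / q)" unfolding \<tau>_def by blast
  then have \<tau>: "1 / q < \<tau>" "\<tau> < m" "\<tau> < r / q" by simp_all
  have q0: "0 < 1 / q" using q by simp
  have "m \<le> 2" by (simp add: m_def)
  then have \<tau>02: "0 < \<tau>" "\<tau> \<le> 2" using less_trans[OF q0 \<tau>(1)] \<tau>(2) by simp_all
  have \<tau>1: "\<tau> \<le> 1 \<or> q \<le> 1 \<and> 1 \<le> \<tau>"
  proof (cases "q \<le> 1")
    case True
    then have "1 \<le> 1 / q" using q by simp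
    with True \<tau> show ?thesis by auto
  next
    case False
    then show ?thesis using \<tau> by (auto simp: m_def)
  qed
  define \<eta> where "\<eta> = q * \<tau> - 1"
  have eta: "0 < \<eta>" using \<tau>(1) q by (simp add: \<eta>_def field_simps)
  obtain C where C: "0 < C" "\<And>u. 1 \<le> u \<Longrightarrow> hX u \<le> C * u powr (- (1 / \<theta>))"
    using tail_decay[OF hX_props th fin[folded \<theta>_def]] by blast
  have decay: "cap E {\<omega>\<in>space M. w < \<bar>Xs i \<omega>\<bar>} \<le> C * w powr (- (r / q))" if i: "i \<ge> 1" and w: "1 \<le> w" for i w
  proof -
    have "cap E {\<omega>\<in>space M. w < \<bar>Xs i \<omega>\<bar>} = hX (w powr p)"
      using scaled_tail_eq[OF id[OF i] XsH[OF i] XH, of w 1 p] w p by simp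
    also have "\<dots> \<le> C * (w powr p) powr (- (1 / \<theta>))"
      using w p by (intro C ge_one_powr_ge_zero) auto
    also have "(w powr p) powr (- (1 / \<theta>)) = w powr (- (r / q))"
      using pth by (simp add: powr_powr)
    finally show ?thesis .
  qed
  obtain L where L: "0 \<le> L" "\<And>i. i \<ge> 1 \<Longrightarrow> E (\<lambda>\<omega>. trunc_powr \<tau> (Xs i \<omega>)) \<le> ereal L"
    using E_trunc_powr_finite[OF csub \<tau>02 \<tau>(3), of C] decay XsH by blast
  have mean: "\<tau> \<le> 1 \<or> E (Xs i) = 0 \<and> E (\<lambda>\<omega>. - Xs i \<omega>) = 0" if i: "i \<ge> 1" for i
    using \<tau>1 ident_distrib_mean[OF id[OF i] XsH[OF i] XH _ _ _ \<tau>02(2) L(2)[OF i]] mean0 by auto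
  \<comment> \<open>\<open>N > r / \<eta>\<close> makes the error of row \<open>n\<close> summable in \<open>n\<close>, and \<open>N > p / \<tau>\<close> integrable in \<open>x\<close>\<close>
  define N where "N = max (r / \<eta>) (p / \<tau>) + 1"
  have N: "0 < N" "r < \<eta> * N" "1 < \<tau> * N / p"
  proof -
    have a: "r / \<eta> < N" "p / \<tau> < N" by (auto simp: N_def)
    have "0 < r / \<eta>" using r eta by simp
    then show "0 < N" using a(1) by (rule less_trans)
    show "r < \<eta> * N" "1 < \<tau> * N / p" using a eta \<tau>02 p by (simp_all add: field_simps)
  qed
  obtain c K where c: "0 < c" and K: "0 \<le> K" and upper: "\<forall>n\<ge>n0. \<forall>x>0. max_sum_tail Xs (a n) p n x
    \<le> (\<Sum>i=1..n. hX (c * x * threshold r \<theta> i n)) + K * real n powr (- (\<eta> * N)) * x powr (- (\<tau> * N / p))"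
    using max_sum_tail_upper[OF \<tau>02 \<tau>(3) N(1) L(2,1) mean] unfolding \<theta>_def \<eta>_def by blast
  define T where "T = (\<lambda>n. \<integral>\<^sup>+x. ennreal (max_sum_tail Xs (a n) p n x) * indicator {\<epsilon><..} x \<partial>lborel)"
  define S where "S = (\<lambda>n. \<Sum>i=1..n. \<integral>\<^sup>+x. ennreal (hX (x * threshold r \<theta> i n)) * indicator {c * \<epsilon><..} x \<partial>lborel)"
  define P where "P = (\<integral>\<^sup>+x. ennreal (x powr (- (\<tau> * N / p))) * indicator {\<epsilon><..} x \<partial>lborel)"
  have P: "P < \<infinity>" unfolding P_def by (rule nn_integral_powr_tail_finite[OF N(3) \<epsilon>])
  have row: "T n \<le> ennreal (1 / c) * S n + ennreal (K * real n powr (- (\<eta> * N))) * P" if n: "n0 \<le> n" for n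
  proof -
    have "T n \<le> (\<integral>\<^sup>+x. (\<Sum>i=1..n. ennreal (hX (c * x * threshold r \<theta> i n)) * indicator {\<epsilon><..} x)
        + ennreal (K * real n powr (- (\<eta> * N))) * (ennreal (x powr (- (\<tau> * N / p))) * indicator {\<epsilon><..} x) \<partial>lborel)"
      unfolding T_def
    proof (rule nn_integral_mono)
      fix x :: real
      show "ennreal (max_sum_tail Xs (a n) p n x) * indicator {\<epsilon><..} x
        \<le> (\<Sum>i=1..n. ennreal (hX (c * x * threshold r \<theta> i n)) * indicator {\<epsilon><..} x)
          + ennreal (K * real n powr (- (\<eta> * N))) * (ennreal (x powr (- (\<tau> * N / p))) * indicator {\<epsilon><..} x)"
      proof (cases "\<epsilon> < x")
        case True
        then have "ennreal (max_sum_tail Xs (a n) p n x) \<le> ennreal ((\<Sum>i=1..n. hX (c * x * threshold r \<theta> i n))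
           + K * real n powr (- (\<eta> * N)) * x powr (- (\<tau> * N / p)))"
          using upper n \<epsilon> by (intro ennreal_leI) auto
        also have "\<dots> = (\<Sum>i=1..n. ennreal (hX (c * x * threshold r \<theta> i n)))
           + ennreal (K * real n powr (- (\<eta> * N))) * ennreal (x powr (- (\<tau> * N / p)))"
          using K hX_props(2) by (simp add: ennreal_plus sum_nonneg sum_ennreal ennreal_mult)
        finally show ?thesis using True by simp
      qed simp
    qed
    also have "\<dots> = (\<Sum>i=1..n. \<integral>\<^sup>+x. ennreal (hX (c * x * threshold r \<theta> i n)) * indicator {\<epsilon><..} x \<partial>lborel)
        + ennreal (K * real n powr (- (\<eta> * N))) * P"
    proof -
      have m: "(\<lambda>x. ennreal (hX (c * x * threshold r \<theta> i n)) * indicator {\<epsilon><..} x) \<in> borel_measurable lborel" for i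
        using measurable_compose[OF _ hm, of "\<lambda>x. c * x * threshold r \<theta> i n" lborel] by simp
      have s1: "(\<integral>\<^sup>+x. (\<Sum>i=1..n. ennreal (hX (c * x * threshold r \<theta> i n)) * indicator {\<epsilon><..} x) \<partial>lborel)
          = (\<Sum>i=1..n. \<integral>\<^sup>+x. ennreal (hX (c * x * threshold r \<theta> i n)) * indicator {\<epsilon><..} x \<partial>lborel)"
        by (intro nn_integral_sum m)
      have s2: "(\<integral>\<^sup>+x. ennreal (K * real n powr (- (\<eta> * N))) * (ennreal (x powr (- (\<tau> * N / p))) * indicator {\<epsilon><..} x) \<partial>lborel)
          = ennreal (K * real n powr (- (\<eta> * N))) * P"
        unfolding P_def by (intro nn_integral_cmult) measurable
      show ?thesis
        unfolding s1[symmetric] s2[symmetric]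
        by (intro nn_integral_add borel_measurable_sum m) measurable
    qed
    finally show ?thesis unfolding tail_integral_rescale[OF hm c] sum_distrib_left[symmetric] S_def .
  qed
  have hfin: "(\<integral>\<^sup>+u. ennreal (hX u) * indicator {0<..} u \<partial>lborel) < \<infinity>"
  proof -
    have "(\<integral>\<^sup>+u. ennreal (hX u) * indicator {exp 1..} u \<partial>lborel)
      \<le> (\<integral>\<^sup>+u. ennreal (hX u * tail_weight \<theta> u) * indicator {exp 1..} u \<partial>lborel)"
    proof (rule nn_integral_mono)
      fix u
      show "ennreal (hX u) * indicator {exp 1..} u \<le> ennreal (hX u * tail_weight \<theta> u) * indicator {exp 1..} u"
      proof (cases "exp 1 \<le> u")
        case True
        have "hX u * 1 \<le> hX u * tail_weight \<theta> u"
          using tail_weight_ge(2)[OF th True] hX_props(2) by (intro mult_left_mono) auto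
        with True show ?thesis by (simp add: ennreal_leI)
      qed simp
    qed
    then have "(\<integral>\<^sup>+u. ennreal (hX u) * indicator {exp 1..} u \<partial>lborel) < \<infinity>"
      using fin unfolding \<theta>_def by (rule order.strict_trans1)
    then show ?thesis using tail_integral_finite_cong[OF hm hX_props(3), of "exp 1"] by simp
  qed
  define F where "F = (\<lambda>j. if Suc j < n0 then ennreal (real (Suc j) powr (r - 2)) * T (Suc j) else 0)"
  have F: "(\<Sum>j. F j) < \<infinity>"
  proof -
    have "(\<Sum>j. F j) = (\<Sum>j<n0. F j)" by (rule suminf_finite) (auto simp: F_def)
    moreover have "F j < \<infinity>" for j
      using max_sum_tail_row_finite[OF _ \<epsilon> hfin, of "Suc j" "a (Suc j)"]
      by (simp add: F_def T_def ennreal_mult_less_top del: of_nat_Suc)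
    ultimately show ?thesis by simp
  qed
  define G where "G = (\<lambda>j. ennreal (1 / c) * (ennreal (real (Suc j) powr (r - 2)) * S (Suc j)))"
  have G: "(\<Sum>j. G j) < \<infinity>"
  proof -
    have "(\<Sum>j. ennreal (real (Suc j) powr (r - 2)) * S (Suc j)) < \<infinity>"
      unfolding S_def using c \<epsilon> by (intro tail_sum_finite[OF hX_props r th _ fin[folded \<theta>_def]]) auto
    then show ?thesis unfolding G_def by (simp add: ennreal_suminf_cmult ennreal_mult_less_top del: of_nat_Suc)
  qed
  define R where "R = (\<lambda>j. ennreal (real (Suc j) powr (- 2)) * (ennreal K * P))"
  have R: "(\<Sum>j. R j) < \<infinity>"
  proof -
    have "summable (\<lambda>n. real n powr (- 2))" by (simp add: summable_real_powr_iff)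
    then have "summable (\<lambda>j. real (Suc j) powr (- 2))" using summable_Suc_iff[of "\<lambda>n. real n powr (- 2)"] by simp
    then have "(\<Sum>j. ennreal (real (Suc j) powr (- 2))) < \<infinity>"
      by (subst suminf_ennreal2) auto
    then show ?thesis unfolding R_def using P by (simp add: ennreal_suminf_multc ennreal_mult_less_top del: of_nat_Suc)
  qed
  have "(\<Sum>j. ennreal (real (Suc j) powr (r - 2)) * T (Suc j)) \<le> (\<Sum>j. F j + (G j + R j))"
  proof (rule suminf_le)
    fix j
    define n where "n = Suc j"
    show "ennreal (real (Suc j) powr (r - 2)) * T (Suc j) \<le> F j + (G j + R j)"
    proof (cases "n0 \<le> Suc j")
      case True
      have "ennreal (real n powr (r - 2)) * T n
        \<le> ennreal (real n powr (r - 2)) * (ennreal (1 / c) * S n + ennreal (K * real n powr (- (\<eta> * N))) * P)"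
        using True by (intro mult_left_mono row) (auto simp: n_def)
      also have "\<dots> = G j + ennreal (real n powr (r - 2)) * ennreal (K * real n powr (- (\<eta> * N))) * P"
        by (simp add: G_def n_def distrib_left mult_ac del: of_nat_Suc)
      also have "ennreal (real n powr (r - 2)) * ennreal (K * real n powr (- (\<eta> * N))) * P \<le> R j"
      proof -
        have "real n powr (r - 2) * (K * real n powr (- (\<eta> * N))) = K * real n powr (r - 2 - \<eta> * N)"
          by (simp add: powr_add[symmetric] powr_diff powr_minus_divide)
        also have "\<dots> \<le> K * real n powr (- 2)"
          using N(2) K by (intro mult_left_mono powr_mono) (auto simp: n_def)
        finally have "ennreal (real n powr (r - 2)) * ennreal (K * real n powr (- (\<eta> * N))) \<le> ennreal (real n powr (- 2)) * ennreal K"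
          using K by (simp add: ennreal_mult[symmetric] ennreal_leI mult_ac)
        then have "ennreal (real n powr (r - 2)) * ennreal (K * real n powr (- (\<eta> * N))) * P
          \<le> ennreal (real n powr (- 2)) * ennreal K * P" by (intro mult_right_mono) auto
        then show ?thesis by (simp add: R_def n_def mult.assoc del: of_nat_Suc)
      qed
      finally show ?thesis unfolding n_def by (simp add: add_increasing add_left_mono del: of_nat_Suc)
    next
      case False
      then have "F j = ennreal (real (Suc j) powr (r - 2)) * T (Suc j)" by (simp add: F_def)
      then show ?thesis by (simp add: add_increasing2 del: of_nat_Suc)
    qed
  qed auto
  also have "\<dots> = (\<Sum>j. F j) + ((\<Sum>j. G j) + (\<Sum>j. R j))"
    by (simp add: suminf_add[symmetric])
  also have "\<dots> < \<infinity>" using F G R by simp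
  finally show ?thesis unfolding T_def .
qed

end

end

theorem theorem3p2:
  fixes M :: "'a measure" and H :: "('a \<Rightarrow> real) set" and E :: "('a \<Rightarrow> real) \<Rightarrow> ereal"
    and Xs :: "nat \<Rightarrow> 'a \<Rightarrow> real" and X :: "'a \<Rightarrow> real"
    and a :: "nat \<Rightarrow> nat \<Rightarrow> real" and p r q \<beta> :: real
  assumes "sublinear_expectation_space M H E"
    and "countably_subadditive_expectation M H E"
    and "X \<in> H" and "\<And>n. n \<ge> 1 \<Longrightarrow> Xs n \<in> H"
    and "indep_seq H E Xs"
    and "\<And>n. n \<ge> 1 \<Longrightarrow> ident_distrib H E (Xs n) X"
    and "p > 0" and "r > 1" and "q > 1/2" and "\<beta> = - q / r"
    and "1/2 < q \<and> q \<le> 1 \<Longrightarrow> E X = 0 \<and> - E (\<lambda>\<omega>. - X \<omega>) = 0"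
    and "array_equiv a (\<lambda>n i. (real i / real n) powr \<beta> * (1 / real n powr q))"
  shows "(\<forall>\<epsilon>>0. (\<Sum>j. let n = Suc j in ereal (real n powr (r - 2)) *
              Choquet M E (\<lambda>\<omega>. max ((MAX k\<in>{1..n}. \<bar>\<Sum>i=1..k. a n i * Xs i \<omega>\<bar> powr p) - \<epsilon>) 0)) < \<infinity>)
     \<longleftrightarrow>
         (p > r / q \<longrightarrow> Choquet M E (\<lambda>\<omega>. \<bar>X \<omega>\<bar> powr p) < \<infinity>) \<and>
         (p = r / q \<longrightarrow> Choquet M E (\<lambda>\<omega>. \<bar>X \<omega>\<bar> powr (r / q) * (ln \<bar>X \<omega>\<bar>)\<^sup>2) < \<infinity>) \<and>
         (p < r / q \<longrightarrow> Choquet M E (\<lambda>\<omega>. \<bar>X \<omega>\<bar> powr (r / q) * ln \<bar>X \<omega>\<bar>) < \<infinity>)"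
proof -
  interpret sublinear_expectation_space M H E by (rule assms(1))
  obtain Ca where Ca: "1 \<le> Ca" "\<forall>\<^sub>F n in sequentially. \<forall>i\<in>{1..n}.
      model_weight q r n i / Ca \<le> a n i \<and> a n i \<le> Ca * model_weight q r n i"
    using assms(12) unfolding array_equiv_def assms(10) model_weight_def[abs_def] by blast
  then obtain n1 where n1: "\<forall>n\<ge>n1. \<forall>i\<in>{1..n}.
      model_weight q r n i / Ca \<le> a n i \<and> a n i \<le> Ca * model_weight q r n i"
    by (auto simp: eventually_sequentially)
  define n0 where "n0 = max 1 n1"
  have n0: "1 \<le> n0" "\<And>n i. n0 \<le> n \<Longrightarrow> i \<in> {1..n} \<Longrightarrow> model_weight q r n i / Ca \<le> a n i \<and> a n i \<le> Ca * model_weight q r n i"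
    using n1 by (auto simp: n0_def)
  have Xm: "X \<in> borel_measurable M" using assms(3) H_measurable by auto
  have s: "0 < r / q" "p / (r / q) = p * q / r" using assms(7-9) by auto
  have mean: "E X = 0 \<and> E (\<lambda>\<omega>. - X \<omega>) = 0" if "q \<le> 1"
    using assms(9,11) that by (simp add: ereal_uminus_eq_reorder)
  define J where "J = (\<integral>\<^sup>+u. ennreal (cap E {\<omega>\<in>space M. u < \<bar>X \<omega>\<bar> powr p} * tail_weight (p * q / r) u)
          * indicator {exp 1..} u \<partial>lborel)"
  define T where "T = (\<lambda>\<epsilon>. \<Sum>j. ennreal (real (Suc j) powr (r - 2)) *
          (\<integral>\<^sup>+x. ennreal (max_sum_tail Xs (a (Suc j)) p (Suc j) x) * indicator {\<epsilon><..} x \<partial>lborel))"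
  have nec: "J < \<infinity>" if "T 1 < \<infinity>"
    unfolding J_def
    by (rule necessity[OF assms(5) _ assms(3) _ assms(7,9,8) Ca(1) n0(1) _ that[unfolded T_def]])
       (use assms(4,6) n0(2) in auto)
  have suf: "T \<epsilon> < \<infinity>" if "J < \<infinity>" "0 < \<epsilon>" for \<epsilon>
    unfolding T_def
    by (rule sufficiency[OF assms(5) _ assms(3) _ assms(7,9,8) Ca(1) n0(1) _ assms(2) mean that[unfolded J_def]])
       (use assms(4,6) n0(2) in auto)
  have "(\<forall>\<epsilon>>0. T \<epsilon> < \<infinity>) \<longleftrightarrow> J < \<infinity>"
    using nec suf zero_less_one by blast
  moreover have "(\<Sum>j. let n = Suc j in ereal (real n powr (r - 2)) *
              Choquet M E (\<lambda>\<omega>. max ((MAX k\<in>{1..n}. \<bar>\<Sum>i=1..k. a n i * Xs i \<omega>\<bar> powr p) - \<epsilon>) 0)) < \<infinity>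
      \<longleftrightarrow> T \<epsilon> < \<infinity>" for \<epsilon>
    unfolding T_def by (rule Choquet_series_finite_iff) (rule assms(4))
  ultimately show ?thesis
    unfolding moment_condition_iff[OF Xm assms(7) s(1), unfolded s(2)] J_def by simp
qed

end
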